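(* Let $F:\mathbb{D}^n\rightarrow\mathbb{R}^{n+1}$ be a smooth minimal immersed $n$-disk with free boundary on the unit sphere $\mathbb{S}^n\subset\mathbb{R}^{n+1}$, that is, $F(\partial\mathbb{D}^n)=F(\mathbb{D}^n)\cap\mathbb{S}^n$ and $\langle\nu^M,\nu^{\mathbb{S}^n}\rangle=0$ along $F(\partial\mathbb{D}^n)$, where $\nu^M$ is a unit normal along $F$ and $\nu^{\mathbb{S}^n}$ the outer unit normal of $\mathbb{S}^n$. Let $M:=F(\mathbb{D}^n)$ and suppose $M$ is not a standard flat disk. Then \[\Big(\sup_{M}|A|^2\Big)^2 > n\inf_{\partial M}|A|^2,\] where $A$ is the second fundamental form of $M$ and $\partial M=F(\partial\mathbb{D}^n)$.
   Context: $|A|^2$ denotes the squared norm of the second fundamental form of the immersion $F$ with respect to the induced metric. *)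

theory Defs
  imports "HOL-Analysis.Analysis"
begin

fun higher_dir :: "(real^'n \<Rightarrow> real^'m) \<Rightarrow> (real^'n) list \<Rightarrow> real^'n \<Rightarrow> real^'m" where
  "higher_dir f [] = f"
| "higher_dir f (v # vs) = (\<lambda>x. frechet_derivative (higher_dir f vs) (at x) v)"

definition smooth_on :: "(real^'n) set \<Rightarrow> (real^'n \<Rightarrow> real^'m) \<Rightarrow> bool" where
  "smooth_on U f \<longleftrightarrow> open U \<and> (\<forall>vs. higher_dir f vs differentiable_on U)"

definition dF :: "(real^'n \<Rightarrow> real^'m) \<Rightarrow> 'n \<Rightarrow> real^'n \<Rightarrow> real^'m" where
  "dF F i x = frechet_derivative F (at x) (axis i 1)"

definition ddF :: "(real^'n \<Rightarrow> real^'m) \<Rightarrow> 'n \<Rightarrow> 'n \<Rightarrow> real^'n \<Rightarrow> real^'m" where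
  "ddF F i j x = frechet_derivative (dF F j) (at x) (axis i 1)"

definition metric_mat :: "(real^'n \<Rightarrow> real^'m) \<Rightarrow> real^'n \<Rightarrow> real^'n^'n" where
  "metric_mat F x = (\<chi> i j. dF F i x \<bullet> dF F j x)"

definition sff_mat :: "(real^'n \<Rightarrow> real^'m) \<Rightarrow> (real^'n \<Rightarrow> real^'m) \<Rightarrow> real^'n \<Rightarrow> real^'n^'n" where
  "sff_mat F nu x = (\<chi> i j. ddF F i j x \<bullet> nu x)"

definition mean_curv :: "(real^'n \<Rightarrow> real^'m) \<Rightarrow> (real^'n \<Rightarrow> real^'m) \<Rightarrow> real^'n \<Rightarrow> real" where
  "mean_curv F nu x = trace (matrix_inv (metric_mat F x) ** sff_mat F nu x)"

text \<open>|A|^2 = g^ik g^jl h_ij h_kl = trace ((g^-1 h)^2).\<close>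
definition sqA :: "(real^'n \<Rightarrow> real^'m) \<Rightarrow> (real^'n \<Rightarrow> real^'m) \<Rightarrow> real^'n \<Rightarrow> real" where
  "sqA F nu x = trace (matrix_inv (metric_mat F x) ** sff_mat F nu x
                       ** matrix_inv (metric_mat F x) ** sff_mat F nu x)"

end

theory Submission
  imports Defs
begin

text \<open>
  Put \<open>s = |A|\<^sup>2\<close>. Simons' identity gives \<open>\<Delta>s = 2|\<nabla>A|\<^sup>2 - 2s\<^sup>2\<close>, minimality gives \<open>\<Delta>|F|\<^sup>2 = 2n\<close>,
  and at the free boundary, where \<open>F\<close> is the outer conormal and a principal direction, the
  conormal derivatives satisfy \<open>\<partial>s \<le> -2s\<close> and \<open>\<partial>|F|\<^sup>2 = 2\<close>. Let \<open>S\<close> be the maximum of \<open>s\<close> and \<open>I\<close> its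
  infimum over the boundary, and suppose that \<open>S > 0\<close>. Then \<open>s\<close> is not maximal at any boundary
  point, so \<open>I < S\<close>. If \<open>S\<^sup>2 \<le> n I\<close>, then for \<open>\<delta> = 1/(6S)\<close> there is a constant \<open>c\<close> with
  \<open>S\<^sup>2(1 - 2\<delta>S) < c n < n I(1 - 2\<delta>I)\<close>, and \<open>s - \<delta>s\<^sup>2 + c|F|\<^sup>2\<close> is strictly subharmonic with strictly
  negative conormal derivative, so it cannot attain its maximum. If \<open>S = 0\<close>, the normal is
  constant up to sign and the image is a flat disk.
\<close>

section \<open>Smooth real functions on open sets\<close>

text \<open>\<open>nu\<close> is a pointwise choice of unit normal with no continuity assumed.
  Differential identities are therefore proved with a smooth normal \<open>N\<close> built near one
  point; \<open>nu\<close> equals it up to a sign depending on the point, which neither |A|^2 nor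
  the equation H = 0 sees. Minimality is known only over the closed disk: Simons' identity, which
  differentiates H = 0, is used in the interior, and at the boundary the gradient of H vanishes by
  continuity.

  The weight c of |F|^2 has to beat -2s^2 in the interior, through 2nc, and to stay below s on the
  boundary, where it adds 2c to the conormal derivative; this is where the factor n comes from. If
  S^2 = n I, no c meets both demands strictly. The term with \<delta> opens a gap, since I < S makes
  its factor smaller at S than at I. It costs 2\<delta>|grad s|^2, at most 8\<delta>s|nabla A|^2,
  and also scales Simons' gain 2|nabla A|^2 by 1 - 2\<delta>s. What is left of the gain is 2(1 -
  6\<delta>s)|nabla A|^2, hence the choice of \<delta>.\<close>

definition pd :: "'n \<Rightarrow> (real^'n \<Rightarrow> real) \<Rightarrow> real^'n \<Rightarrow> real" where
  "pd i f x = frechet_derivative f (at x) (axis i 1)"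

text \<open>Each order asks for Frechet differentiability rather than mere existence of partials, so
  the \<open>pd\<close> determine the whole derivative. For real-valued functions, closure under
  products and quotients is then an induction on the order.\<close>

fun times_differentiable :: "nat \<Rightarrow> (real^'n) set \<Rightarrow> (real^'n \<Rightarrow> real) \<Rightarrow> bool" where
  "times_differentiable 0 V f = True"
| "times_differentiable (Suc k) V f =
     ((\<forall>x\<in>V. f differentiable (at x)) \<and> (\<forall>i. times_differentiable k V (pd i f)))"

definition smooth_fun :: "(real^'n) set \<Rightarrow> (real^'n \<Rightarrow> real) \<Rightarrow> bool" where
  "smooth_fun V f \<longleftrightarrow> (\<forall>k. times_differentiable k V f)"

lemma smooth_fun_differentiable: "smooth_fun V f \<Longrightarrow> x \<in> V \<Longrightarrow> f differentiable (at x)"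
  unfolding smooth_fun_def by (drule spec[of _ "Suc 0"]) simp

lemma smooth_fun_pd [intro]: "smooth_fun V f \<Longrightarrow> smooth_fun V (pd i f)"
  unfolding smooth_fun_def
proof
  fix k assume "\<forall>k. times_differentiable k V f"
  then have "times_differentiable (Suc k) V f" by blast
  then show "times_differentiable k V (pd i f)" by simp
qed

text \<open>Functions that agree near x have the same candidate derivatives, so
  \<open>frechet_derivative\<close> makes the same choice for both even where no derivative
  exists.\<close>

lemma pd_cong:
  assumes "open V" "x \<in> V" "\<And>y. y \<in> V \<Longrightarrow> f y = g y"
  shows "pd i f x = pd i g x"
proof -
  have "(f has_derivative f') (at x) \<longleftrightarrow> (g has_derivative f') (at x)" for f'
    using has_derivative_transform_within_open[of f f' x UNIV V g]
      has_derivative_transform_within_open[of g f' x UNIV V f] assms by auto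
  then show ?thesis unfolding pd_def frechet_derivative_def by simp
qed

lemma times_differentiable_cong:
  assumes "open V" "\<And>y. y \<in> V \<Longrightarrow> f y = g y" "times_differentiable k V f"
  shows "times_differentiable k V g"
  using assms(2,3)
proof (induction k arbitrary: f g)
  case (Suc k)
  have "g differentiable (at x)" if "x \<in> V" for x
  proof -
    have "f differentiable (at x)" using Suc.prems(2) that by simp
    then obtain f' where "(f has_derivative f') (at x)" unfolding differentiable_def by blast
    from has_derivative_transform_within_open[OF this assms(1) that Suc.prems(1)]
    show ?thesis unfolding differentiable_def by blast
  qed
  moreover have "times_differentiable k V (pd i g)" for i
  proof (rule Suc.IH)
    show "pd i f y = pd i g y" if "y \<in> V" for y
      by (rule pd_cong[OF assms(1) that Suc.prems(1)])
    show "times_differentiable k V (pd i f)" using Suc.prems(2) by simp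
  qed
  ultimately show ?case by simp
qed simp

lemma smooth_fun_cong:
  assumes "open V" "\<And>y. y \<in> V \<Longrightarrow> f y = g y" "smooth_fun V f"
  shows "smooth_fun V g"
  using assms times_differentiable_cong unfolding smooth_fun_def by blast

text \<open>For the product rule, where one factor stays undifferentiated while the order
  drops.\<close>

lemma times_differentiable_Suc_D: "times_differentiable (Suc k) V f \<Longrightarrow> times_differentiable k V f"
  by (induction k arbitrary: f) auto

lemma times_differentiable_subset:
  "times_differentiable k V f \<Longrightarrow> W \<subseteq> V \<Longrightarrow> times_differentiable k W f"
  by (induction k arbitrary: f) auto

lemma smooth_fun_subset: "smooth_fun V f \<Longrightarrow> W \<subseteq> V \<Longrightarrow> smooth_fun W f"
  unfolding smooth_fun_def using times_differentiable_subset by blast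

lemma pd_const [simp]: "pd i (\<lambda>x. c) = (\<lambda>x. 0)"
  unfolding pd_def by (simp add: frechet_derivative_const)

lemma pd_eqI: "(f has_derivative f') (at x) \<Longrightarrow> pd i f x = f' (axis i 1)"
  unfolding pd_def by (metis frechet_derivative_at)

lemma pd_add:
  "f differentiable (at x) \<Longrightarrow> g differentiable (at x) \<Longrightarrow>
    pd i (\<lambda>x. f x + g x) x = pd i f x + pd i g x"
  using pd_eqI[OF has_derivative_add] by (auto simp: pd_def frechet_derivative_works)

lemma pd_sum:
  assumes "\<And>k. f k differentiable (at x)"
  shows "pd i (\<lambda>x. \<Sum>k\<in>I. f k x) x = (\<Sum>k\<in>I. pd i (f k) x)"
  unfolding pd_def[of i "f _"]
proof (rule pd_eqI)
  have "(f k has_derivative frechet_derivative (f k) (at x)) (at x)" for k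
    using assms by (simp add: frechet_derivative_works)
  then show "((\<lambda>x. \<Sum>k\<in>I. f k x) has_derivative (\<lambda>v. \<Sum>k\<in>I. frechet_derivative (f k) (at x) v)) (at x)"
    by (rule has_derivative_sum)
qed

lemma pd_mult:
  "f differentiable (at x) \<Longrightarrow> g differentiable (at x) \<Longrightarrow>
    pd i (\<lambda>x. f x * g x) x = pd i f x * g x + f x * pd i g x"
  using pd_eqI[OF has_derivative_mult] by (fastforce simp: pd_def frechet_derivative_works)

lemma pd_chain:
  fixes f :: "real^'n \<Rightarrow> real"
  assumes "f differentiable (at x)" "(h has_real_derivative d) (at (f x))"
  shows "pd i (\<lambda>x. h (f x)) x = d * pd i f x"
proof -
  have "(f has_derivative frechet_derivative f (at x)) (at x)"
    using assms(1) by (simp add: frechet_derivative_works)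
  from diff_chain_at[OF this, of h "(*) d"] assms(2)
  have "((\<lambda>x. h (f x)) has_derivative (\<lambda>v. d * frechet_derivative f (at x) v)) (at x)"
    by (simp add: has_field_derivative_def o_def)
  then have "frechet_derivative (\<lambda>x. h (f x)) (at x) = (\<lambda>v. d * frechet_derivative f (at x) v)"
    by (metis frechet_derivative_at)
  then show ?thesis by (simp add: pd_def)
qed

lemma pd_sum_squares:
  assumes "\<And>k. f k differentiable (at x)"
  shows "pd i (\<lambda>x. \<Sum>k\<in>I. f k x * f k x) x = 2 * (\<Sum>k\<in>I. f k x * pd i (f k) x)"
  using assms by (simp add: pd_sum pd_mult sum_distrib_left mult_ac)

lemma times_differentiable_const: "times_differentiable k V (\<lambda>x. c)"
  by (induction k arbitrary: c) auto

lemma smooth_fun_const [intro, simp]: "smooth_fun V (\<lambda>x. c)"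
  by (simp add: smooth_fun_def times_differentiable_const)

lemma times_differentiable_add:
  assumes "open V" "times_differentiable k V f" "times_differentiable k V g"
  shows "times_differentiable k V (\<lambda>x. f x + g x)"
  using assms(2,3)
proof (induction k arbitrary: f g)
  case (Suc k)
  have "times_differentiable k V (pd i (\<lambda>x. f x + g x))" for i
  proof (rule times_differentiable_cong[OF assms(1)])
    show "pd i f x + pd i g x = pd i (\<lambda>x. f x + g x) x" if "x \<in> V" for x
      using Suc.prems that by (simp add: pd_add[of f x g])
    show "times_differentiable k V (\<lambda>x. pd i f x + pd i g x)"
      using Suc.prems by (intro Suc.IH) auto
  qed
  then show ?case using Suc.prems by auto
qed simp

lemma smooth_fun_add [intro]:
  "open V \<Longrightarrow> smooth_fun V f \<Longrightarrow> smooth_fun V g \<Longrightarrow> smooth_fun V (\<lambda>x. f x + g x)"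
  by (simp add: smooth_fun_def times_differentiable_add)

lemma times_differentiable_mult:
  assumes "open V" "times_differentiable k V f" "times_differentiable k V g"
  shows "times_differentiable k V (\<lambda>x. f x * g x)"
  using assms(2,3)
proof (induction k arbitrary: f g)
  case (Suc k)
  have "times_differentiable k V (pd i (\<lambda>x. f x * g x))" for i
  proof (rule times_differentiable_cong[OF assms(1)])
    show "pd i f x * g x + f x * pd i g x = pd i (\<lambda>x. f x * g x) x" if "x \<in> V" for x
      using Suc.prems that by (simp add: pd_mult[of f x g])
    show "times_differentiable k V (\<lambda>x. pd i f x * g x + f x * pd i g x)"
      using Suc.prems times_differentiable_Suc_D[OF Suc.prems(1)] times_differentiable_Suc_D[OF Suc.prems(2)]
      by (intro times_differentiable_add[OF assms(1)] Suc.IH) auto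
  qed
  then show ?case using Suc.prems by auto
qed simp

lemma smooth_fun_mult [intro]:
  "open V \<Longrightarrow> smooth_fun V f \<Longrightarrow> smooth_fun V g \<Longrightarrow> smooth_fun V (\<lambda>x. f x * g x)"
  by (simp add: smooth_fun_def times_differentiable_mult)

lemma smooth_fun_minus [intro]:
  "open V \<Longrightarrow> smooth_fun V f \<Longrightarrow> smooth_fun V (\<lambda>x. - f x)"
  using smooth_fun_mult[OF _ smooth_fun_const[of V "-1"]] by simp

lemma smooth_fun_diff [intro]:
  "open V \<Longrightarrow> smooth_fun V f \<Longrightarrow> smooth_fun V g \<Longrightarrow> smooth_fun V (\<lambda>x. f x - g x)"
  using smooth_fun_add[OF _ _ smooth_fun_minus] by simp

lemma smooth_fun_sum [intro]:
  "open V \<Longrightarrow> (\<And>i. i \<in> I \<Longrightarrow> smooth_fun V (f i)) \<Longrightarrow> smooth_fun V (\<lambda>x. \<Sum>i\<in>I. f i x)"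
  by (induction I rule: infinite_finite_induct) auto

lemma smooth_fun_prod [intro]:
  "open V \<Longrightarrow> (\<And>i. i \<in> I \<Longrightarrow> smooth_fun V (f i)) \<Longrightarrow> smooth_fun V (\<lambda>x. \<Prod>i\<in>I. f i x)"
  by (induction I rule: infinite_finite_induct) auto

text \<open>The partials of 1/f are polynomial in 1/f and the partials of f, so order k of 1/f
  yields order k + 1.\<close>

lemma smooth_fun_inverse [intro]:
  fixes f :: "real^'n \<Rightarrow> real"
  assumes V: "open V" and f: "smooth_fun V f" and nz: "\<And>x. x \<in> V \<Longrightarrow> f x \<noteq> 0"
  shows "smooth_fun V (\<lambda>x. inverse (f x))"
proof -
  have "times_differentiable k V (\<lambda>x. inverse (f x))" for k
  proof (induction k)
    case (Suc k)
    have "pd i (\<lambda>x. inverse (f x)) x = - (inverse (f x) * inverse (f x)) * pd i f x"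
      if "x \<in> V" for x i
      using pd_chain[OF smooth_fun_differentiable[OF f that] DERIV_inverse[OF nz[OF that]]]
      by (simp add: power2_eq_square numeral_2_eq_2)
    moreover have "times_differentiable k V (\<lambda>x. - 1 * (inverse (f x) * inverse (f x)) * pd i f x)" for i
      using Suc f smooth_fun_pd[OF f, of i] V
      by (intro times_differentiable_mult times_differentiable_const) (auto simp: smooth_fun_def)
    ultimately have "times_differentiable k V (pd i (\<lambda>x. inverse (f x)))" for i
      using times_differentiable_cong[OF V, of "\<lambda>x. - 1 * (inverse (f x) * inverse (f x)) * pd i f x"
          "pd i (\<lambda>x. inverse (f x))" k] by simp
    moreover have "(\<lambda>x. inverse (f x)) differentiable (at x)" if "x \<in> V" for x
      using smooth_fun_differentiable[OF f that] nz[OF that] by (intro differentiable_inverse) auto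
    ultimately show ?case by simp
  qed simp
  then show ?thesis by (simp add: smooth_fun_def)
qed

text \<open>Writing 1/(2 sqrt f) as sqrt f / (2 f) expresses the partials through sqrt f itself and
  the inverse of f, so the induction on the order closes.\<close>

lemma smooth_fun_sqrt:
  fixes f :: "real^'n \<Rightarrow> real"
  assumes V: "open V" and f: "smooth_fun V f" and pos: "\<And>x. x \<in> V \<Longrightarrow> f x > 0"
  shows "smooth_fun V (\<lambda>x. sqrt (f x))"
proof -
  have *: "((\<lambda>x. sqrt (f x)) differentiable (at x)) \<and>
      pd i (\<lambda>x. sqrt (f x)) x = (sqrt (f x) * (1/2) * inverse (f x)) * pd i f x" if "x \<in> V" for x i
  proof -
    have "inverse (sqrt (f x)) / 2 = sqrt (f x) * (1/2) * inverse (f x)"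
      using pos[OF that] by (simp add: field_simps)
    then have "pd i (\<lambda>x. sqrt (f x)) x = (sqrt (f x) * (1/2) * inverse (f x)) * pd i f x"
      using pd_chain[OF smooth_fun_differentiable[OF f that] DERIV_real_sqrt[OF pos[OF that]]] by metis
    moreover have "sqrt differentiable (at (f x))"
      using DERIV_real_sqrt[OF pos[OF that]] by (meson differentiableI field_differentiable_def field_differentiable_imp_differentiable)
    then have "(sqrt \<circ> f) differentiable (at x)"
      using smooth_fun_differentiable[OF f that] by (rule differentiable_chain_at[rotated])
    ultimately show ?thesis by (simp add: o_def)
  qed
  have "times_differentiable k V (\<lambda>x. sqrt (f x))" for k
  proof (induction k)
    case (Suc k)
    have "times_differentiable k V (\<lambda>x. (sqrt (f x) * (1/2) * inverse (f x)) * pd i f x)" for i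
      using Suc smooth_fun_pd[OF f, of i] smooth_fun_inverse[OF V f] pos V
      by (intro times_differentiable_mult times_differentiable_const)
        (force simp: smooth_fun_def)+
    then have "times_differentiable k V (pd i (\<lambda>x. sqrt (f x)))" for i
      using * times_differentiable_cong[OF V, of "\<lambda>x. (sqrt (f x) * (1/2) * inverse (f x)) * pd i f x"
          "pd i (\<lambda>x. sqrt (f x))" k] by simp
    then show ?case using * by simp
  qed simp
  then show ?thesis by (simp add: smooth_fun_def)
qed

section \<open>Directional derivatives, symmetry of second partials, conditions at a maximum\<close>

lemma frechet_derivative_eq_sum_pd:
  fixes f :: "real^'n \<Rightarrow> real"
  assumes "f differentiable (at x)"
  shows "frechet_derivative f (at x) v = (\<Sum>i\<in>UNIV. v $ i * pd i f x)"
proof -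
  have l: "linear (frechet_derivative f (at x))"
    using assms by (rule linear_frechet_derivative)
  have "frechet_derivative f (at x) v = frechet_derivative f (at x) (\<Sum>i\<in>UNIV. v $ i *s axis i 1)"
    by (simp add: basis_expansion)
  also have "\<dots> = (\<Sum>i\<in>UNIV. v $ i * pd i f x)"
    by (simp add: linear_sum[OF l] scalar_mult_eq_scaleR linear_scale[OF l] pd_def)
  finally show ?thesis .
qed

lemma has_derivative_pd:
  fixes f :: "real^'n \<Rightarrow> real"
  assumes "f differentiable (at x)"
  shows "(f has_derivative (\<lambda>v. \<Sum>i\<in>UNIV. v $ i * pd i f x)) (at x)"
  using assms frechet_derivative_eq_sum_pd[OF assms] by (metis (no_types, lifting) ext frechet_derivative_works)

lemma has_real_derivative_along_line:
  fixes f :: "real^'n \<Rightarrow> real"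
  assumes "f differentiable (at (x + t *\<^sub>R v))"
  shows "((\<lambda>t. f (x + t *\<^sub>R v)) has_real_derivative (\<Sum>i\<in>UNIV. v $ i * pd i f (x + t *\<^sub>R v))) (at t)"
proof -
  have "((\<lambda>t. x + t *\<^sub>R v) has_derivative (\<lambda>h. h *\<^sub>R v)) (at t)"
    by (auto intro!: derivative_eq_intros)
  from diff_chain_at[OF this has_derivative_pd[OF assms]]
  have "((\<lambda>t. f (x + t *\<^sub>R v)) has_derivative
      (\<lambda>h. \<Sum>i\<in>UNIV. (h *\<^sub>R v) $ i * pd i f (x + t *\<^sub>R v))) (at t)"
    by (simp add: o_def)
  moreover have "(\<lambda>h. \<Sum>i\<in>UNIV. (h *\<^sub>R v) $ i * pd i f (x + t *\<^sub>R v))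
      = (*) (\<Sum>i\<in>UNIV. v $ i * pd i f (x + t *\<^sub>R v))"
    by (auto simp: fun_eq_iff sum_distrib_left mult_ac)
  ultimately show ?thesis by (simp add: has_field_derivative_def)
qed

lemma smooth_fun_continuous_on: "smooth_fun V f \<Longrightarrow> continuous_on V f"
  by (meson continuous_at_imp_continuous_on differentiable_imp_continuous_within smooth_fun_differentiable)

text \<open>Both mixed partials are limits of the same second difference quotient.\<close>

lemma second_difference_eq_pd:
  fixes f :: "real^'n \<Rightarrow> real"
  assumes f: "smooth_fun V f" and h: "h > 0" and ball: "ball x r \<subseteq> V" and r: "2 * h < r"
  shows "\<exists>y. dist x y \<le> 2 * h \<and>
    f (x + h *\<^sub>R axis i 1 + h *\<^sub>R axis j 1) - f (x + h *\<^sub>R axis i 1) - f (x + h *\<^sub>R axis j 1) + f x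
      = h * (h * pd j (pd i f) y)"
proof -
  let ?a = "axis i 1 :: real^'n" and ?b = "axis j 1 :: real^'n"
  have dist: "dist x (x + s *\<^sub>R ?a + t *\<^sub>R ?b) \<le> 2 * h" if "0 \<le> s" "s \<le> h" "0 \<le> t" "t \<le> h" for s t
  proof -
    have "norm (s *\<^sub>R ?a + t *\<^sub>R ?b) \<le> norm (s *\<^sub>R ?a) + norm (t *\<^sub>R ?b)" by (rule norm_triangle_ineq)
    also have "\<dots> \<le> 2 * h" using that by simp
    finally show ?thesis
      using norm_minus_cancel[of "s *\<^sub>R ?a + t *\<^sub>R ?b"] by (simp add: dist_norm algebra_simps)
  qed
  have inV: "x + s *\<^sub>R ?a + t *\<^sub>R ?b \<in> V" if "0 \<le> s" "s \<le> h" "0 \<le> t" "t \<le> h" for s t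
    using dist[OF that] r ball by auto
  have axis: "(\<Sum>k\<in>UNIV. axis l 1 $ k * c k) = c l" for c :: "'n \<Rightarrow> real" and l
    by (simp add: axis_def if_distrib[of "\<lambda>x. x * _"] cong: if_cong)
  \<comment> \<open>The second difference is \<open>\<phi> h - \<phi> 0\<close>. One mean value in
    direction i and one in direction j leave a single mixed partial at an intermediate
    point.\<close>
  define \<phi> where "\<phi> s = f ((x + h *\<^sub>R ?b) + s *\<^sub>R ?a) - f (x + s *\<^sub>R ?a)" for s
  have "(\<phi> has_real_derivative (pd i f ((x + h *\<^sub>R ?b) + s *\<^sub>R ?a) - pd i f (x + s *\<^sub>R ?a))) (at s)"
    if "0 \<le> s" "s \<le> h" for s
    unfolding \<phi>_def
    using has_real_derivative_along_line[OF smooth_fun_differentiable[OF f], of "x + h *\<^sub>R ?b" s ?a]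
      has_real_derivative_along_line[OF smooth_fun_differentiable[OF f], of "x" s ?a]
      inV[OF that, of h] inV[OF that, of 0] h
    by (intro DERIV_diff) (auto simp: axis algebra_simps)
  from MVT2[OF h, of \<phi>, OF this] obtain s where s: "0 < s" "s < h"
    "\<phi> h - \<phi> 0 = h * (pd i f ((x + h *\<^sub>R ?b) + s *\<^sub>R ?a) - pd i f (x + s *\<^sub>R ?a))"
    by auto
  have "((\<lambda>t. pd i f (x + s *\<^sub>R ?a + t *\<^sub>R ?b)) has_real_derivative
      pd j (pd i f) (x + s *\<^sub>R ?a + t *\<^sub>R ?b)) (at t)" if "0 \<le> t" "t \<le> h" for t
    using has_real_derivative_along_line[OF smooth_fun_differentiable[OF smooth_fun_pd[OF f]],
        of "x + s *\<^sub>R ?a" t ?b i] inV[of s t] that s by (auto simp: axis)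
  from MVT2[OF h, of "\<lambda>t. pd i f (x + s *\<^sub>R ?a + t *\<^sub>R ?b)", OF this] obtain t where t: "0 < t" "t < h"
    "pd i f (x + s *\<^sub>R ?a + h *\<^sub>R ?b) - pd i f (x + s *\<^sub>R ?a + 0 *\<^sub>R ?b)
       = h * pd j (pd i f) (x + s *\<^sub>R ?a + t *\<^sub>R ?b)"
    by auto
  show ?thesis
    using s t dist[of s t] by (intro exI[of _ "x + s *\<^sub>R ?a + t *\<^sub>R ?b"]) (auto simp: \<phi>_def algebra_simps)
qed

lemma pd_commute:
  fixes f :: "real^'n \<Rightarrow> real"
  assumes V: "open V" and f: "smooth_fun V f" and x: "x \<in> V"
  shows "pd i (pd j f) x = pd j (pd i f) x"
proof (rule ccontr)
  assume ne: "pd i (pd j f) x \<noteq> pd j (pd i f) x"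
  define e where "e = \<bar>pd i (pd j f) x - pd j (pd i f) x\<bar> / 2"
  have e: "e > 0" using ne by (simp add: e_def)
  have cont: "isCont (pd i (pd j f)) x" for i j
    using smooth_fun_differentiable[OF smooth_fun_pd[OF smooth_fun_pd[OF f]] x]
    by (rule differentiable_imp_continuous_within)
  obtain r where r: "r > 0" "ball x r \<subseteq> V" using V x openE by blast
  obtain d where d: "d > 0" "\<And>y. dist y x < d \<Longrightarrow> dist (pd i (pd j f) y) (pd i (pd j f) x) < e"
    using cont[of i j] e unfolding continuous_at_eps_delta by blast
  obtain d' where d': "d' > 0" "\<And>y. dist y x < d' \<Longrightarrow> dist (pd j (pd i f) y) (pd j (pd i f) x) < e"
    using cont[of j i] e unfolding continuous_at_eps_delta by blast
  \<comment> \<open>The intermediate points lie within 2h of x; dividing by 3 keeps them strictly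
    inside all three balls.\<close>
  define h where "h = min r (min d d') / 3"
  have h: "h > 0" "2 * h < r" "2 * h < d" "2 * h < d'" using r d d' by (auto simp: h_def)
  obtain y where y: "dist x y \<le> 2 * h"
    "f (x + h *\<^sub>R axis i 1 + h *\<^sub>R axis j 1) - f (x + h *\<^sub>R axis i 1) - f (x + h *\<^sub>R axis j 1) + f x
      = h * (h * pd j (pd i f) y)"
    using second_difference_eq_pd[OF f h(1) r(2) h(2)] by blast
  obtain z where z: "dist x z \<le> 2 * h"
    "f (x + h *\<^sub>R axis j 1 + h *\<^sub>R axis i 1) - f (x + h *\<^sub>R axis j 1) - f (x + h *\<^sub>R axis i 1) + f x
      = h * (h * pd i (pd j f) z)"
    using second_difference_eq_pd[OF f h(1) r(2) h(2)] by blast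
  have "h * (h * pd j (pd i f) y) = h * (h * pd i (pd j f) z)"
    using y(2) z(2) by (simp add: algebra_simps)
  then have "pd j (pd i f) y = pd i (pd j f) z" using h by simp
  moreover have "dist (pd j (pd i f) y) (pd j (pd i f) x) < e"
    using y(1) h by (intro d'(2)) (auto simp: dist_commute)
  moreover have "dist (pd i (pd j f) z) (pd i (pd j f) x) < e"
    using z(1) h by (intro d(2)) (auto simp: dist_commute)
  moreover have "\<bar>p - q\<bar> \<le> \<bar>w - p\<bar> + \<bar>w - q\<bar>" for p q w :: real by arith
  from this[of "pd i (pd j f) x" "pd j (pd i f) x" "pd i (pd j f) z"]
  have "2 * e \<le> dist (pd i (pd j f) z) (pd i (pd j f) x) + dist (pd i (pd j f) z) (pd j (pd i f) x)"
    by (simp add: e_def dist_real_def)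
  ultimately show False by simp
qed

lemma pd_eq_0_at_max:
  fixes f :: "real^'n \<Rightarrow> real"
  assumes "open V" "smooth_fun V f" "x \<in> V" "\<And>y. y \<in> V \<Longrightarrow> f y \<le> f x"
  shows "pd i f x = 0"
proof -
  have "(f has_derivative frechet_derivative f (at x)) (at x)"
    using assms smooth_fun_differentiable frechet_derivative_works by blast
  from differential_zero_maxmin[OF assms(3,1) this] assms(4)
  show ?thesis by (simp add: pd_def)
qed

text \<open>If the second derivative along v were positive, the first one, which is zero at x, would
  be positive just after x, and the mean value theorem would produce a larger value.\<close>

lemma second_derivative_at_max:
  fixes f :: "real^'n \<Rightarrow> real"
  assumes V: "open V" and f: "smooth_fun V f" and x: "x \<in> V" and max: "\<And>y. y \<in> V \<Longrightarrow> f y \<le> f x"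
  shows "(\<Sum>i\<in>UNIV. v $ i * (\<Sum>j\<in>UNIV. v $ j * pd j (pd i f) x)) \<le> 0"
proof (rule ccontr)
  let ?L = "\<Sum>i\<in>UNIV. v $ i * (\<Sum>j\<in>UNIV. v $ j * pd j (pd i f) x)"
  assume "\<not> ?L \<le> 0"
  then have L: "?L > 0" by simp
  define \<phi>' where "\<phi>' t = (\<Sum>i\<in>UNIV. v $ i * pd i f (x + t *\<^sub>R v))" for t
  have "((\<lambda>t. pd i f (x + t *\<^sub>R v)) has_real_derivative (\<Sum>j\<in>UNIV. v $ j * pd j (pd i f) x)) (at 0)" for i
    using has_real_derivative_along_line[OF smooth_fun_differentiable[OF smooth_fun_pd[OF f]],
        of x 0 v i] x by simp
  then have "(\<phi>' has_real_derivative ?L) (at 0)"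
    unfolding \<phi>'_def by (intro DERIV_sum DERIV_cmult)
  from DERIV_pos_inc_right[OF this L] obtain d where d: "d > 0" "\<And>h. 0 < h \<Longrightarrow> h < d \<Longrightarrow> \<phi>' 0 < \<phi>' h"
    by auto
  have "\<phi>' 0 = 0" unfolding \<phi>'_def using pd_eq_0_at_max[OF V f x max] by simp
  have "continuous (at 0) (\<lambda>t. x + t *\<^sub>R v)" by (intro continuous_intros)
  then have "\<forall>\<^sub>F t in at 0. x + t *\<^sub>R v \<in> V"
    using V x by (auto simp: continuous_at intro: topological_tendstoD)
  then obtain d2 where d2: "d2 > 0" "\<And>t. t \<noteq> 0 \<Longrightarrow> \<bar>t\<bar> < d2 \<Longrightarrow> x + t *\<^sub>R v \<in> V"
    by (auto simp: eventually_at dist_real_def)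
  have inV: "x + t *\<^sub>R v \<in> V" if "0 \<le> t" "t < d2" for t
    using d2(2)[of t] x that by (cases "t = 0") auto
  define h where "h = min d d2 / 2"
  have h: "0 < h" "h < d" "h < d2" using d d2 by (auto simp: h_def)
  have "((\<lambda>t. f (x + t *\<^sub>R v)) has_real_derivative \<phi>' t) (at t)" if "0 \<le> t" "t \<le> h" for t
    unfolding \<phi>'_def using that h inV
    by (intro has_real_derivative_along_line smooth_fun_differentiable[OF f]) auto
  from MVT2[OF h(1), of "\<lambda>t. f (x + t *\<^sub>R v)", OF this] obtain z where
    z: "0 < z" "z < h" "f (x + h *\<^sub>R v) - f (x + 0 *\<^sub>R v) = (h - 0) * \<phi>' z" by auto
  have "\<phi>' z > 0" using d(2)[of z] z h \<open>\<phi>' 0 = 0\<close> by auto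
  then have "f (x + h *\<^sub>R v) > f x" using z h by (simp add: algebra_simps)
  then show False using max[OF inV[of h]] h by auto
qed

section \<open>Tangential calculus on a hypersurface patch\<close>

text \<open>
  \<^term>\<open>E a i\<close> is the \<^term>\<open>i\<close>-th coordinate of the tangential projection of the \<^term>\<open>a\<close>-th
  standard basis vector, so that \<open>D a f\<close> below is the \<^term>\<open>a\<close>-th component of the tangential gradient
  of the immersion \<^term>\<open>X\<close> with unit normal \<^term>\<open>N\<close>. Computing with these extrinsic derivatives,
  which commute up to curvature terms, avoids Christoffel symbols; \<open>lap\<close> is the
  Laplace--Beltrami operator and \<open>s\<close> is the squared norm of the second fundamental form.
\<close>

locale hypersurface_patch =
  fixes V :: "(real^'n) set" and X N :: "'m::finite \<Rightarrow> real^'n \<Rightarrow> real"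
    and E :: "'m \<Rightarrow> 'n \<Rightarrow> real^'n \<Rightarrow> real"
  assumes open_V: "open V"
    and smooth_X: "smooth_fun V (X a)"
    and smooth_N: "smooth_fun V (N a)"
    and smooth_E: "smooth_fun V (E a i)"
    and N_N: "x \<in> V \<Longrightarrow> (\<Sum>a\<in>UNIV. N a x * N a x) = 1"
    and N_dX: "x \<in> V \<Longrightarrow> (\<Sum>a\<in>UNIV. N a x * pd i (X a) x) = 0"
    and E_dX: "x \<in> V \<Longrightarrow> (\<Sum>i\<in>UNIV. E b i x * pd i (X a) x) = (if a = b then 1 else 0) - N a x * N b x"
    and dX_E: "x \<in> V \<Longrightarrow> (\<Sum>a\<in>UNIV. E a i x * pd j (X a) x) = (if i = j then 1 else 0)"
    and N_E: "x \<in> V \<Longrightarrow> (\<Sum>a\<in>UNIV. N a x * E a i x) = 0"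
begin

definition D :: "'m \<Rightarrow> (real^'n \<Rightarrow> real) \<Rightarrow> real^'n \<Rightarrow> real" where
  "D a f x = (\<Sum>i\<in>UNIV. E a i x * pd i f x)"

text \<open>The shape operator up to sign, as an ambient matrix that annihilates the normal. Its
  trace and squared norm are then plain sums without the metric.\<close>

definition B :: "'m \<Rightarrow> 'm \<Rightarrow> real^'n \<Rightarrow> real" where
  "B a b = D a (N b)"

definition lap :: "(real^'n \<Rightarrow> real) \<Rightarrow> real^'n \<Rightarrow> real" where
  "lap f x = (\<Sum>c\<in>UNIV. D c (D c f) x)"

definition H :: "real^'n \<Rightarrow> real" where "H x = (\<Sum>a\<in>UNIV. B a a x)"

definition s :: "real^'n \<Rightarrow> real" where "s x = (\<Sum>a\<in>UNIV. \<Sum>b\<in>UNIV. B a b x * B a b x)"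

lemma smooth_D: "smooth_fun V f \<Longrightarrow> smooth_fun V (D a f)"
  using smooth_fun_sum[OF open_V, of UNIV "\<lambda>i x. E a i x * pd i f x"]
    smooth_fun_mult[OF open_V smooth_E smooth_fun_pd] by (simp add: D_def[abs_def])

lemma smooth_B: "smooth_fun V (B a b)"
  unfolding B_def by (intro smooth_D smooth_N)

lemma smooth_H: "smooth_fun V H"
  unfolding H_def[abs_def] by (intro smooth_fun_sum open_V smooth_B)

lemma smooth_s: "smooth_fun V s"
  unfolding s_def[abs_def] by (intro smooth_fun_sum smooth_fun_mult open_V smooth_B)

section \<open>Derivation rules for \<open>D\<close>, symmetry of the shape operator,
  commutators\<close>

lemma D_cong: "(\<And>y. y \<in> V \<Longrightarrow> f y = g y) \<Longrightarrow> x \<in> V \<Longrightarrow> D a f x = D a g x"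
  unfolding D_def using pd_cong[OF open_V, of x f g] by auto

lemma D_const [simp]: "D a (\<lambda>x. c) = (\<lambda>x. 0)"
  by (simp add: D_def[abs_def])

lemma D_add:
  "smooth_fun V f \<Longrightarrow> smooth_fun V g \<Longrightarrow> x \<in> V \<Longrightarrow> D a (\<lambda>x. f x + g x) x = D a f x + D a g x"
  by (simp add: D_def pd_add smooth_fun_differentiable algebra_simps sum.distrib)

lemma D_mult:
  "smooth_fun V f \<Longrightarrow> smooth_fun V g \<Longrightarrow> x \<in> V \<Longrightarrow>
    D a (\<lambda>x. f x * g x) x = D a f x * g x + f x * D a g x"
  by (simp add: D_def pd_mult smooth_fun_differentiable algebra_simps sum.distrib sum_distrib_left)

lemma D_cmult: "smooth_fun V f \<Longrightarrow> x \<in> V \<Longrightarrow> D a (\<lambda>x. c * f x) x = c * D a f x"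
  by (simp add: D_mult[of "\<lambda>_. c"])

lemma D_diff:
  "smooth_fun V f \<Longrightarrow> smooth_fun V g \<Longrightarrow> x \<in> V \<Longrightarrow> D a (\<lambda>x. f x - g x) x = D a f x - D a g x"
  using D_add[of f "\<lambda>x. -1 * g x" x a] D_cmult[of g x a "-1"] smooth_fun_minus[OF open_V, of g] by simp

lemma D_sum:
  "(\<And>i. smooth_fun V (f i)) \<Longrightarrow> x \<in> V \<Longrightarrow> D a (\<lambda>x. \<Sum>i\<in>I. f i x) x = (\<Sum>i\<in>I. D a (f i) x)"
proof (induction I rule: infinite_finite_induct)
  case (insert i I)
  then show ?case by (simp add: D_add smooth_fun_sum[OF open_V])
qed simp_all

lemma N_D: "x \<in> V \<Longrightarrow> (\<Sum>a\<in>UNIV. N a x * D a f x) = 0"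
proof -
  assume x: "x \<in> V"
  have "(\<Sum>a\<in>UNIV. N a x * D a f x) = (\<Sum>a\<in>UNIV. \<Sum>i\<in>UNIV. N a x * E a i x * pd i f x)"
    by (simp add: D_def sum_distrib_left mult.assoc)
  also have "\<dots> = (\<Sum>i\<in>UNIV. \<Sum>a\<in>UNIV. N a x * E a i x * pd i f x)" by (rule sum.swap)
  also have "\<dots> = (\<Sum>i\<in>UNIV. (\<Sum>a\<in>UNIV. N a x * E a i x) * pd i f x)" by (simp add: sum_distrib_right)
  finally show ?thesis using N_E[OF x] by simp
qed

lemma pd_eq_sum_D: "x \<in> V \<Longrightarrow> pd j f x = (\<Sum>a\<in>UNIV. pd j (X a) x * D a f x)"
proof -
  assume x: "x \<in> V"
  have "(\<Sum>a\<in>UNIV. pd j (X a) x * D a f x) = (\<Sum>a\<in>UNIV. \<Sum>i\<in>UNIV. E a i x * pd j (X a) x * pd i f x)"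
    by (simp add: D_def sum_distrib_left mult_ac)
  also have "\<dots> = (\<Sum>i\<in>UNIV. \<Sum>a\<in>UNIV. E a i x * pd j (X a) x * pd i f x)" by (rule sum.swap)
  also have "\<dots> = (\<Sum>i\<in>UNIV. (\<Sum>a\<in>UNIV. E a i x * pd j (X a) x) * pd i f x)" by (simp add: sum_distrib_right)
  also have "\<dots> = pd j f x" using dX_E[OF x] by (simp add: if_distrib[of "\<lambda>x. x * _"] cong: if_cong)
  finally show ?thesis by simp
qed

lemma D_X: "x \<in> V \<Longrightarrow> D b (X a) x = (if a = b then 1 else 0) - N a x * N b x"
  unfolding D_def by (rule E_dX)

lemma N_dN: "x \<in> V \<Longrightarrow> (\<Sum>b\<in>UNIV. N b x * pd i (N b) x) = 0"
proof -
  assume x: "x \<in> V"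
  have "pd i (\<lambda>x. \<Sum>b\<in>UNIV. N b x * N b x) x = pd i (\<lambda>x. 1) x"
    by (rule pd_cong[OF open_V x]) (rule N_N)
  moreover have "pd i (\<lambda>x. \<Sum>b\<in>UNIV. N b x * N b x) x = 2 * (\<Sum>b\<in>UNIV. N b x * pd i (N b) x)"
    by (rule pd_sum_squares) (rule smooth_fun_differentiable[OF smooth_N x])
  ultimately show ?thesis by simp
qed

lemma B_N: "x \<in> V \<Longrightarrow> (\<Sum>b\<in>UNIV. B a b x * N b x) = 0"
proof -
  assume x: "x \<in> V"
  have "(\<Sum>b\<in>UNIV. B a b x * N b x) = (\<Sum>b\<in>UNIV. \<Sum>i\<in>UNIV. E a i x * (N b x * pd i (N b) x))"
    by (simp add: B_def D_def sum_distrib_right sum_distrib_left mult_ac)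
  also have "\<dots> = (\<Sum>i\<in>UNIV. \<Sum>b\<in>UNIV. E a i x * (N b x * pd i (N b) x))" by (rule sum.swap)
  also have "\<dots> = 0" using N_dN[OF x] by (simp add: sum_distrib_left[symmetric])
  finally show ?thesis .
qed

lemma dN_dX:
  "x \<in> V \<Longrightarrow> (\<Sum>a\<in>UNIV. pd i (N a) x * pd j (X a) x) = - (\<Sum>a\<in>UNIV. N a x * pd i (pd j (X a)) x)"
proof -
  assume x: "x \<in> V"
  have "pd i (\<lambda>x. \<Sum>a\<in>UNIV. N a x * pd j (X a) x) x = pd i (\<lambda>x. 0) x"
    by (rule pd_cong[OF open_V x]) (rule N_dX)
  moreover have "pd i (\<lambda>x. \<Sum>a\<in>UNIV. N a x * pd j (X a) x) x
      = (\<Sum>a\<in>UNIV. pd i (N a) x * pd j (X a) x + N a x * pd i (pd j (X a)) x)"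
    using smooth_fun_differentiable[OF smooth_N x] smooth_fun_differentiable[OF smooth_fun_pd[OF smooth_X] x]
    by (subst pd_sum) (auto simp: pd_mult)
  ultimately show ?thesis by (simp add: sum.distrib)
qed

lemma dN_dX_sym: "x \<in> V \<Longrightarrow> (\<Sum>a\<in>UNIV. pd i (N a) x * pd j (X a) x) = (\<Sum>a\<in>UNIV. pd j (N a) x * pd i (X a) x)"
  by (simp add: dN_dX pd_commute[OF open_V smooth_X, of x i j])

text \<open>As dN is tangential, it is determined by the form k = <dN, dX>. Differentiating <N, dX>
  = 0 gives k = -<N, ddX>, which is symmetric because second partials commute.\<close>

lemma B_sym: "x \<in> V \<Longrightarrow> B a b x = B b a x"
proof -
  assume x: "x \<in> V"
  define k where "k i j = (\<Sum>c\<in>UNIV. pd i (N c) x * pd j (X c) x)" for i j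
  have k: "k i j = k j i" for i j unfolding k_def by (rule dN_dX_sym[OF x])
  have dN: "pd i (N b) x = (\<Sum>j\<in>UNIV. E b j x * k i j)" for i b
  proof -
    have "(\<Sum>j\<in>UNIV. E b j x * k i j) = (\<Sum>j\<in>UNIV. \<Sum>c\<in>UNIV. E b j x * pd j (X c) x * pd i (N c) x)"
      by (simp add: k_def sum_distrib_left mult_ac)
    also have "\<dots> = (\<Sum>c\<in>UNIV. \<Sum>j\<in>UNIV. E b j x * pd j (X c) x * pd i (N c) x)" by (rule sum.swap)
    also have "\<dots> = (\<Sum>c\<in>UNIV. (\<Sum>j\<in>UNIV. E b j x * pd j (X c) x) * pd i (N c) x)" by (simp add: sum_distrib_right)
    also have "\<dots> = (\<Sum>c\<in>UNIV. (if c = b then 1 else 0) * pd i (N c) x) - N b x * (\<Sum>c\<in>UNIV. N c x * pd i (N c) x)"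
      by (simp add: E_dX[OF x] algebra_simps sum_subtractf sum_distrib_left)
    also have "\<dots> = pd i (N b) x"
      using N_dN[OF x] by (simp add: if_distrib[of "\<lambda>x. x * _"] cong: if_cong)
    finally show ?thesis by simp
  qed
  have B: "B a b x = (\<Sum>i\<in>UNIV. \<Sum>j\<in>UNIV. E a i x * E b j x * k i j)" for a b
    by (simp add: B_def D_def dN sum_distrib_left mult.assoc)
  have "B a b x = (\<Sum>j\<in>UNIV. \<Sum>i\<in>UNIV. E a i x * E b j x * k i j)" unfolding B by (rule sum.swap)
  also have "\<dots> = (\<Sum>j\<in>UNIV. \<Sum>i\<in>UNIV. E b j x * E a i x * k j i)" using k by (simp add: mult_ac)
  finally show ?thesis by (simp add: B)
qed

lemma N_B: "x \<in> V \<Longrightarrow> (\<Sum>a\<in>UNIV. N a x * B a b x) = 0"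
  unfolding B_def by (rule N_D)

lemma D_D:
  assumes f: "smooth_fun V f" and x: "x \<in> V"
  shows "D a (D b f) x = (\<Sum>i\<in>UNIV. \<Sum>j\<in>UNIV. E a i x * E b j x * pd i (pd j f) x) + (\<Sum>j\<in>UNIV. D a (E b j) x * pd j f x)"
proof -
  have "D a (D b f) x = D a (\<lambda>x. \<Sum>j\<in>UNIV. E b j x * pd j f x) x" by (simp add: D_def[abs_def])
  also have "\<dots> = (\<Sum>j\<in>UNIV. D a (\<lambda>x. E b j x * pd j f x) x)"
    by (intro D_sum smooth_fun_mult open_V smooth_E smooth_fun_pd f x)
  also have "\<dots> = (\<Sum>j\<in>UNIV. D a (E b j) x * pd j f x + E b j x * D a (pd j f) x)"
    by (simp add: D_mult smooth_E smooth_fun_pd f x)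
  also have "\<dots> = (\<Sum>j\<in>UNIV. D a (E b j) x * pd j f x) + (\<Sum>j\<in>UNIV. \<Sum>i\<in>UNIV. E a i x * E b j x * pd i (pd j f) x)"
    by (simp add: sum.distrib D_def[of a "pd _ f"] sum_distrib_left mult_ac)
  also have "(\<Sum>j\<in>UNIV. \<Sum>i\<in>UNIV. E a i x * E b j x * pd i (pd j f) x) = (\<Sum>i\<in>UNIV. \<Sum>j\<in>UNIV. E a i x * E b j x * pd i (pd j f) x)"
    by (rule sum.swap)
  finally show ?thesis by simp
qed

text \<open>The derivatives of \<open>E\<close> in \<open>D_D\<close> only multiply the gradient,
  which vanishes at a maximum; the rest is the Hessian evaluated on the vectors
  \<open>E a\<close>.\<close>

lemma lap_at_max:
  assumes f: "smooth_fun V f" and x: "x \<in> V" and max: "\<And>y. y \<in> V \<Longrightarrow> f y \<le> f x"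
  shows "lap f x \<le> 0"
proof -
  have "pd j f x = 0" for j by (rule pd_eq_0_at_max[OF open_V f x max])
  then have "D a (D a f) x = (\<Sum>i\<in>UNIV. \<Sum>j\<in>UNIV. E a i x * E a j x * pd i (pd j f) x)" for a
    by (simp add: D_D[OF f x])
  also have "\<dots> a \<le> 0" for a
    using second_derivative_at_max[OF open_V f x max, of "\<chi> i. E a i x"] pd_commute[OF open_V f x]
    by (simp add: sum_distrib_left mult.assoc)
  finally show ?thesis unfolding lap_def by (intro sum_nonpos)
qed

text \<open>The second-order parts cancel, so the commutator is a vector field with chart
  coefficients Y. They are found by testing on the coordinate functions, whose second derivatives
  follow from the projection matrix in \<open>D_X\<close>.\<close>

lemma D_commute:
  assumes f: "smooth_fun V f" and x: "x \<in> V"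
  shows "D a (D b f) x = D b (D a f) x + (\<Sum>c\<in>UNIV. (N a x * B b c x - N b x * B a c x) * D c f x)"
proof -
  define Y where "Y j = D a (E b j) x - D b (E a j) x" for j
  have bracket: "D a (D b f) x - D b (D a f) x = (\<Sum>j\<in>UNIV. Y j * pd j f x)" if f: "smooth_fun V f" for f
  proof -
    have "(\<Sum>i\<in>UNIV. \<Sum>j\<in>UNIV. E b i x * E a j x * pd i (pd j f) x) = (\<Sum>j\<in>UNIV. \<Sum>i\<in>UNIV. E b i x * E a j x * pd i (pd j f) x)"
      by (rule sum.swap)
    also have "\<dots> = (\<Sum>j\<in>UNIV. \<Sum>i\<in>UNIV. E a j x * E b i x * pd j (pd i f) x)"
      using pd_commute[OF open_V f x] by (simp add: mult_ac)
    finally show ?thesis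
      unfolding D_D[OF f x] Y_def by (simp add: algebra_simps sum_subtractf)
  qed
  have X: "(\<Sum>j\<in>UNIV. Y j * pd j (X c) x) = N a x * B b c x - N b x * B a c x" for c
  proof -
    have "D a (D b (X c)) x = - (B a c x * N b x + N c x * B a b x)" for a b
    proof -
      have "D a (D b (X c)) x = D a (\<lambda>x. (if c = b then 1 else 0) - N c x * N b x) x"
        by (rule D_cong[OF _ x]) (rule D_X)
      also have "\<dots> = 0 - D a (\<lambda>x. N c x * N b x) x"
        by (subst D_diff) (auto intro: smooth_fun_mult open_V smooth_N x)
      finally show ?thesis by (simp add: D_mult smooth_N x B_def)
    qed
    from this[of a b] this[of b a] show ?thesis
      using bracket[OF smooth_X, of c] B_sym[OF x, of a b] by (simp add: algebra_simps)
  qed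
  have "(\<Sum>j\<in>UNIV. Y j * pd j f x) = (\<Sum>j\<in>UNIV. \<Sum>c\<in>UNIV. Y j * pd j (X c) x * D c f x)"
    by (simp add: pd_eq_sum_D[OF x, of _ f] sum_distrib_left mult_ac)
  also have "\<dots> = (\<Sum>c\<in>UNIV. \<Sum>j\<in>UNIV. Y j * pd j (X c) x * D c f x)" by (rule sum.swap)
  also have "\<dots> = (\<Sum>c\<in>UNIV. (N a x * B b c x - N b x * B a c x) * D c f x)"
    by (simp add: sum_distrib_right[symmetric] X)
  finally show ?thesis using bracket[OF f] by simp
qed

lemma B_B_N: "x \<in> V \<Longrightarrow> (\<Sum>a\<in>UNIV. N a x * (\<Sum>d\<in>UNIV. B c d x * B d a x)) = 0"
proof -
  assume x: "x \<in> V"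
  have "(\<Sum>a\<in>UNIV. N a x * (\<Sum>d\<in>UNIV. B c d x * B d a x)) = (\<Sum>a\<in>UNIV. \<Sum>d\<in>UNIV. B c d x * (B d a x * N a x))"
    by (simp add: sum_distrib_left mult_ac)
  also have "\<dots> = (\<Sum>d\<in>UNIV. \<Sum>a\<in>UNIV. B c d x * (B d a x * N a x))" by (rule sum.swap)
  finally show ?thesis using B_N[OF x] by (simp add: sum_distrib_left[symmetric])
qed

text \<open>Symmetry of B turns D_c D_c N_b into D_c D_b N_c, which up to a commutator is the
  derivative of a trace: the traced Codazzi equation.\<close>

lemma lap_N: "x \<in> V \<Longrightarrow> lap (N b) x = D b H x - s x * N b x"
proof -
  assume x: "x \<in> V"
  have 1: "D c (D c (N b)) x = D b (B c c) x + (N c x * (\<Sum>d\<in>UNIV. B b d x * B d c x) - N b x * (\<Sum>d\<in>UNIV. B c d x * B c d x))" for c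
  proof -
    have "D c (D c (N b)) x = D c (D b (N c)) x"
      using B_sym by (intro D_cong[OF _ x]) (simp add: B_def)
    also have "\<dots> = D b (D c (N c)) x + (\<Sum>d\<in>UNIV. (N c x * B b d x - N b x * B c d x) * D d (N c) x)"
      by (rule D_commute[OF smooth_N x])
    also have "(\<Sum>d\<in>UNIV. (N c x * B b d x - N b x * B c d x) * D d (N c) x)
        = (\<Sum>d\<in>UNIV. (N c x * B b d x - N b x * B c d x) * B d c x)" by (simp add: B_def)
    also have "\<dots> = N c x * (\<Sum>d\<in>UNIV. B b d x * B d c x) - N b x * (\<Sum>d\<in>UNIV. B c d x * B d c x)"
      by (simp add: algebra_simps sum_subtractf sum_distrib_left)
    finally show ?thesis using B_sym[OF x, of _ c] by (simp add: B_def)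
  qed
  have "D b H x = (\<Sum>c\<in>UNIV. D b (B c c) x)"
    unfolding H_def[abs_def] by (rule D_sum[OF smooth_B x])
  then show ?thesis
    unfolding lap_def 1 using B_B_N[OF x, of b]
    by (simp add: sum.distrib sum_subtractf sum_distrib_left[symmetric] s_def mult.commute)
qed

lemma lap_add:
  assumes "smooth_fun V f" "smooth_fun V g" "x \<in> V"
  shows "lap (\<lambda>x. f x + g x) x = lap f x + lap g x"
proof -
  have "D c (D c (\<lambda>x. f x + g x)) x = D c (\<lambda>x. D c f x + D c g x) x" for c
    using assms by (intro D_cong) (auto simp: D_add)
  then show ?thesis using assms by (simp add: lap_def D_add smooth_D sum.distrib)
qed

lemma lap_mult:
  assumes "smooth_fun V f" "smooth_fun V g" "x \<in> V"
  shows "lap (\<lambda>x. f x * g x) x = lap f x * g x + 2 * (\<Sum>c\<in>UNIV. D c f x * D c g x) + f x * lap g x"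
proof -
  have "D c (D c (\<lambda>x. f x * g x)) x = D c (\<lambda>x. D c f x * g x + f x * D c g x) x" for c
    using assms by (intro D_cong) (auto simp: D_mult)
  also have "D c (\<lambda>x. D c f x * g x + f x * D c g x) x
      = D c (D c f) x * g x + 2 * (D c f x * D c g x) + f x * D c (D c g) x" for c
    using assms by (simp add: D_add D_mult smooth_D smooth_fun_mult open_V)
  finally show ?thesis
    by (simp add: lap_def sum.distrib sum_distrib_left sum_distrib_right)
qed

lemma lap_cmult: "smooth_fun V f \<Longrightarrow> x \<in> V \<Longrightarrow> lap (\<lambda>x. c * f x) x = c * lap f x"
  using lap_mult[of "\<lambda>_. c" f x] by (simp add: lap_def)

lemma lap_sum:
  "(\<And>i. smooth_fun V (f i)) \<Longrightarrow> x \<in> V \<Longrightarrow> lap (\<lambda>x. \<Sum>i\<in>I. f i x) x = (\<Sum>i\<in>I. lap (f i) x)"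
proof (induction I rule: infinite_finite_induct)
  case (insert i I)
  then show ?case by (simp add: lap_add smooth_fun_sum[OF open_V])
qed (simp_all add: lap_def)

text \<open>Lets a patch shrink to the open ball, where a maximum over the closed ball is a local
  one and H = 0 holds on a whole neighbourhood.\<close>

lemma subset_patch: "open W \<Longrightarrow> W \<subseteq> V \<Longrightarrow> hypersurface_patch W X N E"
  by unfold_locales
    (auto intro: smooth_fun_subset[OF smooth_X] smooth_fun_subset[OF smooth_N] smooth_fun_subset[OF smooth_E]
      simp: subset_iff N_N N_dX E_dX dX_E N_E)

end

text \<open>The corrected matrix has zero contraction with n, so the correction is minus the normal
  part of t. Its squared norm is 2|m|^2 because m is orthogonal to the unit vector n, and Pythagoras
  applies.\<close>

lemma sum_square_tangential_part:
  fixes t :: "'m::finite \<Rightarrow> 'm \<Rightarrow> real"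
  assumes nn: "(\<Sum>a\<in>UNIV. n a * n a) = 1" and nm: "(\<Sum>a\<in>UNIV. n a * m a) = 0"
    and l: "\<And>b. (\<Sum>a\<in>UNIV. n a * t a b) = - m b" and r: "\<And>a. (\<Sum>b\<in>UNIV. n b * t a b) = - m a"
  shows "(\<Sum>a\<in>UNIV. \<Sum>b\<in>UNIV. (t a b + n a * m b + n b * m a)\<^sup>2) = (\<Sum>a\<in>UNIV. \<Sum>b\<in>UNIV. (t a b)\<^sup>2) - 2 * (\<Sum>a\<in>UNIV. (m a)\<^sup>2)"
proof -
  have "(t a b + n a * m b + n b * m a)\<^sup>2 = (t a b)\<^sup>2 + n a * n a * (m b)\<^sup>2 + (m a)\<^sup>2 * (n b * n b)
     + 2 * (m b * (n a * t a b)) + 2 * (m a * (n b * t a b)) + 2 * (n a * m a) * (n b * m b)" for a b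
    by (simp add: power2_eq_square algebra_simps)
  then have "(\<Sum>a\<in>UNIV. \<Sum>b\<in>UNIV. (t a b + n a * m b + n b * m a)\<^sup>2)
    = (\<Sum>a\<in>UNIV. \<Sum>b\<in>UNIV. (t a b)\<^sup>2) + (\<Sum>a\<in>UNIV. \<Sum>b\<in>UNIV. n a * n a * (m b)\<^sup>2) + (\<Sum>a\<in>UNIV. \<Sum>b\<in>UNIV. (m a)\<^sup>2 * (n b * n b))
     + 2 * (\<Sum>a\<in>UNIV. \<Sum>b\<in>UNIV. m b * (n a * t a b)) + 2 * (\<Sum>a\<in>UNIV. \<Sum>b\<in>UNIV. m a * (n b * t a b))
     + (\<Sum>a\<in>UNIV. \<Sum>b\<in>UNIV. 2 * (n a * m a) * (n b * m b))"
    by (simp add: sum.distrib sum_distrib_left)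
  also have "(\<Sum>a\<in>UNIV. \<Sum>b\<in>UNIV. n a * n a * (m b)\<^sup>2) = (\<Sum>b\<in>UNIV. (m b)\<^sup>2)"
    by (simp add: sum_distrib_left[symmetric] sum_distrib_right[symmetric] nn)
  also have "(\<Sum>a\<in>UNIV. \<Sum>b\<in>UNIV. (m a)\<^sup>2 * (n b * n b)) = (\<Sum>b\<in>UNIV. (m b)\<^sup>2)"
    by (simp add: sum_distrib_left[symmetric] nn)
  also have "(\<Sum>a\<in>UNIV. \<Sum>b\<in>UNIV. m b * (n a * t a b)) = (\<Sum>b\<in>UNIV. \<Sum>a\<in>UNIV. m b * (n a * t a b))" by (rule sum.swap)
  also have "\<dots> = - (\<Sum>b\<in>UNIV. (m b)\<^sup>2)"
    by (simp add: sum_distrib_left[symmetric] l power2_eq_square sum_negf)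
  also have "(\<Sum>a\<in>UNIV. \<Sum>b\<in>UNIV. m a * (n b * t a b)) = - (\<Sum>b\<in>UNIV. (m b)\<^sup>2)"
    by (simp add: sum_distrib_left[symmetric] r power2_eq_square sum_negf)
  also have "(\<Sum>a\<in>UNIV. \<Sum>b\<in>UNIV. 2 * (n a * m a) * (n b * m b)) = 0"
    by (simp add: sum_distrib_left[symmetric] nm)
  finally show ?thesis by simp
qed

context hypersurface_patch
begin

section \<open>Commuting the Laplacian with tangential derivatives; Simons' identity\<close>

lemma N_D_D:
  assumes f: "smooth_fun V f" and x: "x \<in> V"
  shows "(\<Sum>c\<in>UNIV. N c x * D d (D c f) x) = - (\<Sum>c\<in>UNIV. B d c x * D c f x)"
proof -
  have "D d (\<lambda>x. \<Sum>c\<in>UNIV. N c x * D c f x) x = D d (\<lambda>x. 0) x"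
    by (rule D_cong[OF _ x]) (rule N_D)
  moreover have "D d (\<lambda>x. \<Sum>c\<in>UNIV. N c x * D c f x) x = (\<Sum>c\<in>UNIV. D d (\<lambda>x. N c x * D c f x) x)"
    by (intro D_sum smooth_fun_mult open_V smooth_N smooth_D f x)
  moreover have "\<dots> = (\<Sum>c\<in>UNIV. B d c x * D c f x) + (\<Sum>c\<in>UNIV. N c x * D d (D c f) x)"
    by (simp add: D_mult smooth_N smooth_D f x sum.distrib B_def)
  ultimately show ?thesis by simp
qed

text \<open>Moving \<open>D a\<close> out past two \<open>D c\<close> costs two commutators, each
  contributing one term -B^2. Geometrically, one is the Ricci term of the Gauss equation with H = 0,
  the other comes from taking ambient components of the gradient. All else is a multiple of N and
  dies against the tangential weight w.\<close>

lemma lap_D: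
  assumes f: "smooth_fun V f" and x: "x \<in> V" and H: "H x = 0" and w: "(\<Sum>a\<in>UNIV. w a * N a x) = 0"
  shows "(\<Sum>a\<in>UNIV. w a * lap (D a f) x)
    = (\<Sum>a\<in>UNIV. w a * D a (lap f) x) - 2 * (\<Sum>a\<in>UNIV. w a * (\<Sum>c\<in>UNIV. (\<Sum>d\<in>UNIV. B a d x * B d c x) * D c f x))"
proof -
  define M where "M a = (\<Sum>c\<in>UNIV. (\<Sum>d\<in>UNIV. B a d x * B d c x) * D c f x)" for a
  have M: "M a = (\<Sum>d\<in>UNIV. B a d x * (\<Sum>c\<in>UNIV. B d c x * D c f x))" for a
  proof -
    have "M a = (\<Sum>c\<in>UNIV. \<Sum>d\<in>UNIV. B a d x * (B d c x * D c f x))"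
      by (simp add: M_def sum_distrib_right mult.assoc)
    also have "\<dots> = (\<Sum>d\<in>UNIV. \<Sum>c\<in>UNIV. B a d x * (B d c x * D c f x))" by (rule sum.swap)
    finally show ?thesis by (simp add: sum_distrib_left)
  qed
  have sm: "smooth_fun V (\<lambda>x. N c x * (\<Sum>d\<in>UNIV. B a d x * D d f x))" for a c
    by (intro smooth_fun_sum smooth_fun_mult open_V smooth_N smooth_B smooth_D f)
  have smg: "smooth_fun V (\<lambda>x. \<Sum>d\<in>UNIV. B a d x * D d f x)" for a
    by (intro smooth_fun_sum smooth_fun_mult open_V smooth_B smooth_D f)
  \<comment> \<open>This factor of \<open>N a\<close> is the same for all a, so the weight cancels
    the term and R never has to be evaluated.\<close>
  define R where "R a = (\<Sum>c\<in>UNIV. D c (\<lambda>x. \<Sum>d\<in>UNIV. B c d x * D d f x) x)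
      + (\<Sum>c\<in>UNIV. \<Sum>d\<in>UNIV. B c d x * D d (D c f) x)" for a :: 'm
  have "lap (D a f) x = D a (lap f) x - 2 * M a - N a x * R a" for a
  proof -
    have 1: "D c (D c (D a f)) x = D c (D a (D c f)) x
        + (B c c x * (\<Sum>d\<in>UNIV. B a d x * D d f x) + N c x * D c (\<lambda>x. \<Sum>d\<in>UNIV. B a d x * D d f x) x)
        - (B c a x * (\<Sum>d\<in>UNIV. B c d x * D d f x) + N a x * D c (\<lambda>x. \<Sum>d\<in>UNIV. B c d x * D d f x) x)" for c
    proof -
      have "D c (D c (D a f)) x
        = D c (\<lambda>x. (D a (D c f) x + N c x * (\<Sum>d\<in>UNIV. B a d x * D d f x)) - N a x * (\<Sum>d\<in>UNIV. B c d x * D d f x)) x"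
        using D_commute[OF f]
        by (intro D_cong[OF _ x]) (simp add: algebra_simps sum_subtractf sum_distrib_left)
      also have "\<dots> = D c (D a (D c f)) x + D c (\<lambda>x. N c x * (\<Sum>d\<in>UNIV. B a d x * D d f x)) x
          - D c (\<lambda>x. N a x * (\<Sum>d\<in>UNIV. B c d x * D d f x)) x"
        by (simp add: D_diff D_add sm smooth_fun_add open_V smooth_D f x)
      finally show ?thesis
        by (simp only: D_mult[OF smooth_N smg x]) (simp only: B_def)
    qed
    have 2: "D c (D a (D c f)) x = D a (D c (D c f)) x
       + (N c x * (\<Sum>d\<in>UNIV. B a d x * D d (D c f) x) - N a x * (\<Sum>d\<in>UNIV. B c d x * D d (D c f) x))" for c
      unfolding D_commute[OF smooth_D[OF f] x, of c a]
      by (simp add: algebra_simps sum_subtractf sum_distrib_left)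
    have 3: "(\<Sum>c\<in>UNIV. D a (D c (D c f)) x) = D a (lap f) x"
      unfolding lap_def[abs_def] by (rule D_sum[symmetric]) (intro smooth_D f x)+
    have 4: "(\<Sum>c\<in>UNIV. B c c x * (\<Sum>d\<in>UNIV. B a d x * D d f x)) = 0"
      using H by (simp add: sum_distrib_right[symmetric] H_def)
    have 5: "(\<Sum>c\<in>UNIV. N c x * D c g x) = 0" for g by (rule N_D[OF x])
    have 6: "(\<Sum>c\<in>UNIV. B c a x * (\<Sum>d\<in>UNIV. B c d x * D d f x)) = M a"
      using B_sym[OF x] by (simp add: M)
    have "(\<Sum>c\<in>UNIV. N c x * (\<Sum>d\<in>UNIV. B a d x * D d (D c f) x)) = (\<Sum>c\<in>UNIV. \<Sum>d\<in>UNIV. B a d x * (N c x * D d (D c f) x))"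
      by (simp add: sum_distrib_left mult_ac)
    also have "\<dots> = (\<Sum>d\<in>UNIV. \<Sum>c\<in>UNIV. B a d x * (N c x * D d (D c f) x))" by (rule sum.swap)
    also have "\<dots> = - M a"
      by (simp add: sum_distrib_left[symmetric] N_D_D[OF f x] M sum_negf)
    finally have 7: "(\<Sum>c\<in>UNIV. N c x * (\<Sum>d\<in>UNIV. B a d x * D d (D c f) x)) = - M a" .
    have "lap (D a f) x = (\<Sum>c\<in>UNIV. D c (D a (D c f)) x) - M a
        - N a x * (\<Sum>c\<in>UNIV. D c (\<lambda>x. \<Sum>d\<in>UNIV. B c d x * D d f x) x)"
      unfolding lap_def 1 by (simp add: sum.distrib sum_subtractf 4 5 6 sum_distrib_left[symmetric])
    also have "(\<Sum>c\<in>UNIV. D c (D a (D c f)) x) = D a (lap f) x - M a - N a x * (\<Sum>c\<in>UNIV. \<Sum>d\<in>UNIV. B c d x * D d (D c f) x)"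
      unfolding 2 by (simp add: sum.distrib sum_subtractf 3 7 sum_distrib_left[symmetric])
    finally show ?thesis by (simp add: R_def algebra_simps)
  qed
  moreover have "R a = R b" for a b by (simp add: R_def)
  then have "(\<Sum>a\<in>UNIV. w a * (N a x * R a)) = (\<Sum>a\<in>UNIV. w a * N a x) * R undefined"
    by (simp add: sum_distrib_right mult.assoc) (metis (mono_tags, lifting))
  then have "(\<Sum>a\<in>UNIV. w a * (N a x * R a)) = 0" using w by simp
  ultimately show ?thesis
    by (simp add: right_diff_distrib sum_subtractf sum_distrib_left[symmetric] M_def[symmetric]
        mult.left_commute[of _ 2])
qed

lemma D_s: "x \<in> V \<Longrightarrow> D c s x = 2 * (\<Sum>a\<in>UNIV. \<Sum>b\<in>UNIV. B a b x * D c (B a b) x)"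
proof -
  assume x: "x \<in> V"
  have "D c s x = (\<Sum>a\<in>UNIV. D c (\<lambda>x. \<Sum>b\<in>UNIV. B a b x * B a b x) x)"
    unfolding s_def[abs_def] by (intro D_sum smooth_fun_sum smooth_fun_mult open_V smooth_B x)
  also have "\<dots> = (\<Sum>a\<in>UNIV. \<Sum>b\<in>UNIV. D c (\<lambda>x. B a b x * B a b x) x)"
    by (intro sum.cong refl D_sum smooth_fun_sum smooth_fun_mult open_V smooth_B x)
  finally show ?thesis
    by (simp add: D_mult smooth_B x sum_distrib_left mult_ac)
qed

text \<open>\<open>lap_D\<close> is applied to each component of N with weights
  \<open>B a b\<close>, after inserting lap N = -s N. The second sum is accounted for by the normal
  components hidden in \<open>D c (B a b)\<close>; \<open>simons\<close> separates them.\<close>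

lemma lap_s:
  assumes x: "x \<in> V" and H: "\<And>y. y \<in> V \<Longrightarrow> H y = 0"
  shows "lap s x = 2 * (\<Sum>c\<in>UNIV. \<Sum>a\<in>UNIV. \<Sum>b\<in>UNIV. (D c (B a b) x)\<^sup>2)
    - 4 * (\<Sum>a\<in>UNIV. \<Sum>c\<in>UNIV. (\<Sum>d\<in>UNIV. B a d x * B d c x)\<^sup>2) - 2 * (s x)\<^sup>2"
proof -
  define M where "M a c = (\<Sum>d\<in>UNIV. B a d x * B d c x)" for a c
  have 1: "lap s x = (\<Sum>a\<in>UNIV. \<Sum>b\<in>UNIV. 2 * (B a b x * lap (B a b) x) + 2 * (\<Sum>c\<in>UNIV. D c (B a b) x * D c (B a b) x))"
  proof -
    have "lap s x = (\<Sum>a\<in>UNIV. lap (\<lambda>x. \<Sum>b\<in>UNIV. B a b x * B a b x) x)"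
      unfolding s_def[abs_def] by (intro lap_sum smooth_fun_sum smooth_fun_mult open_V smooth_B x)
    also have "\<dots> = (\<Sum>a\<in>UNIV. \<Sum>b\<in>UNIV. lap (\<lambda>x. B a b x * B a b x) x)"
      by (intro sum.cong refl lap_sum smooth_fun_sum smooth_fun_mult open_V smooth_B x)
    finally show ?thesis by (simp add: lap_mult smooth_B x algebra_simps)
  qed
  have 2: "(\<Sum>a\<in>UNIV. B a b x * lap (B a b) x)
     = - (\<Sum>a\<in>UNIV. B a b x * (N b x * D a s x)) - s x * (\<Sum>a\<in>UNIV. B a b x * B a b x)
       - 2 * (\<Sum>a\<in>UNIV. B a b x * (\<Sum>c\<in>UNIV. M a c * B c b x))" for b
  proof -
    have "D a (lap (N b)) x = - (N b x * D a s x) - s x * B a b x" for a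
    proof -
      have "lap (N b) y = - 1 * (s y * N b y)" if "y \<in> V" for y
      proof -
        have "D b H y = D b (\<lambda>_. 0) y" using H that by (intro D_cong) auto
        then show ?thesis using lap_N[OF that, of b] by simp
      qed
      then have "D a (lap (N b)) x = D a (\<lambda>y. - 1 * (s y * N b y)) x"
        by (intro D_cong[OF _ x])
      also have "\<dots> = - 1 * D a (\<lambda>y. s y * N b y) x"
        by (intro D_cmult smooth_fun_mult open_V smooth_s smooth_N x)
      finally show ?thesis by (simp add: D_mult smooth_s smooth_N x B_def)
    qed
    then have "(\<Sum>a\<in>UNIV. B a b x * D a (lap (N b)) x)
        = - (\<Sum>a\<in>UNIV. B a b x * (N b x * D a s x)) - s x * (\<Sum>a\<in>UNIV. B a b x * B a b x)"
      by (simp add: right_diff_distrib sum_subtractf sum_negf sum_distrib_left mult_ac)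
    moreover have "(\<Sum>a\<in>UNIV. B a b x * N a x) = 0" using N_B[OF x, of b] by (simp add: mult.commute)
    ultimately show ?thesis
      using lap_D[OF smooth_N x H[OF x], of "\<lambda>a. B a b x" b]
      by (simp add: B_def[symmetric] M_def[symmetric])
  qed
  have 3: "(\<Sum>b\<in>UNIV. \<Sum>a\<in>UNIV. B a b x * (N b x * D a s x)) = 0"
  proof -
    have "(\<Sum>b\<in>UNIV. \<Sum>a\<in>UNIV. B a b x * (N b x * D a s x)) = (\<Sum>a\<in>UNIV. \<Sum>b\<in>UNIV. B a b x * N b x * D a s x)"
      by (subst sum.swap) (simp add: mult.assoc)
    then show ?thesis using B_N[OF x] by (simp add: sum_distrib_right[symmetric])
  qed
  have 4: "(\<Sum>b\<in>UNIV. \<Sum>a\<in>UNIV. B a b x * (\<Sum>c\<in>UNIV. M a c * B c b x)) = (\<Sum>a\<in>UNIV. \<Sum>c\<in>UNIV. (M a c)\<^sup>2)"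
  proof -
    have "(\<Sum>b\<in>UNIV. \<Sum>a\<in>UNIV. B a b x * (\<Sum>c\<in>UNIV. M a c * B c b x)) = (\<Sum>a\<in>UNIV. \<Sum>b\<in>UNIV. \<Sum>c\<in>UNIV. M a c * (B a b x * B b c x))"
      using B_sym[OF x] by (subst sum.swap) (simp add: sum_distrib_left mult_ac)
    also have "\<dots> = (\<Sum>a\<in>UNIV. \<Sum>c\<in>UNIV. \<Sum>b\<in>UNIV. M a c * (B a b x * B b c x))"
      by (intro sum.cong refl sum.swap)
    finally show ?thesis by (simp add: sum_distrib_left[symmetric] M_def power2_eq_square)
  qed
  have 5: "(\<Sum>a\<in>UNIV. \<Sum>b\<in>UNIV. B a b x * lap (B a b) x) = - (s x)\<^sup>2 - 2 * (\<Sum>a\<in>UNIV. \<Sum>c\<in>UNIV. (M a c)\<^sup>2)"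
  proof -
    have "(\<Sum>a\<in>UNIV. \<Sum>b\<in>UNIV. B a b x * lap (B a b) x) = (\<Sum>b\<in>UNIV. \<Sum>a\<in>UNIV. B a b x * lap (B a b) x)" by (rule sum.swap)
    also have "\<dots> = - s x * (\<Sum>b\<in>UNIV. \<Sum>a\<in>UNIV. B a b x * B a b x) - 2 * (\<Sum>a\<in>UNIV. \<Sum>c\<in>UNIV. (M a c)\<^sup>2)"
      unfolding 2 using 3 4
      by (simp add: sum_subtractf sum_negf sum_distrib_left[symmetric])
    also have "(\<Sum>b\<in>UNIV. \<Sum>a\<in>UNIV. B a b x * B a b x) = s x" unfolding s_def by (rule sum.swap)
    finally show ?thesis by (simp add: power2_eq_square)
  qed
  have "(\<Sum>a\<in>UNIV. \<Sum>b\<in>UNIV. \<Sum>c\<in>UNIV. D c (B a b) x * D c (B a b) x) = (\<Sum>a\<in>UNIV. \<Sum>c\<in>UNIV. \<Sum>b\<in>UNIV. (D c (B a b) x)\<^sup>2)"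
    unfolding power2_eq_square by (intro sum.cong refl sum.swap)
  also have "\<dots> = (\<Sum>c\<in>UNIV. \<Sum>a\<in>UNIV. \<Sum>b\<in>UNIV. (D c (B a b) x)\<^sup>2)" by (rule sum.swap)
  finally show ?thesis
    unfolding 1 using 5 by (simp add: sum.distrib sum_distrib_left[symmetric] M_def)
qed

text \<open>Simons' identity; \<open>\<tau>\<close> is the squared norm of the covariant derivative of the second fundamental
  form, obtained from \<open>D c (B a b)\<close> by removing the normal components.\<close>

lemma simons:
  assumes x: "x \<in> V" and H: "\<And>y. y \<in> V \<Longrightarrow> H y = 0"
  obtains \<tau> where "\<tau> \<ge> 0" "lap s x = 2 * \<tau> - 2 * (s x)\<^sup>2" "(\<Sum>c\<in>UNIV. (D c s x)\<^sup>2) \<le> 4 * s x * \<tau>"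
proof -
  define M where "M c a = (\<Sum>d\<in>UNIV. B c d x * B d a x)" for c a
  \<comment> \<open>M is minus the contraction of \<open>D c (B a b)\<close> with N in either slot,
    so T is its tangential part.\<close>
  define T where "T c a b = D c (B a b) x + N a x * M c b + N b x * M c a" for c a b
  define \<tau> where "\<tau> = (\<Sum>c\<in>UNIV. \<Sum>a\<in>UNIV. \<Sum>b\<in>UNIV. (T c a b)\<^sup>2)"
  have NM: "(\<Sum>a\<in>UNIV. N a x * M c a) = 0" for c
    unfolding M_def by (rule B_B_N[OF x])
  have N_l: "(\<Sum>a\<in>UNIV. N a x * D c (B a b) x) = - M c b" for c b
    using N_D_D[OF smooth_N x, of c b] by (simp add: B_def[symmetric] M_def)
  have t_sym: "D c (B a b) x = D c (B b a) x" for a b c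
    using B_sym by (intro D_cong[OF _ x])
  have N_r: "(\<Sum>b\<in>UNIV. N b x * D c (B a b) x) = - M c a" for c a
    using N_l[of c a] t_sym by simp
  \<comment> \<open>The normal parts amount to 2|M|^2, so 2\<tau> absorbs exactly the term -4|M|^2
    of \<open>lap_s\<close>.\<close>
  have tau: "\<tau> = (\<Sum>c\<in>UNIV. \<Sum>a\<in>UNIV. \<Sum>b\<in>UNIV. (D c (B a b) x)\<^sup>2) - 2 * (\<Sum>c\<in>UNIV. \<Sum>a\<in>UNIV. (M c a)\<^sup>2)"
    unfolding \<tau>_def T_def
    by (subst sum_square_tangential_part[OF N_N[OF x] NM N_l N_r])
      (simp add: sum_subtractf sum_distrib_left)
  \<comment> \<open>B annihilates N, so only T contributes to the gradient of s; this is what lets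
    Cauchy-Schwarz bound it by \<tau>.\<close>
  have BT: "D c s x = 2 * (\<Sum>a\<in>UNIV. \<Sum>b\<in>UNIV. B a b x * T c a b)" for c
  proof -
    have "(\<Sum>a\<in>UNIV. \<Sum>b\<in>UNIV. B a b x * (N b x * M c a)) = (\<Sum>a\<in>UNIV. M c a * (\<Sum>b\<in>UNIV. B a b x * N b x))"
      by (simp add: sum_distrib_left mult_ac)
    then have 1: "(\<Sum>a\<in>UNIV. \<Sum>b\<in>UNIV. B a b x * (N b x * M c a)) = 0" using B_N[OF x] by simp
    have "(\<Sum>a\<in>UNIV. \<Sum>b\<in>UNIV. B a b x * (N a x * M c b)) = (\<Sum>b\<in>UNIV. \<Sum>a\<in>UNIV. B a b x * (N a x * M c b))" by (rule sum.swap)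
    also have "\<dots> = (\<Sum>b\<in>UNIV. M c b * (\<Sum>a\<in>UNIV. N a x * B a b x))"
      by (simp add: sum_distrib_left mult_ac)
    finally have 2: "(\<Sum>a\<in>UNIV. \<Sum>b\<in>UNIV. B a b x * (N a x * M c b)) = 0" using N_B[OF x] by simp
    show ?thesis
      unfolding D_s[OF x] T_def using 1 2 by (simp add: distrib_left sum.distrib)
  qed
  have "(D c s x)\<^sup>2 \<le> 4 * s x * (\<Sum>a\<in>UNIV. \<Sum>b\<in>UNIV. (T c a b)\<^sup>2)" for c
  proof -
    have "(\<Sum>p\<in>UNIV \<times> UNIV. B (fst p) (snd p) x * T c (fst p) (snd p))\<^sup>2
      \<le> (\<Sum>p\<in>UNIV \<times> UNIV. (B (fst p) (snd p) x)\<^sup>2) * (\<Sum>p\<in>UNIV \<times> UNIV. (T c (fst p) (snd p))\<^sup>2)"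
      by (rule Cauchy_Schwarz_ineq_sum)
    then have "(\<Sum>a\<in>UNIV. \<Sum>b\<in>UNIV. B a b x * T c a b)\<^sup>2 \<le> s x * (\<Sum>a\<in>UNIV. \<Sum>b\<in>UNIV. (T c a b)\<^sup>2)"
      by (simp add: sum.cartesian_product s_def power2_eq_square case_prod_unfold)
    then show ?thesis unfolding BT by (simp add: power_mult_distrib)
  qed
  then have "(\<Sum>c\<in>UNIV. (D c s x)\<^sup>2) \<le> (\<Sum>c\<in>UNIV. 4 * s x * (\<Sum>a\<in>UNIV. \<Sum>b\<in>UNIV. (T c a b)\<^sup>2))"
    by (rule sum_mono)
  then have "(\<Sum>c\<in>UNIV. (D c s x)\<^sup>2) \<le> 4 * s x * \<tau>" by (simp add: \<tau>_def sum_distrib_left)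
  moreover have "\<tau> \<ge> 0" unfolding \<tau>_def by (intro sum_nonneg) auto
  moreover have "lap s x = 2 * \<tau> - 2 * (s x)\<^sup>2"
    using lap_s[OF x] H unfolding tau M_def by simp
  ultimately show ?thesis using that by blast
qed

section \<open>The position vector and the free boundary\<close>

definition r :: "real^'n \<Rightarrow> real" where "r x = (\<Sum>a\<in>UNIV. X a x * X a x)"

lemma smooth_r: "smooth_fun V r"
  unfolding r_def[abs_def] by (intro smooth_fun_sum smooth_fun_mult open_V smooth_X)

lemma sum_P_X:
  assumes "x \<in> V"
  shows "(\<Sum>a\<in>UNIV. D b (X a) x * y a) = y b - N b x * (\<Sum>a\<in>UNIV. N a x * y a)"
proof -
  have "D b (X a) x * y a = (if a = b then y a else 0) - N b x * (N a x * y a)" for a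
    by (simp add: D_X[OF assms] algebra_simps)
  then show ?thesis by (simp add: sum_subtractf sum_distrib_left)
qed

lemma sum_P_P: "x \<in> V \<Longrightarrow> (\<Sum>a\<in>UNIV. D a (X a) x) = real CARD('m) - 1"
  using N_N[of x] by (simp add: D_X sum_subtractf)

lemma D_r:
  assumes x: "x \<in> V"
  shows "D a r x = 2 * (X a x - N a x * (\<Sum>b\<in>UNIV. N b x * X b x))"
proof -
  have "D a r x = (\<Sum>b\<in>UNIV. D a (\<lambda>x. X b x * X b x) x)"
    unfolding r_def[abs_def] by (intro D_sum smooth_fun_mult open_V smooth_X x)
  also have "\<dots> = 2 * (\<Sum>b\<in>UNIV. D a (X b) x * X b x)"
    by (simp add: D_mult smooth_X x sum_distrib_left mult_ac)
  finally show ?thesis by (simp add: sum_P_X[OF x])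
qed

lemma lap_X: "x \<in> V \<Longrightarrow> lap (X a) x = - (H x * N a x)"
proof -
  assume x: "x \<in> V"
  have "D c (D c (X a)) x = - (N c x * D c (N a) x) - B c c x * N a x" for c
  proof -
    have "D c (D c (X a)) x = D c (\<lambda>x. (if a = c then 1 else 0) - N a x * N c x) x"
      by (rule D_cong[OF _ x]) (rule D_X)
    also have "\<dots> = 0 - D c (\<lambda>x. N a x * N c x) x"
      by (subst D_diff) (auto intro: smooth_fun_mult open_V smooth_N x)
    finally show ?thesis by (simp add: D_mult smooth_N x B_def)
  qed
  then show ?thesis
    using N_D[OF x] by (simp add: lap_def sum_subtractf sum_negf H_def sum_distrib_right)
qed

text \<open>The coordinate functions are harmonic at x, so what remains is twice the squared norm of
  the tangential projection P, and P^2 = P turns that norm into the trace of P.\<close>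

lemma lap_r:
  assumes x: "x \<in> V" and H: "H x = 0"
  shows "lap r x = 2 * (real CARD('m) - 1)"
proof -
  have "lap r x = (\<Sum>a\<in>UNIV. lap (\<lambda>x. X a x * X a x) x)"
    unfolding r_def[abs_def] by (intro lap_sum smooth_fun_mult open_V smooth_X x)
  also have "\<dots> = 2 * (\<Sum>a\<in>UNIV. \<Sum>c\<in>UNIV. D c (X a) x * D c (X a) x)"
    using H by (simp add: lap_mult smooth_X x lap_X sum_distrib_left)
  also have "(\<Sum>a\<in>UNIV. \<Sum>c\<in>UNIV. D c (X a) x * D c (X a) x) = (\<Sum>c\<in>UNIV. \<Sum>a\<in>UNIV. D c (X a) x * D c (X a) x)"
    by (rule sum.swap)
  also have "\<dots> = (\<Sum>c\<in>UNIV. D c (X c) x)"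
    unfolding sum_P_X[OF x] using N_D[OF x]
    by (intro sum.cong refl) (simp add: D_X[OF x] algebra_simps sum_subtractf sum_distrib_left[symmetric] N_N[OF x]
      if_distrib[of "\<lambda>x. _ * x"] cong: if_cong)
  finally show ?thesis by (simp add: sum_P_P[OF x])
qed

text \<open>The position vector is a principal direction along a free boundary, so the tangential derivatives
  of \<open>B X - \<mu> X\<close> vanish there.\<close>

lemma conormal_derivative_s:
  assumes \<Gamma>: "\<Gamma> \<subseteq> V" and x: "x \<in> \<Gamma>"
    and gradient: "\<And>f y a. smooth_fun V f \<Longrightarrow> (\<And>z. z \<in> \<Gamma> \<Longrightarrow> f z = 0) \<Longrightarrow> y \<in> \<Gamma> \<Longrightarrow>
        D a f y = X a y * (\<Sum>c\<in>UNIV. X c y * D c f y)"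
    and XX: "\<And>y. y \<in> \<Gamma> \<Longrightarrow> (\<Sum>a\<in>UNIV. X a y * X a y) = 1"
    and XN: "\<And>y. y \<in> \<Gamma> \<Longrightarrow> (\<Sum>a\<in>UNIV. X a y * N a y) = 0"
    and H: "H x = 0" and DH: "\<And>a. D a H x = 0"
  shows "(\<Sum>c\<in>UNIV. X c x * D c s x) \<le> - 2 * s x"
proof -
  have xV: "x \<in> V" using \<Gamma> x by auto
  \<comment> \<open>The support function vanishes on \<Gamma> and its tangential gradient is B X, so
    \<open>gradient\<close> forces B X to be parallel to X there, with factor \<mu>.\<close>
  define u where "u x = (\<Sum>c\<in>UNIV. X c x * N c x)" for x
  define \<mu> where "\<mu> x = (\<Sum>a\<in>UNIV. X a x * (\<Sum>c\<in>UNIV. B a c x * X c x))" for x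
  define v where "v b x = (\<Sum>c\<in>UNIV. B c b x * X c x) - \<mu> x * X b x" for b x
  have sm_u: "smooth_fun V u"
    unfolding u_def[abs_def] by (intro smooth_fun_sum smooth_fun_mult open_V smooth_X smooth_N)
  have sm_\<mu>: "smooth_fun V \<mu>"
    unfolding \<mu>_def[abs_def] by (intro smooth_fun_sum smooth_fun_mult open_V smooth_X smooth_B)
  have sm_BX: "smooth_fun V (\<lambda>x. \<Sum>c\<in>UNIV. B c b x * X c x)" for b
    by (intro smooth_fun_sum smooth_fun_mult open_V smooth_X smooth_B)
  have sm_v: "smooth_fun V (v b)" for b
    unfolding v_def[abs_def] by (intro smooth_fun_diff sm_BX smooth_fun_mult open_V smooth_X sm_\<mu>)
  have D_u: "D a u y = (\<Sum>c\<in>UNIV. B a c y * X c y)" if "y \<in> V" for a y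
  proof -
    have "D a u y = (\<Sum>c\<in>UNIV. D a (\<lambda>x. X c x * N c x) y)"
      unfolding u_def[abs_def] by (intro D_sum smooth_fun_mult open_V smooth_X smooth_N that)
    also have "\<dots> = (\<Sum>c\<in>UNIV. D a (X c) y * N c y) + (\<Sum>c\<in>UNIV. B a c y * X c y)"
      by (simp add: D_mult smooth_X smooth_N that B_def sum.distrib mult.commute)
    also have "(\<Sum>c\<in>UNIV. D a (X c) y * N c y) = 0"
      unfolding sum_P_X[OF that] by (simp add: N_N[OF that])
    finally show ?thesis by simp
  qed
  have BX: "(\<Sum>c\<in>UNIV. B a c y * X c y) = \<mu> y * X a y" if y: "y \<in> \<Gamma>" for a y
  proof -
    have yV: "y \<in> V" using y \<Gamma> by auto
    have "u z = 0" if "z \<in> \<Gamma>" for z using XN[OF that] by (simp add: u_def)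
    from gradient[OF sm_u this y, of a] show ?thesis
      unfolding D_u[OF yV] \<mu>_def by (simp add: mult.commute)
  qed
  have v0: "v b y = 0" if y: "y \<in> \<Gamma>" for b y
    using BX[OF y, of b] B_sym[of y b] y \<Gamma> by (simp add: v_def subset_iff)
  \<comment> \<open>The gradient of \<open>v b\<close> on \<Gamma> is X times this conormal
    derivative, an unknown to be eliminated by contracting \<open>eq\<close> in two ways.\<close>
  define \<kappa> where "\<kappa> b = (\<Sum>c\<in>UNIV. X c x * D c (v b) x)" for b
  define t where "t a c b = D a (B c b) x" for a c b
  have eq: "(\<Sum>c\<in>UNIV. t a c b * X c x) + B a b x - D a \<mu> x * X b x - \<mu> x * D a (X b) x = X a x * \<kappa> b" for a b
  proof -
    have "D a (v b) x = D a (\<lambda>x. \<Sum>c\<in>UNIV. B c b x * X c x) x - D a (\<lambda>x. \<mu> x * X b x) x"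
      unfolding v_def[abs_def] by (intro D_diff sm_BX smooth_fun_mult open_V smooth_X sm_\<mu> xV)
    also have "D a (\<lambda>x. \<Sum>c\<in>UNIV. B c b x * X c x) x = (\<Sum>c\<in>UNIV. D a (\<lambda>x. B c b x * X c x) x)"
      by (intro D_sum smooth_fun_mult open_V smooth_X smooth_B xV)
    also have "\<dots> = (\<Sum>c\<in>UNIV. t a c b * X c x) + (\<Sum>c\<in>UNIV. D a (X c) x * B c b x)"
      by (simp add: D_mult smooth_X smooth_B xV t_def sum.distrib mult.commute)
    also have "(\<Sum>c\<in>UNIV. D a (X c) x * B c b x) = B a b x"
      unfolding sum_P_X[OF xV] by (simp add: N_B[OF xV])
    also have "D a (\<lambda>x. \<mu> x * X b x) x = D a \<mu> x * X b x + \<mu> x * D a (X b) x"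
      by (simp add: D_mult smooth_X sm_\<mu> xV)
    finally show ?thesis
      using gradient[OF sm_v v0 x, of a b] by (simp add: \<kappa>_def)
  qed
  \<comment> \<open>Both contractions of \<open>eq\<close> contain the unknown derivatives of \<mu>
    and v only in this combination: the trace determines it, the contraction with B uses it.\<close>
  define m where "m = (\<Sum>a\<in>UNIV. D a \<mu> x * X a x) + (\<Sum>a\<in>UNIV. X a x * \<kappa> a)"
  have XN_x: "(\<Sum>c\<in>UNIV. X c x * N c x) = 0" by (rule XN[OF x])
  have trace: "m = - \<mu> x * (real CARD('m) - 1)"
  proof -
    \<comment> \<open>The divergence of B is lap N = -s N, which disappears against X because X is
      orthogonal to N.\<close>
    have "(\<Sum>a\<in>UNIV. t a c a) = - s x * N c x" for c
    proof -
      have "(\<Sum>a\<in>UNIV. t a c a) = (\<Sum>a\<in>UNIV. D a (D a (N c)) x)"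
        unfolding t_def using B_sym by (intro sum.cong refl D_cong[OF _ xV]) (simp add: B_def)
      then show ?thesis using lap_N[OF xV, of c] DH by (simp add: lap_def)
    qed
    then have "(\<Sum>a\<in>UNIV. \<Sum>c\<in>UNIV. t a c a * X c x) = (\<Sum>c\<in>UNIV. - s x * N c x * X c x)"
      by (subst sum.swap) (simp add: sum_distrib_right[symmetric])
    also have "\<dots> = - s x * (\<Sum>c\<in>UNIV. X c x * N c x)" by (simp add: sum_distrib_left mult_ac)
    finally have 1: "(\<Sum>a\<in>UNIV. \<Sum>c\<in>UNIV. t a c a * X c x) = 0" using XN_x by simp
    have "(\<Sum>a\<in>UNIV. (\<Sum>c\<in>UNIV. t a c a * X c x) + B a a x - D a \<mu> x * X a x - \<mu> x * D a (X a) x) = (\<Sum>a\<in>UNIV. X a x * \<kappa> a)"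
      unfolding eq ..
    then have "(\<Sum>a\<in>UNIV. \<Sum>c\<in>UNIV. t a c a * X c x) + H x - (\<Sum>a\<in>UNIV. D a \<mu> x * X a x) - \<mu> x * (real CARD('m) - 1)
       = (\<Sum>a\<in>UNIV. X a x * \<kappa> a)"
      by (simp add: sum.distrib sum_subtractf H_def sum_P_P[OF xV] sum_distrib_left[symmetric])
    then show ?thesis using 1 H by (simp add: m_def)
  qed
  have contr: "(\<Sum>a\<in>UNIV. \<Sum>b\<in>UNIV. B a b x * (\<Sum>c\<in>UNIV. t a c b * X c x)) = - s x + \<mu> x * m"
  proof -
    have "(\<Sum>a\<in>UNIV. \<Sum>b\<in>UNIV. B a b x * ((\<Sum>c\<in>UNIV. t a c b * X c x) + B a b x - D a \<mu> x * X b x - \<mu> x * D a (X b) x))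
       = (\<Sum>a\<in>UNIV. \<Sum>b\<in>UNIV. B a b x * (X a x * \<kappa> b))"
      unfolding eq ..
    then have "(\<Sum>a\<in>UNIV. \<Sum>b\<in>UNIV. B a b x * (\<Sum>c\<in>UNIV. t a c b * X c x)) + s x
        - (\<Sum>a\<in>UNIV. \<Sum>b\<in>UNIV. D a \<mu> x * (B a b x * X b x)) - \<mu> x * (\<Sum>a\<in>UNIV. \<Sum>b\<in>UNIV. D a (X b) x * B a b x)
       = (\<Sum>a\<in>UNIV. \<Sum>b\<in>UNIV. B a b x * X a x * \<kappa> b)"
      by (simp add: algebra_simps sum.distrib sum_subtractf s_def sum_distrib_left)
    also have "(\<Sum>a\<in>UNIV. \<Sum>b\<in>UNIV. D a (X b) x * B a b x) = 0"
      unfolding sum_P_X[OF xV] using H N_B[OF xV] B_sym[OF xV] by (simp add: H_def)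
    also have "(\<Sum>a\<in>UNIV. \<Sum>b\<in>UNIV. D a \<mu> x * (B a b x * X b x)) = \<mu> x * (\<Sum>a\<in>UNIV. D a \<mu> x * X a x)"
      by (simp add: sum_distrib_left[symmetric] BX[OF x]) (simp add: sum_distrib_left mult_ac)
    also have "(\<Sum>a\<in>UNIV. \<Sum>b\<in>UNIV. B a b x * X a x * \<kappa> b) = (\<Sum>b\<in>UNIV. \<Sum>a\<in>UNIV. B a b x * X a x * \<kappa> b)" by (rule sum.swap)
    also have "\<dots> = (\<Sum>b\<in>UNIV. (\<Sum>a\<in>UNIV. B b a x * X a x) * \<kappa> b)"
      using B_sym[OF xV] by (simp add: sum_distrib_right)
    also have "\<dots> = \<mu> x * (\<Sum>b\<in>UNIV. X b x * \<kappa> b)"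
      unfolding BX[OF x] by (simp add: sum_distrib_left mult_ac)
    finally show ?thesis by (simp add: m_def algebra_simps)
  qed
  \<comment> \<open>The Codazzi equation in ambient form: exchanging the direction of
    differentiation with an index costs multiples of N, and the one that survives contraction with X
    is later annihilated by B.\<close>
  have key: "(\<Sum>c\<in>UNIV. X c x * D c (B a b) x) = (\<Sum>c\<in>UNIV. t a c b * X c x) - N a x * (\<Sum>c\<in>UNIV. X c x * (\<Sum>d\<in>UNIV. B c d x * B d b x))" for a b
  proof -
    define Q where "Q c = (\<Sum>d\<in>UNIV. B c d x * B d b x)" for c
    have DQ: "D c (B a b) x = t a c b + N c x * Q a - N a x * Q c" for c
      using D_commute[OF smooth_N xV, of c a b]
      by (simp add: B_def[symmetric] t_def Q_def algebra_simps sum_subtractf sum_distrib_left)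
    have "X c x * D c (B a b) x = t a c b * X c x + (X c x * N c x) * Q a - N a x * (X c x * Q c)" for c
      unfolding DQ by (simp add: algebra_simps)
    then have "(\<Sum>c\<in>UNIV. X c x * D c (B a b) x) = (\<Sum>c\<in>UNIV. t a c b * X c x) + (\<Sum>c\<in>UNIV. X c x * N c x) * Q a
      - N a x * (\<Sum>c\<in>UNIV. X c x * Q c)"
      by (simp add: sum.distrib sum_subtractf sum_distrib_right sum_distrib_left)
    then show ?thesis by (simp add: XN_x Q_def)
  qed
  have "(\<Sum>c\<in>UNIV. X c x * D c s x) = 2 * (\<Sum>c\<in>UNIV. \<Sum>a\<in>UNIV. \<Sum>b\<in>UNIV. B a b x * (X c x * D c (B a b) x))"
    by (simp add: D_s[OF xV] sum_distrib_left mult_ac)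
  also have "(\<Sum>c\<in>UNIV. \<Sum>a\<in>UNIV. \<Sum>b\<in>UNIV. B a b x * (X c x * D c (B a b) x)) = (\<Sum>a\<in>UNIV. \<Sum>c\<in>UNIV. \<Sum>b\<in>UNIV. B a b x * (X c x * D c (B a b) x))"
    by (rule sum.swap)
  also have "\<dots> = (\<Sum>a\<in>UNIV. \<Sum>b\<in>UNIV. \<Sum>c\<in>UNIV. B a b x * (X c x * D c (B a b) x))"
    by (intro sum.cong refl sum.swap)
  also have "\<dots> = (\<Sum>a\<in>UNIV. \<Sum>b\<in>UNIV. B a b x * (\<Sum>c\<in>UNIV. t a c b * X c x))
      - (\<Sum>a\<in>UNIV. \<Sum>b\<in>UNIV. N a x * B a b x * (\<Sum>c\<in>UNIV. X c x * (\<Sum>d\<in>UNIV. B c d x * B d b x)))"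
    by (simp only: sum_distrib_left[symmetric] key) (simp add: right_diff_distrib sum_subtractf mult_ac)
  also have "(\<Sum>a\<in>UNIV. \<Sum>b\<in>UNIV. N a x * B a b x * (\<Sum>c\<in>UNIV. X c x * (\<Sum>d\<in>UNIV. B c d x * B d b x)))
      = (\<Sum>b\<in>UNIV. \<Sum>a\<in>UNIV. N a x * B a b x * (\<Sum>c\<in>UNIV. X c x * (\<Sum>d\<in>UNIV. B c d x * B d b x)))" by (rule sum.swap)
  also have "\<dots> = 0" by (simp add: sum_distrib_right[symmetric] N_B[OF xV])
  finally have "(\<Sum>c\<in>UNIV. X c x * D c s x) = - 2 * s x - 2 * ((real CARD('m) - 1) * (\<mu> x)\<^sup>2)"
    unfolding contr trace by (simp add: power2_eq_square algebra_simps)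
  moreover have "(real CARD('m) - 1) * (\<mu> x)\<^sup>2 \<ge> 0"
    by (intro mult_nonneg_nonneg) (simp_all add: Suc_leI)
  ultimately show ?thesis by linarith
qed

end

section \<open>Tangential frames and local unit normals of an immersion\<close>

lemma has_derivative_component:
  fixes G :: "real^'n \<Rightarrow> real^'m"
  assumes "G differentiable (at x)"
  shows "((\<lambda>x. G x $ a) has_derivative (\<lambda>v. frechet_derivative G (at x) v $ a)) (at x)"
  using assms by (intro bounded_linear.has_derivative[OF bounded_linear_vec_nth])
    (simp add: frechet_derivative_works)

lemma pd_component:
  fixes G :: "real^'n \<Rightarrow> real^'m"
  assumes "G differentiable (at x)"
  shows "pd i (\<lambda>x. G x $ a) x = frechet_derivative G (at x) (axis i 1) $ a"
  by (rule pd_eqI[OF has_derivative_component[OF assms]])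

lemma smooth_on_higher_dir:
  assumes "smooth_on U F" "x \<in> U"
  shows "higher_dir F vs differentiable (at x)"
proof -
  have "open U" "higher_dir F vs differentiable_on U" using assms(1) unfolding smooth_on_def by blast+
  then show ?thesis using assms(2) by (simp add: differentiable_on_eq_differentiable_at)
qed

text \<open>The induction treats all direction lists at once, since a partial of a component of
  \<open>higher_dir F vs\<close> is a component for the list extended by a basis vector.\<close>

lemma smooth_on_component:
  fixes F :: "real^'n \<Rightarrow> real^'m"
  assumes "smooth_on U F"
  shows "smooth_fun U (\<lambda>x. F x $ a)"
proof -
  have U: "open U" using assms unfolding smooth_on_def by blast
  note d = smooth_on_higher_dir[OF assms]
  have "times_differentiable k U (\<lambda>x. higher_dir F vs x $ a)" for k vs
  proof (induction k arbitrary: vs)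
    case (Suc k)
    have "(\<lambda>x. higher_dir F vs x $ a) differentiable (at x)" if "x \<in> U" for x
      using has_derivative_component[OF d[OF that]] by (rule differentiableI)
    moreover have "times_differentiable k U (pd i (\<lambda>x. higher_dir F vs x $ a))" for i
    proof (rule times_differentiable_cong[OF U])
      show "times_differentiable k U (\<lambda>x. higher_dir F (axis i 1 # vs) x $ a)" by (rule Suc.IH)
      show "higher_dir F (axis i 1 # vs) x $ a = pd i (\<lambda>x. higher_dir F vs x $ a) x" if "x \<in> U" for x
        by (simp add: pd_component d[OF that])
    qed
    ultimately show ?case by simp
  qed simp
  from this[of _ "[]"] show ?thesis by (simp add: smooth_fun_def)
qed

lemma smooth_on_differentiable:
  assumes "smooth_on U F" "x \<in> U"
  shows "F differentiable (at x)" "dF F i differentiable (at x)"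
proof -
  note d = smooth_on_higher_dir[OF assms]
  show "F differentiable (at x)" using d[of "[]"] by simp
  show "dF F i differentiable (at x)" using d[of "[axis i 1]"] by (simp add: dF_def[abs_def])
qed

lemma dF_component: "smooth_on U F \<Longrightarrow> x \<in> U \<Longrightarrow> dF F i x $ a = pd i (\<lambda>x. F x $ a) x"
  by (simp add: dF_def pd_component smooth_on_differentiable)

lemma ddF_component:
  assumes "smooth_on U F" "x \<in> U"
  shows "ddF F i j x $ a = pd i (pd j (\<lambda>x. F x $ a)) x"
proof -
  have "open U" using assms by (simp add: smooth_on_def)
  then have "pd i (pd j (\<lambda>x. F x $ a)) x = pd i (\<lambda>x. dF F j x $ a) x"
    using assms by (intro pd_cong[of U]) (auto simp: dF_component)
  then show ?thesis using assms by (simp add: ddF_def pd_component smooth_on_differentiable)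
qed

lemma smooth_fun_det:
  fixes A :: "real^'n \<Rightarrow> real^'k^'k"
  assumes "open V" "\<And>i j. smooth_fun V (\<lambda>x. A x $ i $ j)"
  shows "smooth_fun V (\<lambda>x. det (A x))"
  unfolding det_def
  by (intro smooth_fun_sum smooth_fun_mult smooth_fun_const smooth_fun_prod assms)

lemma matrix_inv_mult:
  assumes "invertible A"
  shows matrix_inv_right: "A ** matrix_inv A = mat 1" and matrix_inv_left: "matrix_inv A ** A = mat 1"
  using someI_ex[OF assms[unfolded invertible_def]] by (auto simp: matrix_inv_def)

text \<open>Cramer's rule makes the entries quotients of polynomials in the entries of A, which
  gives smoothness of the inverse metric.\<close>

lemma matrix_inv_entry:
  fixes A :: "real^'k^'k"
  assumes "det A \<noteq> 0"
  shows "matrix_inv A $ i $ j = det (\<chi> k l. if l = i then axis j 1 $ k else A $ k $ l) / det A"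
proof -
  have "invertible A" using assms by (simp add: invertible_det_nz)
  then have "A *v (matrix_inv A *v axis j 1) = axis j 1"
    by (simp add: matrix_vector_mul_assoc matrix_inv_right)
  with cramer[OF assms, of "matrix_inv A *v axis j 1" "axis j 1"]
  have "(matrix_inv A *v axis j 1) $ i = det (\<chi> k l. if l = i then axis j 1 $ k else A $ k $ l) / det A"
    by simp
  moreover have "(matrix_inv A *v axis j 1) $ i = matrix_inv A $ i $ j"
    by (simp add: matrix_vector_mult_def axis_def if_distrib[of "\<lambda>x. _ * x"] cong: if_cong)
  ultimately show ?thesis by simp
qed

lemma smooth_fun_matrix_inv:
  fixes A :: "real^'n \<Rightarrow> real^'k^'k"
  assumes V: "open V" and A: "\<And>i j. smooth_fun V (\<lambda>x. A x $ i $ j)" and nz: "\<And>x. x \<in> V \<Longrightarrow> det (A x) \<noteq> 0"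
  shows "smooth_fun V (\<lambda>x. matrix_inv (A x) $ i $ j)"
proof (rule smooth_fun_cong[OF V])
  let ?C = "\<lambda>x. (\<chi> k l. if l = i then axis j 1 $ k else A x $ k $ l) :: real^'k^'k"
  show "det (?C x) * inverse (det (A x)) = matrix_inv (A x) $ i $ j" if "x \<in> V" for x
    by (simp add: matrix_inv_entry[OF nz[OF that]] divide_inverse)
  have "smooth_fun V (\<lambda>x. ?C x $ k $ l)" for k l by (cases "l = i") (simp_all add: A)
  then show "smooth_fun V (\<lambda>x. det (?C x) * inverse (det (A x)))"
    by (intro smooth_fun_mult smooth_fun_inverse smooth_fun_det V A nz)
qed

text \<open>Where the metric is invertible, these are the coefficients of the orthogonal projection
  of \<open>axis a 1\<close> to the tangent space in the basis \<open>dF F i x\<close>; they realise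
  the \<open>E\<close> of a patch.\<close>

definition frame :: "(real^'n \<Rightarrow> real^'m) \<Rightarrow> 'm \<Rightarrow> 'n \<Rightarrow> real^'n \<Rightarrow> real" where
  "frame F a i x = (\<Sum>j\<in>UNIV. matrix_inv (metric_mat F x) $ i $ j * dF F j x $ a)"

lemma metric_mat_mult:
  "metric_mat F x *v v = (\<chi> i. dF F i x \<bullet> (\<Sum>j\<in>UNIV. v $ j *\<^sub>R dF F j x))"
  by (simp add: metric_mat_def matrix_vector_mult_def vec_eq_iff inner_sum_right mult.commute)

lemma frechet_derivative_eq_sum_dF:
  assumes "F differentiable (at x)"
  shows "frechet_derivative F (at x) v = (\<Sum>j\<in>UNIV. v $ j *\<^sub>R dF F j x)"
proof -
  have l: "linear (frechet_derivative F (at x))"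
    using assms by (rule linear_frechet_derivative)
  have "frechet_derivative F (at x) v = frechet_derivative F (at x) (\<Sum>i\<in>UNIV. v $ i *s axis i 1)"
    by (simp add: basis_expansion)
  then show ?thesis
    by (simp add: linear_sum[OF l] scalar_mult_eq_scaleR linear_scale[OF l] dF_def)
qed

text \<open>The metric is a Gram matrix: its quadratic form is |dF v|^2, so it has the same kernel
  as dF.\<close>

lemma det_metric_mat_nz_iff:
  assumes "F differentiable (at x)"
  shows "det (metric_mat F x) \<noteq> 0 \<longleftrightarrow> inj (frechet_derivative F (at x))"
proof -
  let ?T = "\<lambda>v. \<Sum>j\<in>UNIV. v $ j *\<^sub>R dF F j x"
  have T: "frechet_derivative F (at x) = ?T" using frechet_derivative_eq_sum_dF[OF assms] by auto
  have l: "linear ?T" using linear_frechet_derivative[OF assms] by (simp add: T)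
  have "metric_mat F x *v v = 0 \<longleftrightarrow> ?T v = 0" for v
  proof
    assume "metric_mat F x *v v = 0"
    then have "dF F i x \<bullet> ?T v = 0" for i by (simp add: metric_mat_mult vec_eq_iff)
    then have "?T v \<bullet> ?T v = 0" by (simp add: inner_sum_left)
    then show "?T v = 0" by simp
  next
    assume "?T v = 0"
    then show "metric_mat F x *v v = 0"
      unfolding metric_mat_mult by (simp only: inner_zero_right) (simp add: vec_eq_iff)
  qed
  then show ?thesis
    unfolding T linear_injective_0[OF l] invertible_det_nz[symmetric] invertible_left_inverse
      matrix_left_invertible_ker by simp
qed

text \<open>In codimension one the orthogonal complement of the tangent space is a line, which has
  no room for two orthogonal nonzero vectors.\<close>

lemma normal_unique:
  fixes F :: "real^'n \<Rightarrow> real^'m"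
  assumes dim: "CARD('m) = CARD('n) + 1" and F: "F differentiable (at x)"
    and inj: "inj (frechet_derivative F (at x))"
    and n: "norm n = 1" "\<And>i. n \<bullet> dF F i x = 0"
    and w: "\<And>i. w \<bullet> dF F i x = 0" "w \<bullet> n = 0"
  shows "w = 0"
proof (rule ccontr)
  assume "w \<noteq> 0"
  let ?T = "frechet_derivative F (at x)"
  have l: "linear ?T" using F by (rule linear_frechet_derivative)
  let ?A = "range ?T" and ?C = "{y \<in> (UNIV::(real^'m) set). \<forall>t\<in>range ?T. orthogonal t y}"
  have "subspace ?A" using l by (metis linear_subspace_image subspace_UNIV)
  then have "dim ?C + dim ?A = dim (UNIV::(real^'m) set)"
    by (intro dim_subspace_orthogonal_to_vectors) auto
  moreover have "dim ?A = CARD('n)"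
    using dim_image_eq[OF l, of UNIV] inj by (simp add: dim_UNIV)
  ultimately have C: "dim ?C = 1" using dim by simp
  have "orthogonal (?T v) y" if "\<And>i. y \<bullet> dF F i x = 0" for y v
    using that by (simp add: frechet_derivative_eq_sum_dF[OF F] orthogonal_def inner_sum_right inner_commute[of _ y])
  then have sub: "{w, n} \<subseteq> ?C" using n w by auto
  have "n \<noteq> 0" using n by auto
  have ne: "w \<noteq> n" using w(2) \<open>n \<noteq> 0\<close> by auto
  have "pairwise orthogonal {w, n}"
    using w(2) by (auto simp: pairwise_def orthogonal_def inner_commute)
  then have "independent {w, n}"
    using \<open>w \<noteq> 0\<close> \<open>n \<noteq> 0\<close> by (intro pairwise_orthogonal_independent) auto
  from independent_card_le_dim[OF sub this] C ne show False by simp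
qed

lemma frame_metric:
  assumes "det (metric_mat F x) \<noteq> 0"
  shows "(\<Sum>i\<in>UNIV. frame F a i x * (dF F i x \<bullet> dF F j x)) = dF F j x $ a"
    and "(\<Sum>a\<in>UNIV. frame F a i x * dF F j x $ a) = (if i = j then 1 else 0)"
proof -
  let ?g = "metric_mat F x"
  have inv: "invertible ?g" using assms by (simp add: invertible_det_nz)
  have g_sym: "?g $ i $ j = ?g $ j $ i" for i j by (simp add: metric_mat_def inner_commute)
  have left: "(\<Sum>k\<in>UNIV. matrix_inv ?g $ i $ k * ?g $ k $ j) = (if i = j then 1 else 0)" for i j
    using matrix_inv_left[OF inv] by (simp add: matrix_matrix_mult_def mat_def vec_eq_iff)
  have right: "(\<Sum>k\<in>UNIV. ?g $ i $ k * matrix_inv ?g $ k $ j) = (if i = j then 1 else 0)" for i j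
    using matrix_inv_right[OF inv] by (simp add: matrix_matrix_mult_def mat_def vec_eq_iff)
  have "(\<Sum>i\<in>UNIV. frame F a i x * (dF F i x \<bullet> dF F j x))
      = (\<Sum>i\<in>UNIV. \<Sum>k\<in>UNIV. ?g $ j $ i * matrix_inv ?g $ i $ k * dF F k x $ a)"
    by (simp add: frame_def sum_distrib_right sum_distrib_left metric_mat_def inner_commute mult_ac)
  also have "\<dots> = (\<Sum>k\<in>UNIV. \<Sum>i\<in>UNIV. ?g $ j $ i * matrix_inv ?g $ i $ k * dF F k x $ a)" by (rule sum.swap)
  also have "\<dots> = dF F j x $ a"
    by (simp add: sum_distrib_right[symmetric] right if_distrib[of "\<lambda>x. x * _"] cong: if_cong)
  finally show "(\<Sum>i\<in>UNIV. frame F a i x * (dF F i x \<bullet> dF F j x)) = dF F j x $ a" .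
  have "(\<Sum>a\<in>UNIV. frame F a i x * dF F j x $ a)
      = (\<Sum>a\<in>UNIV. \<Sum>k\<in>UNIV. matrix_inv ?g $ i $ k * (dF F k x $ a * dF F j x $ a))"
    by (simp add: frame_def sum_distrib_left sum_distrib_right mult_ac)
  also have "\<dots> = (\<Sum>k\<in>UNIV. \<Sum>a\<in>UNIV. matrix_inv ?g $ i $ k * (dF F k x $ a * dF F j x $ a))" by (rule sum.swap)
  also have "\<dots> = (\<Sum>k\<in>UNIV. matrix_inv ?g $ i $ k * ?g $ k $ j)"
    by (simp add: metric_mat_def inner_vec_def sum_distrib_left)
  finally show "(\<Sum>a\<in>UNIV. frame F a i x * dF F j x $ a) = (if i = j then 1 else 0)" by (simp add: left)
qed

lemma frame_orthogonal:
  assumes "\<And>i. n \<bullet> dF F i x = 0"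
  shows "(\<Sum>a\<in>UNIV. n $ a * frame F a i x) = 0"
proof -
  have "(\<Sum>a\<in>UNIV. n $ a * frame F a i x) = (\<Sum>a\<in>UNIV. \<Sum>j\<in>UNIV. matrix_inv (metric_mat F x) $ i $ j * (n $ a * dF F j x $ a))"
    by (simp add: frame_def sum_distrib_left mult_ac)
  also have "\<dots> = (\<Sum>j\<in>UNIV. \<Sum>a\<in>UNIV. matrix_inv (metric_mat F x) $ i $ j * (n $ a * dF F j x $ a))" by (rule sum.swap)
  also have "\<dots> = (\<Sum>j\<in>UNIV. matrix_inv (metric_mat F x) $ i $ j * (n \<bullet> dF F j x))"
    by (simp add: inner_vec_def sum_distrib_left)
  finally show ?thesis using assms by simp
qed

text \<open>A basis vector minus its tangential and normal parts is orthogonal to both, hence zero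
  by \<open>normal_unique\<close>.\<close>

lemma frame_projection:
  fixes F :: "real^'n \<Rightarrow> real^'m"
  assumes dim: "CARD('m) = CARD('n) + 1" and F: "F differentiable (at x)"
    and g: "det (metric_mat F x) \<noteq> 0" and n: "norm n = 1" "\<And>i. n \<bullet> dF F i x = 0"
  shows "(\<Sum>i\<in>UNIV. frame F b i x * dF F i x $ a) = (if a = b then 1 else 0) - n $ a * n $ b"
proof -
  define w where "w = axis b 1 - (\<Sum>i\<in>UNIV. frame F b i x *\<^sub>R dF F i x) - n $ b *\<^sub>R n"
  have "w = 0"
  proof (rule normal_unique[OF dim F _ n])
    show "inj (frechet_derivative F (at x))" using det_metric_mat_nz_iff[OF F] g by simp
    show "w \<bullet> dF F j x = 0" for j
      using frame_metric(1)[OF g, of b j] n(2)[of j]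
      by (simp add: w_def inner_diff_left inner_sum_left inner_axis inner_axis')
    have "dF F i x \<bullet> n = 0" for i using n(2)[of i] by (simp add: inner_commute)
    then show "w \<bullet> n = 0"
      using n(1) by (simp add: w_def inner_diff_left inner_sum_left inner_axis' norm_eq_1)
  qed
  then have "w $ a = 0" by simp
  moreover have "axis b (1::real) $ a = (if a = b then 1 else 0)" by (simp add: axis_def)
  ultimately show ?thesis
    by (simp add: w_def mult.commute[of "n $ a"] del: axis_nth)
qed

text \<open>Supplies the smooth normal that \<open>nu\<close> need not be: a fixed normal vector at
  \<open>x0\<close> is projected to the normal lines at nearby points and normalised.\<close>

lemma patch_exists:
  fixes F :: "real^'n \<Rightarrow> real^'m"
  assumes dim: "CARD('m) = CARD('n) + 1" and F: "smooth_on U F" and x0: "x0 \<in> U"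
    and inj: "inj (frechet_derivative F (at x0))"
    and n0: "norm n0 = 1" "\<And>i. n0 \<bullet> dF F i x0 = 0"
  obtains V N where "x0 \<in> V" "V \<subseteq> U" "hypersurface_patch V (\<lambda>a x. F x $ a) N (frame F)"
    "\<And>x. x \<in> V \<Longrightarrow> det (metric_mat F x) \<noteq> 0"
proof -
  have U: "open U" using F by (simp add: smooth_on_def)
  define X where "X a x = F x $ a" for a x
  have sX: "smooth_fun U (X a)" for a unfolding X_def[abs_def] using F by (rule smooth_on_component)
  have dX: "dF F i x $ a = pd i (X a) x" if "x \<in> U" for i a x
    unfolding X_def[abs_def] using F that by (rule dF_component)
  have s_dF: "smooth_fun U (\<lambda>x. dF F i x $ a)" for i a
    by (rule smooth_fun_cong[OF U _ smooth_fun_pd[OF sX[of a], of i]]) (simp add: dX)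
  have s_g: "smooth_fun U (\<lambda>x. metric_mat F x $ i $ j)" for i j
    unfolding metric_mat_def inner_vec_def by (auto intro!: smooth_fun_sum smooth_fun_mult U s_dF)
  have s_det: "smooth_fun U (\<lambda>x. det (metric_mat F x))" by (intro smooth_fun_det U s_g)
  \<comment> \<open>U may reach beyond the points where F is an immersion, so it is first cut down
    to invertible metrics.\<close>
  define W where "W = {x\<in>U. det (metric_mat F x) \<noteq> 0}"
  have "open (- {0::real})" by (rule open_Compl) simp
  from continuous_open_preimage[OF smooth_fun_continuous_on[OF s_det] U this] have W: "open W"
    by (simp add: W_def vimage_def Int_def)
  have WU: "W \<subseteq> U" by (auto simp: W_def)
  have x0W: "x0 \<in> W"
    using det_metric_mat_nz_iff[OF smooth_on_differentiable(1)[OF F x0]] inj x0 by (simp add: W_def)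
  have s_frame: "smooth_fun W (frame F a i)" for a i
    unfolding frame_def[abs_def]
    by (intro smooth_fun_sum smooth_fun_mult smooth_fun_matrix_inv W smooth_fun_subset[OF s_dF WU]
        smooth_fun_subset[OF s_g WU]) (simp add: W_def)
  define p where "p x = n0 - (\<Sum>i\<in>UNIV. (\<Sum>a\<in>UNIV. frame F a i x * n0 $ a) *\<^sub>R dF F i x)" for x
  have p_orth: "p x \<bullet> dF F j x = 0" if "x \<in> W" for x j
  proof -
    have g: "det (metric_mat F x) \<noteq> 0" using that by (simp add: W_def)
    have "(\<Sum>i\<in>UNIV. (\<Sum>a\<in>UNIV. frame F a i x * n0 $ a) * (dF F i x \<bullet> dF F j x))
        = (\<Sum>i\<in>UNIV. \<Sum>a\<in>UNIV. n0 $ a * (frame F a i x * (dF F i x \<bullet> dF F j x)))"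
      by (simp add: sum_distrib_left sum_distrib_right mult_ac)
    also have "\<dots> = (\<Sum>a\<in>UNIV. \<Sum>i\<in>UNIV. n0 $ a * (frame F a i x * (dF F i x \<bullet> dF F j x)))" by (rule sum.swap)
    also have "\<dots> = n0 \<bullet> dF F j x"
      unfolding sum_distrib_left[symmetric] frame_metric(1)[OF g] by (simp add: inner_vec_def)
    finally show ?thesis by (simp add: p_def inner_diff_left inner_sum_left)
  qed
  have p0: "p x0 = n0"
  proof -
    have "(\<Sum>a\<in>UNIV. frame F a i x0 * n0 $ a) = 0" for i
      using frame_orthogonal[OF n0(2), of i] by (simp add: mult.commute)
    then show ?thesis by (simp add: p_def)
  qed
  have s_p: "smooth_fun W (\<lambda>x. p x $ a)" for a
  proof -
    have "smooth_fun W (\<lambda>x. n0 $ a - (\<Sum>i\<in>UNIV. (\<Sum>b\<in>UNIV. frame F b i x * n0 $ b) * dF F i x $ a))"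
      by (intro smooth_fun_diff smooth_fun_sum smooth_fun_mult smooth_fun_const W s_frame
          smooth_fun_subset[OF s_dF WU])
    then show ?thesis by (simp add: p_def)
  qed
  define q where "q x = (\<Sum>a\<in>UNIV. p x $ a * p x $ a)" for x
  have q_eq: "q x = p x \<bullet> p x" for x by (simp add: q_def inner_vec_def)
  have s_q: "smooth_fun W q"
    unfolding q_def[abs_def] by (intro smooth_fun_sum smooth_fun_mult W s_p)
  \<comment> \<open>At \<open>x0\<close> the projection is \<open>n0\<close> itself, of length 1, so
    it stays nonzero nearby and can be normalised.\<close>
  define V where "V = {x\<in>W. q x > 0}"
  have V: "open V"
    using continuous_open_preimage[OF smooth_fun_continuous_on[OF s_q] W, of "{0<..}"]
    by (simp add: V_def vimage_def Int_def)
  have VW: "V \<subseteq> W" by (auto simp: V_def)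
  have "q x0 = 1" using n0(1) by (simp add: q_eq p0 norm_eq_1)
  then have x0V: "x0 \<in> V" using x0W by (simp add: V_def)
  define N where "N a x = p x $ a * inverse (sqrt (q x))" for a x
  define nn where "nn x = inverse (sqrt (q x)) *\<^sub>R p x" for x
  have N_nn: "N a x = nn x $ a" for a x by (simp add: N_def nn_def)
  have n1: "norm (nn x) = 1" if "x \<in> V" for x
  proof -
    have "norm (p x) = sqrt (q x)" by (simp add: q_eq norm_eq_sqrt_inner)
    moreover have "sqrt (q x) > 0" using that by (simp add: V_def)
    ultimately show ?thesis by (simp add: nn_def)
  qed
  have n_orth: "nn x \<bullet> dF F i x = 0" if "x \<in> V" for x i
    using p_orth[of x i] that VW by (auto simp: nn_def)
  have s_N: "smooth_fun V (N a)" for a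
    unfolding N_def[abs_def]
  proof (intro smooth_fun_mult smooth_fun_inverse smooth_fun_sqrt V)
    show "smooth_fun V (\<lambda>x. p x $ a)" by (rule smooth_fun_subset[OF s_p VW])
    show "smooth_fun V q" by (rule smooth_fun_subset[OF s_q VW])
  qed (auto simp: V_def)
  have VU: "V \<subseteq> U" using VW WU by auto
  have g: "det (metric_mat F x) \<noteq> 0" if "x \<in> V" for x using that VW by (auto simp: W_def)
  have "hypersurface_patch V X N (frame F)"
  proof
    show "open V" by (rule V)
    show "smooth_fun V (X a)" for a by (rule smooth_fun_subset[OF sX VU])
    show "smooth_fun V (N a)" for a by (rule s_N)
    show "smooth_fun V (frame F a i)" for a i by (rule smooth_fun_subset[OF s_frame VW])
    fix x assume x: "x \<in> V"
    then have xU: "x \<in> U" using VU by auto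
    note d = smooth_on_differentiable(1)[OF F xU]
    show "(\<Sum>a\<in>UNIV. N a x * N a x) = 1"
      using n1[OF x] by (simp add: N_nn norm_eq_1 inner_vec_def)
    show "(\<Sum>a\<in>UNIV. N a x * pd i (X a) x) = 0" for i
      using n_orth[OF x, of i] by (simp add: N_nn inner_vec_def dX[OF xU])
    show "(\<Sum>i\<in>UNIV. frame F b i x * pd i (X a) x) = (if a = b then 1 else 0) - N a x * N b x" for a b
      using frame_projection[OF dim d g[OF x] n1[OF x] n_orth[OF x], of b a]
      by (simp add: N_nn dX[OF xU])
    show "(\<Sum>a\<in>UNIV. frame F a i x * pd j (X a) x) = (if i = j then 1 else 0)" for i j
      using frame_metric(2)[OF g[OF x], of i j] by (simp add: dX[OF xU])
    show "(\<Sum>a\<in>UNIV. N a x * frame F a i x) = 0" for i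
      using frame_orthogonal[OF n_orth[OF x], of i] by (simp add: N_nn)
  qed
  then have "hypersurface_patch V (\<lambda>a x. F x $ a) N (frame F)"
    by (simp add: X_def[abs_def])
  with that x0V VU g show ?thesis by blast
qed

text \<open>The sign \<sigma> exists because the normal space is a line; it is squared away in
  |A|^2. The matrix g^-1 h is -\<sigma> times the product of \<open>frame\<close> and dN, while B is
  that product in the other order, so traces of powers agree by cyclicity.\<close>

lemma patch_curvatures:
  fixes F nu :: "real^'n \<Rightarrow> real^'m"
  assumes dim: "CARD('m) = CARD('n) + 1" and F: "smooth_on U F" and VU: "V \<subseteq> U"
    and patch: "hypersurface_patch V (\<lambda>a x. F x $ a) N (frame F)"
    and g: "\<And>x. x \<in> V \<Longrightarrow> det (metric_mat F x) \<noteq> 0"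
    and x: "x \<in> V" and nu: "norm (nu x) = 1" "\<And>i. nu x \<bullet> dF F i x = 0"
  obtains \<sigma> :: real where "\<sigma> * \<sigma> = 1" "\<And>a. nu x $ a = \<sigma> * N a x"
    "sqA F nu x = hypersurface_patch.s N (frame F) x"
    "mean_curv F nu x = - \<sigma> * hypersurface_patch.H N (frame F) x"
proof -
  interpret P: hypersurface_patch V "\<lambda>a x. F x $ a" N "frame F" by (rule patch)
  have xU: "x \<in> U" using x VU by auto
  note dX = dF_component[OF F xU]
  define n :: "real^'m" where "n = (\<chi> a. N a x)"
  have n1: "n \<bullet> n = 1" using P.N_N[OF x] by (simp add: n_def inner_vec_def)
  have n_orth: "n \<bullet> dF F i x = 0" for i using P.N_dX[OF x, of i] by (simp add: n_def inner_vec_def dX)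
  define \<sigma> where "\<sigma> = nu x \<bullet> n"
  have "nu x - \<sigma> *\<^sub>R n = 0"
  proof (rule normal_unique[OF dim smooth_on_differentiable(1)[OF F xU]])
    show "inj (frechet_derivative F (at x))"
      using det_metric_mat_nz_iff[OF smooth_on_differentiable(1)[OF F xU]] g[OF x] by simp
    show "norm n = 1" using n1 by (simp add: norm_eq_1)
    show "n \<bullet> dF F i x = 0" for i by (rule n_orth)
    show "(nu x - \<sigma> *\<^sub>R n) \<bullet> dF F i x = 0" for i by (simp add: inner_diff_left nu n_orth)
    show "(nu x - \<sigma> *\<^sub>R n) \<bullet> n = 0" by (simp add: inner_diff_left n1 \<sigma>_def)
  qed
  then have nu_n: "nu x = \<sigma> *\<^sub>R n" by simp
  have "\<sigma> * \<sigma> = nu x \<bullet> nu x" using n1 by (simp add: nu_n)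
  then have \<sigma>: "\<sigma> * \<sigma> = 1" using nu(1) by (simp add: norm_eq_1)
  have nu_N: "nu x $ a = \<sigma> * N a x" for a by (simp add: nu_n n_def)
  have sff: "sff_mat F nu x $ i $ j = - \<sigma> * (\<Sum>a\<in>UNIV. pd j (N a) x * pd i (\<lambda>x. F x $ a) x)" for i j
  proof -
    have "sff_mat F nu x $ i $ j = \<sigma> * (\<Sum>a\<in>UNIV. N a x * pd i (pd j (\<lambda>x. F x $ a)) x)"
      by (simp add: sff_mat_def inner_vec_def ddF_component[OF F xU] nu_N sum_distrib_left mult_ac)
    also have "\<dots> = - \<sigma> * (\<Sum>a\<in>UNIV. pd i (N a) x * pd j (\<lambda>x. F x $ a) x)"
      by (simp add: P.dN_dX[OF x])
    also have "(\<Sum>a\<in>UNIV. pd i (N a) x * pd j (\<lambda>x. F x $ a) x) = (\<Sum>a\<in>UNIV. pd j (N a) x * pd i (\<lambda>x. F x $ a) x)"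
      by (rule P.dN_dX_sym[OF x])
    finally show ?thesis .
  qed
  define S where "S = matrix_inv (metric_mat F x) ** sff_mat F nu x"
  have S: "S $ i $ j = - \<sigma> * (\<Sum>a\<in>UNIV. frame F a i x * pd j (N a) x)" for i j
  proof -
    have "S $ i $ j = - \<sigma> * (\<Sum>k\<in>UNIV. \<Sum>a\<in>UNIV. matrix_inv (metric_mat F x) $ i $ k * (pd j (N a) x * dF F k x $ a))"
      by (simp add: S_def matrix_matrix_mult_def sff dX sum_distrib_left sum_negf mult_ac)
    also have "(\<Sum>k\<in>UNIV. \<Sum>a\<in>UNIV. matrix_inv (metric_mat F x) $ i $ k * (pd j (N a) x * dF F k x $ a))
      = (\<Sum>a\<in>UNIV. \<Sum>k\<in>UNIV. matrix_inv (metric_mat F x) $ i $ k * (pd j (N a) x * dF F k x $ a))" by (rule sum.swap)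
    also have "\<dots> = (\<Sum>a\<in>UNIV. frame F a i x * pd j (N a) x)"
      by (simp add: frame_def sum_distrib_left sum_distrib_right mult_ac)
    finally show ?thesis .
  qed
  have "mean_curv F nu x = - \<sigma> * (\<Sum>i\<in>UNIV. \<Sum>a\<in>UNIV. frame F a i x * pd i (N a) x)"
    by (simp add: mean_curv_def S_def[symmetric] trace_def S sum_distrib_left)
  also have "(\<Sum>i\<in>UNIV. \<Sum>a\<in>UNIV. frame F a i x * pd i (N a) x) = (\<Sum>a\<in>UNIV. \<Sum>i\<in>UNIV. frame F a i x * pd i (N a) x)" by (rule sum.swap)
  also have "\<dots> = P.H x" by (simp add: P.H_def P.B_def P.D_def)
  finally have 1: "mean_curv F nu x = - \<sigma> * P.H x" .
  have "sqA F nu x = trace (S ** S)" by (simp add: sqA_def S_def matrix_mul_assoc)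
  also have "\<dots> = (\<Sum>i\<in>UNIV. \<Sum>j\<in>UNIV. S $ i $ j * S $ j $ i)" by (simp add: trace_def matrix_matrix_mult_def)
  also have "\<dots> = (\<Sum>i\<in>UNIV. \<Sum>j\<in>UNIV. \<Sum>a\<in>UNIV. \<Sum>b\<in>UNIV. frame F a i x * pd j (N a) x * (frame F b j x * pd i (N b) x))"
  proof (intro sum.cong refl)
    fix i j
    have "S $ i $ j * S $ j $ i = (\<sigma> * \<sigma>) *
        ((\<Sum>a\<in>UNIV. frame F a i x * pd j (N a) x) * (\<Sum>b\<in>UNIV. frame F b j x * pd i (N b) x))"
      by (simp add: S mult_ac)
    then show "S $ i $ j * S $ j $ i = (\<Sum>a\<in>UNIV. \<Sum>b\<in>UNIV. frame F a i x * pd j (N a) x * (frame F b j x * pd i (N b) x))"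
      by (simp add: \<sigma> sum_product)
  qed
  also have "\<dots> = (\<Sum>i\<in>UNIV. \<Sum>a\<in>UNIV. \<Sum>j\<in>UNIV. \<Sum>b\<in>UNIV. frame F a i x * pd j (N a) x * (frame F b j x * pd i (N b) x))"
    by (intro sum.cong refl sum.swap)
  also have "\<dots> = (\<Sum>a\<in>UNIV. \<Sum>i\<in>UNIV. \<Sum>j\<in>UNIV. \<Sum>b\<in>UNIV. frame F a i x * pd j (N a) x * (frame F b j x * pd i (N b) x))"
    by (rule sum.swap)
  also have "\<dots> = (\<Sum>a\<in>UNIV. \<Sum>i\<in>UNIV. \<Sum>b\<in>UNIV. \<Sum>j\<in>UNIV. frame F a i x * pd j (N a) x * (frame F b j x * pd i (N b) x))"
    by (intro sum.cong refl sum.swap)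
  also have "\<dots> = (\<Sum>a\<in>UNIV. \<Sum>b\<in>UNIV. \<Sum>i\<in>UNIV. \<Sum>j\<in>UNIV. frame F a i x * pd j (N a) x * (frame F b j x * pd i (N b) x))"
    by (intro sum.cong refl sum.swap)
  also have "\<dots> = (\<Sum>a\<in>UNIV. \<Sum>b\<in>UNIV. P.B a b x * P.B b a x)"
    unfolding P.B_def P.D_def sum_product by (intro sum.cong refl) (simp add: mult_ac)
  also have "\<dots> = P.s x" unfolding P.s_def using P.B_sym[OF x] by simp
  finally have 2: "sqA F nu x = P.s x" .
  show ?thesis by (rule that[OF \<sigma> nu_N 2 1])
qed

section \<open>Derivatives at the boundary of the unit ball\<close>

text \<open>In the open ball f vanishes near each point of V; continuity carries the conclusion to
  boundary points, where f is known on one side only. Used for the gradient of H.\<close>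

lemma pd_eq_0_on_cball:
  fixes f :: "real^'n \<Rightarrow> real"
  assumes V: "open V" and f: "smooth_fun V f" and x: "x \<in> V" "norm x \<le> 1"
    and f0: "\<And>y. y \<in> V \<Longrightarrow> norm y \<le> 1 \<Longrightarrow> f y = 0"
  shows "pd i f x = 0"
proof (rule ccontr)
  assume ne: "pd i f x \<noteq> 0"
  let ?W = "{y\<in>V. pd i f y \<noteq> 0}"
  have "open (- {0::real})" by (rule open_Compl) simp
  from continuous_open_preimage[OF smooth_fun_continuous_on[OF smooth_fun_pd[OF f]] V this]
  have "open ?W" by (simp add: vimage_def Int_def)
  moreover have "x \<in> closure (ball 0 1)" using x by simp
  ultimately have "?W \<inter> ball 0 1 \<noteq> {}"
    using ne x open_Int_closure_eq_empty[of ?W "ball 0 1"] by blast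
  then obtain y where y: "y \<in> V" "pd i f y \<noteq> 0" "norm y < 1" by auto
  have "pd i f y = pd i (\<lambda>_. 0) y"
    using y f0 V by (intro pd_cong[of "V \<inter> ball 0 1"]) auto
  with y show False by simp
qed

lemma max_on_cball:
  fixes f :: "real^'n \<Rightarrow> real"
  assumes "continuous_on (cball 0 1) f"
  shows "\<exists>z. norm z \<le> 1 \<and> (\<forall>y. norm y \<le> 1 \<longrightarrow> f y \<le> f z)"
proof -
  have "\<exists>z\<in>cball 0 1. \<forall>y\<in>cball 0 1. f y \<le> f z"
    using assms by (intro continuous_attains_sup) auto
  then show ?thesis by auto
qed

lemma in_cball_along_inward:
  fixes x v :: "real^'n"
  assumes "norm x \<le> 1" "x \<bullet> v > 0"
  obtains d where "d > 0" "\<And>t. 0 \<le> t \<Longrightarrow> t < d \<Longrightarrow> norm (x - t *\<^sub>R v) \<le> 1"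
proof
  have v: "v \<bullet> v > 0" using assms(2) by (metis inner_gt_zero_iff inner_zero_right less_irrefl)
  \<comment> \<open>The positive zero of -2t(x . v) + t^2 |v|^2, the change of the squared norm
    along the line.\<close>
  then show "2 * (x \<bullet> v) / (v \<bullet> v) > 0" using assms by simp
  fix t assume t: "0 \<le> t" "t < 2 * (x \<bullet> v) / (v \<bullet> v)"
  have "t * (t * (v \<bullet> v)) \<le> t * (2 * (x \<bullet> v))"
    using t v by (intro mult_left_mono) (auto simp: field_simps)
  moreover have "(x - t *\<^sub>R v) \<bullet> (x - t *\<^sub>R v) = x \<bullet> x - 2 * t * (x \<bullet> v) + t * (t * (v \<bullet> v))"
    by (simp add: algebra_simps inner_commute)
  moreover have "x \<bullet> x \<le> 1" using assms(1) by (simp add: dot_square_norm power_le_one)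
  ultimately have "(x - t *\<^sub>R v) \<bullet> (x - t *\<^sub>R v) \<le> 1" by simp
  then show "norm (x - t *\<^sub>R v) \<le> 1" by (simp add: norm_eq_sqrt_inner)
qed

text \<open>Otherwise f would grow along -v, and that line stays in the closed ball for a short time
  because x . v > 0.\<close>

lemma outward_derivative_at_max:
  fixes f :: "real^'n \<Rightarrow> real"
  assumes V: "open V" and f: "smooth_fun V f" and x: "x \<in> V" "norm x \<le> 1" and v: "x \<bullet> v > 0"
    and max: "\<And>y. y \<in> V \<Longrightarrow> norm y \<le> 1 \<Longrightarrow> f y \<le> f x"
  shows "(\<Sum>i\<in>UNIV. v $ i * pd i f x) \<ge> 0"
proof (rule ccontr)
  assume neg: "\<not> (\<Sum>i\<in>UNIV. v $ i * pd i f x) \<ge> 0"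
  have "((\<lambda>t. f (x + t *\<^sub>R (- v))) has_real_derivative (\<Sum>i\<in>UNIV. (- v) $ i * pd i f x)) (at 0)"
    using has_real_derivative_along_line[of f x 0 "- v"] smooth_fun_differentiable[OF f x(1)] by simp
  moreover have "(\<Sum>i\<in>UNIV. (- v) $ i * pd i f x) > 0" using neg by (simp add: sum_negf)
  ultimately obtain d where d: "d > 0" "\<And>t. 0 < t \<Longrightarrow> t < d \<Longrightarrow> f (x + 0 *\<^sub>R (- v)) < f (x + (0 + t) *\<^sub>R (- v))"
    using DERIV_pos_inc_right by blast
  obtain d' where d': "d' > 0" "\<And>t. 0 \<le> t \<Longrightarrow> t < d' \<Longrightarrow> norm (x - t *\<^sub>R v) \<le> 1"
    using in_cball_along_inward[OF x(2) v] by blast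
  have "((\<lambda>t. x - t *\<^sub>R v) \<longlongrightarrow> x - 0 *\<^sub>R v) (at_right 0)" by (intro tendsto_intros)
  then have "((\<lambda>t. x - t *\<^sub>R v) \<longlongrightarrow> x) (at_right 0)" by simp
  from topological_tendstoD[OF this V x(1)]
  obtain e where e: "e > 0" "\<And>t. 0 < t \<Longrightarrow> t < e \<Longrightarrow> x - t *\<^sub>R v \<in> V"
    unfolding eventually_at_right_field by auto
  define t where "t = min d (min d' e) / 2"
  have "0 < t" "t < d" "t < d'" "t < e" using d d' e by (auto simp: t_def)
  then show False using d(2)[of t] max[of "x - t *\<^sub>R v"] d'(2)[of t] e(2)[of t] by simp
qed

lemma tangential_derivative_eq_0:
  fixes f :: "real^'n \<Rightarrow> real"
  assumes V: "open V" and f: "smooth_fun V f" and x: "x \<in> V" "norm x = 1" and v: "x \<bullet> v = 0"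
    and f0: "\<And>y. y \<in> V \<Longrightarrow> norm y = 1 \<Longrightarrow> f y = 0"
  shows "(\<Sum>i\<in>UNIV. v $ i * pd i f x) = 0"
proof (cases "v = 0")
  case False
  define w where "w = v /\<^sub>R norm v"
  have w: "norm w = 1" "x \<bullet> w = 0" "v = norm v *\<^sub>R w" using False v by (auto simp: w_def)
  \<comment> \<open>The great circle through x with velocity w stays on the sphere, where f
    vanishes.\<close>
  define \<gamma> where "\<gamma> t = cos t *\<^sub>R x + sin t *\<^sub>R w" for t :: real
  have \<gamma>1: "norm (\<gamma> t) = 1" for t
  proof -
    have "\<gamma> t \<bullet> \<gamma> t = (cos t)\<^sup>2 * (x \<bullet> x) + 2 * (sin t * cos t) * (x \<bullet> w) + (sin t)\<^sup>2 * (w \<bullet> w)"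
      by (simp add: \<gamma>_def power2_eq_square algebra_simps inner_commute)
    then show ?thesis using w x by (simp add: norm_eq_1)
  qed
  have \<gamma>0: "\<gamma> 0 = x" by (simp add: \<gamma>_def)
  have d\<gamma>: "(\<gamma> has_derivative (\<lambda>h. h *\<^sub>R w)) (at 0)"
    unfolding \<gamma>_def[abs_def] by (auto intro!: derivative_eq_intros)
  have "(f has_derivative (\<lambda>v. \<Sum>i\<in>UNIV. v $ i * pd i f x)) (at (\<gamma> 0))"
    using has_derivative_pd[OF smooth_fun_differentiable[OF f x(1)]] by (simp add: \<gamma>0)
  from diff_chain_at[OF d\<gamma> this]
  have 1: "((f \<circ> \<gamma>) has_derivative (\<lambda>h. \<Sum>i\<in>UNIV. (h *\<^sub>R w) $ i * pd i f x)) (at 0)" by (simp add: o_def)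
  have cont: "continuous_on UNIV \<gamma>" unfolding \<gamma>_def[abs_def] by (intro continuous_intros)
  have "open (\<gamma> -` V)" using continuous_open_preimage[OF cont open_UNIV V] by simp
  moreover have "0 \<in> \<gamma> -` V" using x by (simp add: \<gamma>0)
  moreover have "(f \<circ> \<gamma>) t = 0" if "t \<in> \<gamma> -` V" for t using that f0 \<gamma>1 by simp
  ultimately have "((\<lambda>_. 0) has_derivative (\<lambda>h. \<Sum>i\<in>UNIV. (h *\<^sub>R w) $ i * pd i f x)) (at 0)"
    by (rule has_derivative_transform_within_open[OF 1])
  moreover have "((\<lambda>_::real. 0::real) has_derivative (\<lambda>h. 0)) (at 0)" by simp
  ultimately have "(\<lambda>h::real. \<Sum>i\<in>UNIV. (h *\<^sub>R w) $ i * pd i f x) = (\<lambda>h. 0)"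
    by (rule has_derivative_unique)
  then have "(\<Sum>i\<in>UNIV. (norm v *\<^sub>R w) $ i * pd i f x) = 0" by metis
  then show ?thesis using w(3) by metis
qed simp

section \<open>Free boundary minimal disks\<close>

locale minimal_disk =
  fixes F :: "real^'n \<Rightarrow> real^'m" and nu :: "real^'n \<Rightarrow> real^'m" and U :: "(real^'n) set"
  assumes dim: "CARD('m) = CARD('n) + 1"
    and smooth: "smooth_on U F" and U: "cball 0 1 \<subseteq> U"
    and immersion: "\<forall>x\<in>cball 0 1. inj (frechet_derivative F (at x))"
    and unit_normal: "\<forall>x\<in>cball 0 1. norm (nu x) = 1 \<and> (\<forall>i. nu x \<bullet> dF F i x = 0)"
    and minimal: "\<forall>x\<in>cball 0 1. mean_curv F nu x = 0"
    and bdry_in_sphere: "\<forall>x\<in>sphere 0 1. norm (F x) = 1"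
    and free_bdry_orth: "\<forall>x\<in>sphere 0 1. nu x \<bullet> F x = 0"
begin

lemma patch_at:
  assumes "norm x0 \<le> 1"
  obtains V N where "x0 \<in> V" "hypersurface_patch V (\<lambda>a x. F x $ a) N (frame F)"
    "\<And>x. x \<in> V \<Longrightarrow> norm x \<le> 1 \<Longrightarrow> sqA F nu x = hypersurface_patch.s N (frame F) x"
    "\<And>x. x \<in> V \<Longrightarrow> norm x \<le> 1 \<Longrightarrow> hypersurface_patch.H N (frame F) x = 0"
    "\<And>x. x \<in> V \<Longrightarrow> norm x \<le> 1 \<Longrightarrow> \<exists>\<sigma>. \<sigma> * \<sigma> = 1 \<and> (\<forall>a. nu x $ a = \<sigma> * N a x)"
proof -
  have "x0 \<in> cball 0 1" using assms by simp
  then obtain V N where VN: "x0 \<in> V" "V \<subseteq> U" "hypersurface_patch V (\<lambda>a x. F x $ a) N (frame F)"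
    "\<And>x. x \<in> V \<Longrightarrow> det (metric_mat F x) \<noteq> 0"
    using patch_exists[OF dim smooth, of x0 "nu x0"] U immersion unit_normal by (metis subsetD)
  have nu: "norm (nu x) = 1" "nu x \<bullet> dF F i x = 0" if "norm x \<le> 1" for x i
    using unit_normal that by auto
  note curv = patch_curvatures[where nu = nu, OF dim smooth VN(2,3,4)]
  show ?thesis
  proof (rule that[OF VN(1,3)])
    fix x assume x: "x \<in> V" "norm x \<le> 1"
    obtain \<sigma> where \<sigma>: "\<sigma> * \<sigma> = 1" "\<And>a. nu x $ a = \<sigma> * N a x"
      "sqA F nu x = hypersurface_patch.s N (frame F) x"
      "mean_curv F nu x = - \<sigma> * hypersurface_patch.H N (frame F) x"
      using curv[OF _ x(1) nu[OF x(2)]] by metis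
    show "sqA F nu x = hypersurface_patch.s N (frame F) x" by (rule \<sigma>(3))
    have "mean_curv F nu x = 0" using minimal x by simp
    then show "hypersurface_patch.H N (frame F) x = 0" using \<sigma>(1,4) by auto
    show "\<exists>\<sigma>. \<sigma> * \<sigma> = 1 \<and> (\<forall>a. nu x $ a = \<sigma> * N a x)" using \<sigma> by blast
  qed
qed

lemma lap_interior_max:
  assumes patch: "hypersurface_patch V X N E" and f: "smooth_fun V f" and x: "x \<in> V" "norm x < 1"
    and max: "\<And>y. y \<in> V \<Longrightarrow> norm y \<le> 1 \<Longrightarrow> f y \<le> f x"
  shows "hypersurface_patch.lap E f x \<le> 0"
proof -
  have V: "open V" using patch by (rule hypersurface_patch.open_V)
  interpret P: hypersurface_patch "V \<inter> ball 0 1" X N E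
    by (rule hypersurface_patch.subset_patch[OF patch]) (use V in auto)
  show ?thesis
    using x max by (intro P.lap_at_max smooth_fun_subset[OF f]) auto
qed

lemma continuous_F: "continuous_on (cball 0 1) F"
proof -
  have "continuous_on U F"
    using smooth_on_differentiable(1)[OF smooth]
    by (intro continuous_at_imp_continuous_on ballI differentiable_imp_continuous_within) auto
  then show ?thesis using U by (rule continuous_on_subset)
qed

text \<open>The squared distance to the origin is strictly subharmonic.\<close>

lemma norm_F_le_1:
  assumes "norm x \<le> 1"
  shows "norm (F x) \<le> 1"
proof -
  have "continuous_on (cball 0 1) (\<lambda>x. F x \<bullet> F x)"
    by (intro continuous_intros continuous_F)
  from max_on_cball[OF this] obtain z where z: "norm z \<le> 1" "\<And>y. norm y \<le> 1 \<Longrightarrow> F y \<bullet> F y \<le> F z \<bullet> F z"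
    by blast
  have "norm z = 1"
  proof (rule ccontr)
    assume "norm z \<noteq> 1"
    with z have lt: "norm z < 1" by simp
    obtain V N where VN: "z \<in> V" "hypersurface_patch V (\<lambda>a x. F x $ a) N (frame F)"
      "\<And>x. x \<in> V \<Longrightarrow> norm x \<le> 1 \<Longrightarrow> hypersurface_patch.H N (frame F) x = 0"
      using patch_at[OF z(1)] by metis
    interpret P: hypersurface_patch V "\<lambda>a x. F x $ a" N "frame F" by (rule VN(2))
    have r: "P.r y = F y \<bullet> F y" for y by (simp add: P.r_def inner_vec_def)
    have "P.lap P.r z \<le> 0"
      by (rule lap_interior_max[OF VN(2) P.smooth_r VN(1) lt]) (simp add: r z)
    moreover have "P.lap P.r z > 0"
      using P.lap_r[OF VN(1)] VN(1,3) z dim by simp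
    ultimately show False by simp
  qed
  then have "norm (F z) = 1" using bdry_in_sphere by simp
  then have "F z \<bullet> F z = 1" by (simp add: norm_eq_1)
  then have "F x \<bullet> F x \<le> 1" using z(2)[OF assms] by simp
  then show ?thesis by (simp add: norm_eq_sqrt_inner)
qed

lemma boundary_patch:
  assumes patch: "hypersurface_patch V (\<lambda>a x. F x $ a) N (frame F)"
    and nu: "\<And>x. x \<in> V \<Longrightarrow> norm x \<le> 1 \<Longrightarrow> \<exists>\<sigma>. \<sigma> * \<sigma> = 1 \<and> (\<forall>a. nu x $ a = \<sigma> * N a x)"
    and y: "y \<in> V" "norm y = 1"
  shows "(\<Sum>a\<in>UNIV. F y $ a * F y $ a) = 1" and "(\<Sum>a\<in>UNIV. F y $ a * N a y) = 0"
proof -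
  have "norm (F y) = 1" using bdry_in_sphere y by simp
  then show "(\<Sum>a\<in>UNIV. F y $ a * F y $ a) = 1" by (simp add: norm_eq_1 inner_vec_def)
  obtain \<sigma> where \<sigma>: "\<sigma> * \<sigma> = 1" "\<forall>a. nu y $ a = \<sigma> * N a y" using nu[of y] y by auto
  have "nu y \<bullet> F y = 0" using free_bdry_orth y by simp
  then have "\<sigma> * (\<Sum>a\<in>UNIV. F y $ a * N a y) = 0"
    using \<sigma>(2) by (simp add: inner_vec_def sum_distrib_left mult_ac)
  then show "(\<Sum>a\<in>UNIV. F y $ a * N a y) = 0" using \<sigma>(1) by auto
qed

text \<open>At a boundary point \<open>F\<close> itself is the conormal, and \<open>v\<close> is its pullback.\<close>

lemma conormal:
  assumes patch: "hypersurface_patch V (\<lambda>a x. F x $ a) N (frame F)"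
    and nu: "\<And>x. x \<in> V \<Longrightarrow> norm x \<le> 1 \<Longrightarrow> \<exists>\<sigma>. \<sigma> * \<sigma> = 1 \<and> (\<forall>a. nu x $ a = \<sigma> * N a x)"
    and x: "x \<in> V" "norm x = 1"
  defines "v \<equiv> (\<chi> i. \<Sum>c\<in>UNIV. F x $ c * frame F c i x)"
  shows "x \<bullet> v > 0"
    and "(\<Sum>c\<in>UNIV. F x $ c * hypersurface_patch.D (frame F) c f x) = (\<Sum>i\<in>UNIV. v $ i * pd i f x)"
    and "(\<Sum>i\<in>UNIV. v $ i * pd i (\<lambda>x. F x $ a) x) = F x $ a"
proof -
  interpret P: hypersurface_patch V "\<lambda>a x. F x $ a" N "frame F" by (rule patch)
  have D: "(\<Sum>c\<in>UNIV. F x $ c * P.D c f x) = (\<Sum>i\<in>UNIV. v $ i * pd i f x)" for f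
  proof -
    have "(\<Sum>c\<in>UNIV. F x $ c * P.D c f x) = (\<Sum>c\<in>UNIV. \<Sum>i\<in>UNIV. F x $ c * frame F c i x * pd i f x)"
      by (simp add: P.D_def sum_distrib_left mult.assoc)
    also have "\<dots> = (\<Sum>i\<in>UNIV. \<Sum>c\<in>UNIV. F x $ c * frame F c i x * pd i f x)" by (rule sum.swap)
    finally show ?thesis by (simp add: v_def sum_distrib_right)
  qed
  then show "(\<Sum>c\<in>UNIV. F x $ c * P.D c f x) = (\<Sum>i\<in>UNIV. v $ i * pd i f x)" .
  note FF = boundary_patch(1)[OF patch nu x] and FN = boundary_patch(2)[OF patch nu x]
  have "(\<Sum>c\<in>UNIV. F x $ c * P.D c (\<lambda>x. F x $ a) x) = F x $ a" for a
  proof -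
    have "F x $ c * P.D c (\<lambda>x. F x $ a) x = (if a = c then F x $ c else 0) - N a x * (F x $ c * N c x)" for c
      by (simp add: P.D_X[OF x(1)] algebra_simps)
    then show ?thesis by (simp add: sum_subtractf sum_distrib_left[symmetric] FN)
  qed
  then show DX: "(\<Sum>i\<in>UNIV. v $ i * pd i (\<lambda>x. F x $ a) x) = F x $ a" for a by (simp add: D)
  have sr: "smooth_fun V (\<lambda>x. P.r x - 1)"
    by (intro smooth_fun_diff P.open_V P.smooth_r smooth_fun_const)
  have pd_r: "pd i (\<lambda>x. P.r x - 1) x = pd i P.r x" for i
    using pd_add[of P.r x "\<lambda>_. - 1" i] smooth_fun_differentiable[OF P.smooth_r x(1)] by simp
  have FN': "(\<Sum>b\<in>UNIV. N b x * F x $ b) = 0" using FN by (simp add: mult.commute)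
  have Dr: "(\<Sum>i\<in>UNIV. v $ i * pd i P.r x) = 2"
    unfolding D[symmetric] P.D_r[OF x(1)] FN' using FF
    by (simp add: sum_distrib_left[symmetric] mult.left_commute[of _ 2])
  have r1: "P.r y \<le> 1" if "norm y \<le> 1" for y
  proof -
    have "P.r y = F y \<bullet> F y" by (simp add: P.r_def inner_vec_def)
    then show ?thesis using norm_F_le_1[OF that] by (simp add: dot_square_norm power_le_one)
  qed
  have r_eq: "P.r y = 1" if "y \<in> V" "norm y = 1" for y
    using boundary_patch(1)[OF patch nu that] by (simp add: P.r_def)
  \<comment> \<open>The derivative of |F|^2 along v is 2. For v tangent to the sphere it would be 0,
    as |F| = 1 there; for v pointing inward it would be at most 0, as |F|^2 has its maximum 1 at
    x.\<close>
  have "x \<bullet> v \<noteq> 0"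
  proof
    assume "x \<bullet> v = 0"
    from tangential_derivative_eq_0[OF P.open_V sr x this] r_eq have "(\<Sum>i\<in>UNIV. v $ i * pd i P.r x) = 0"
      by (simp add: pd_r)
    with Dr show False by simp
  qed
  moreover have "\<not> x \<bullet> v < 0"
  proof
    assume "x \<bullet> v < 0"
    then have "x \<bullet> (- v) > 0" by simp
    from outward_derivative_at_max[OF P.open_V P.smooth_r x(1) _ this] x r1 r_eq[OF x]
    have "(\<Sum>i\<in>UNIV. (- v) $ i * pd i P.r x) \<ge> 0" by simp
    with Dr show False by (simp add: sum_negf)
  qed
  ultimately show "x \<bullet> v > 0" by simp
qed

text \<open>The pullback of the conormal points out of the ball by \<open>conormal\<close>, so the
  one-sided first-order condition applies to it.\<close>

lemma boundary_max:
  assumes patch: "hypersurface_patch V (\<lambda>a x. F x $ a) N (frame F)"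
    and nu: "\<And>x. x \<in> V \<Longrightarrow> norm x \<le> 1 \<Longrightarrow> \<exists>\<sigma>. \<sigma> * \<sigma> = 1 \<and> (\<forall>a. nu x $ a = \<sigma> * N a x)"
    and x: "x \<in> V" "norm x = 1" and f: "smooth_fun V f"
    and max: "\<And>y. y \<in> V \<Longrightarrow> norm y \<le> 1 \<Longrightarrow> f y \<le> f x"
  shows "(\<Sum>c\<in>UNIV. F x $ c * hypersurface_patch.D (frame F) c f x) \<ge> 0"
proof -
  note c = conormal[OF patch nu x]
  have "norm x \<le> 1" using x by simp
  from outward_derivative_at_max[OF hypersurface_patch.open_V[OF patch] f x(1) this c(1) max]
  show ?thesis by (simp add: c(2))
qed

text \<open>The work is to verify \<open>gradient\<close>: differentials of functions vanishing on
  the boundary sphere are all multiples of one covector, and comparison with |F|^2 - 1, whose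
  tangential gradient is 2F, identifies its direction as F.\<close>

lemma conormal_derivative_sqA:
  assumes patch: "hypersurface_patch V (\<lambda>a x. F x $ a) N (frame F)"
    and nu: "\<And>x. x \<in> V \<Longrightarrow> norm x \<le> 1 \<Longrightarrow> \<exists>\<sigma>. \<sigma> * \<sigma> = 1 \<and> (\<forall>a. nu x $ a = \<sigma> * N a x)"
    and H: "\<And>x. x \<in> V \<Longrightarrow> norm x \<le> 1 \<Longrightarrow> hypersurface_patch.H N (frame F) x = 0"
    and x: "x \<in> V" "norm x = 1"
  shows "(\<Sum>c\<in>UNIV. F x $ c * hypersurface_patch.D (frame F) c (hypersurface_patch.s N (frame F)) x)
    \<le> - 2 * hypersurface_patch.s N (frame F) x"
proof -
  interpret P: hypersurface_patch V "\<lambda>a x. F x $ a" N "frame F" by (rule patch)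
  define \<Gamma> where "\<Gamma> = V \<inter> sphere 0 1"
  have normal_derivative: "(\<Sum>i\<in>UNIV. w $ i * pd i f y) = (y \<bullet> w) * (\<Sum>i\<in>UNIV. y $ i * pd i f y)"
    if f: "smooth_fun V f" and f0: "\<And>z. z \<in> \<Gamma> \<Longrightarrow> f z = 0" and y: "y \<in> \<Gamma>" for f y w
  proof -
    have yy: "y \<in> V" "norm y = 1" using y by (auto simp: \<Gamma>_def)
    have "y \<bullet> (w - (y \<bullet> w) *\<^sub>R y) = 0" using yy by (simp add: inner_diff_right norm_eq_1)
    from tangential_derivative_eq_0[OF P.open_V f yy this] f0
    have "(\<Sum>i\<in>UNIV. (w - (y \<bullet> w) *\<^sub>R y) $ i * pd i f y) = 0" by (simp add: \<Gamma>_def)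
    then show ?thesis by (simp add: left_diff_distrib sum_subtractf sum_distrib_left mult.assoc)
  qed
  have gradient: "P.D a f y = F y $ a * (\<Sum>c\<in>UNIV. F y $ c * P.D c f y)"
    if f: "smooth_fun V f" and f0: "\<And>z. z \<in> \<Gamma> \<Longrightarrow> f z = 0" and y: "y \<in> \<Gamma>" for f y a
  proof -
    have yy: "y \<in> V" "norm y = 1" using y by (auto simp: \<Gamma>_def)
    define e where "e c = y \<bullet> (\<chi> i. frame F c i y)" for c
    have D: "P.D c f y = e c * (\<Sum>i\<in>UNIV. y $ i * pd i f y)"
      if "smooth_fun V f" "\<And>z. z \<in> \<Gamma> \<Longrightarrow> f z = 0" for c f
      using normal_derivative[OF that y, of "\<chi> i. frame F c i y"] by (simp add: P.D_def e_def)
    have sr: "smooth_fun V (\<lambda>x. P.r x - 1)"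
      by (intro smooth_fun_diff P.open_V P.smooth_r smooth_fun_const)
    have r0: "P.r z - 1 = 0" if "z \<in> \<Gamma>" for z
      using boundary_patch(1)[OF patch nu, of z] that by (simp add: P.r_def \<Gamma>_def)
    define k where "k = (\<Sum>i\<in>UNIV. y $ i * pd i (\<lambda>x. P.r x - 1) y)"
    have Dr: "2 * F y $ a = e a * k" for a
    proof -
      have "P.D a (\<lambda>x. P.r x - 1) y = P.D a P.r y"
        by (subst P.D_diff) (auto simp: P.smooth_r yy)
      also have "\<dots> = 2 * F y $ a"
        using boundary_patch(2)[OF patch nu yy] by (simp add: P.D_r[OF yy(1)] mult.commute)
      finally show ?thesis using D[OF sr r0] by (simp add: k_def)
    qed
    have "k * (\<Sum>c\<in>UNIV. F y $ c * e c) = (\<Sum>c\<in>UNIV. F y $ c * (e c * k))"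
      by (simp add: sum_distrib_left mult_ac)
    also have "\<dots> = 2 * (\<Sum>c\<in>UNIV. F y $ c * F y $ c)"
      unfolding Dr[symmetric] by (simp add: sum_distrib_left mult_ac)
    finally have k: "k * (\<Sum>c\<in>UNIV. F y $ c * e c) = 2" using boundary_patch(1)[OF patch nu yy] by simp
    have "2 * (F y $ a * (\<Sum>c\<in>UNIV. F y $ c * P.D c f y))
        = e a * (k * (\<Sum>c\<in>UNIV. F y $ c * e c)) * (\<Sum>i\<in>UNIV. y $ i * pd i f y)"
      using Dr[of a] by (simp add: D[OF f f0] sum_distrib_right sum_distrib_left[symmetric] mult.assoc[symmetric])
    then show ?thesis using k D[OF f f0, of a] by simp
  qed
  show ?thesis
  proof (rule P.conormal_derivative_s[of \<Gamma>])
    show "\<Gamma> \<subseteq> V" "x \<in> \<Gamma>" using x by (auto simp: \<Gamma>_def)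
    show "P.D a f y = F y $ a * (\<Sum>c\<in>UNIV. F y $ c * P.D c f y)"
      if "smooth_fun V f" "\<And>z. z \<in> \<Gamma> \<Longrightarrow> f z = 0" "y \<in> \<Gamma>" for f y a
      by (rule gradient[OF that])
    show "(\<Sum>a\<in>UNIV. F y $ a * F y $ a) = 1" "(\<Sum>a\<in>UNIV. F y $ a * N a y) = 0" if "y \<in> \<Gamma>" for y
      using boundary_patch[OF patch nu, of y] that by (auto simp: \<Gamma>_def)
    show "P.H x = 0" using H x by simp
    have "pd i P.H x = 0" for i
      using x H by (intro pd_eq_0_on_cball[OF P.open_V P.smooth_H]) auto
    then show "P.D a P.H x = 0" for a by (simp add: P.D_def)
  qed
qed

end

section \<open>The comparison argument\<close>

context minimal_disk
begin

text \<open>On the disk, \<open>sqA F nu\<close> agrees locally with the smooth \<open>s\<close> of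
  a patch, so possible jumps of \<open>nu\<close> between the two normals are harmless.\<close>

lemma continuous_sqA: "continuous_on (cball 0 1) (sqA F nu)"
  unfolding continuous_on_def
proof
  fix x :: "real^'n" assume "x \<in> cball 0 1"
  then have x: "norm x \<le> 1" by simp
  obtain V N where VN: "x \<in> V" "hypersurface_patch V (\<lambda>a x. F x $ a) N (frame F)"
    "\<And>x. x \<in> V \<Longrightarrow> norm x \<le> 1 \<Longrightarrow> sqA F nu x = hypersurface_patch.s N (frame F) x"
    using patch_at[OF x] by metis
  interpret P: hypersurface_patch V "\<lambda>a x. F x $ a" N "frame F" by (rule VN(2))
  have "isCont P.s x"
    using smooth_fun_differentiable[OF P.smooth_s VN(1)] by (rule differentiable_imp_continuous_within)
  then have "(P.s \<longlongrightarrow> sqA F nu x) (at x within cball 0 1)"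
    using VN(1,3) x by (simp add: isCont_def Lim_at_imp_Lim_at_within)
  moreover have "\<forall>\<^sub>F y in at x within cball 0 1. P.s y = sqA F nu y"
    unfolding eventually_at_topological using P.open_V VN by auto
  ultimately show "(sqA F nu \<longlongrightarrow> sqA F nu x) (at x within cball 0 1)"
    by (rule Lim_transform_eventually)
qed

lemma sqA_nonneg: "norm x \<le> 1 \<Longrightarrow> sqA F nu x \<ge> 0"
proof -
  assume x: "norm x \<le> 1"
  obtain V N where VN: "x \<in> V" "hypersurface_patch V (\<lambda>a x. F x $ a) N (frame F)"
    "\<And>x. x \<in> V \<Longrightarrow> norm x \<le> 1 \<Longrightarrow> sqA F nu x = hypersurface_patch.s N (frame F) x"
    using patch_at[OF x] by metis
  interpret P: hypersurface_patch V "\<lambda>a x. F x $ a" N "frame F" by (rule VN(2))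
  have "P.s x \<ge> 0" unfolding P.s_def by (intro sum_nonneg) auto
  then show ?thesis using VN x by simp
qed

text \<open>At a boundary maximum the conormal derivative would be nonnegative, yet it is at most
  -2S < 0.\<close>

lemma sqA_boundary_less_max:
  assumes z: "\<And>y. norm y \<le> 1 \<Longrightarrow> sqA F nu y \<le> S" "S > 0" and x: "norm x = 1"
  shows "sqA F nu x < S"
proof (rule ccontr)
  assume "\<not> sqA F nu x < S"
  then have S: "sqA F nu x = S" using z(1)[of x] x by simp
  obtain V N where VN: "x \<in> V" "hypersurface_patch V (\<lambda>a x. F x $ a) N (frame F)"
    "\<And>x. x \<in> V \<Longrightarrow> norm x \<le> 1 \<Longrightarrow> sqA F nu x = hypersurface_patch.s N (frame F) x"
    "\<And>x. x \<in> V \<Longrightarrow> norm x \<le> 1 \<Longrightarrow> hypersurface_patch.H N (frame F) x = 0"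
    "\<And>x. x \<in> V \<Longrightarrow> norm x \<le> 1 \<Longrightarrow> \<exists>\<sigma>. \<sigma> * \<sigma> = 1 \<and> (\<forall>a. nu x $ a = \<sigma> * N a x)"
    using patch_at[of x] x by (metis order_refl)
  interpret P: hypersurface_patch V "\<lambda>a x. F x $ a" N "frame F" by (rule VN(2))
  have s: "P.s x = S" using VN(1,3) x S by simp
  have "P.s y \<le> P.s x" if "y \<in> V" "norm y \<le> 1" for y
    using VN(3)[OF that] z(1)[OF that(2)] s by simp
  from boundary_max[OF VN(2,5,1) x P.smooth_s this]
  have "(\<Sum>c\<in>UNIV. F x $ c * P.D c P.s x) \<ge> 0" by simp
  moreover have "(\<Sum>c\<in>UNIV. F x $ c * P.D c P.s x) \<le> - 2 * P.s x"
    by (rule conormal_derivative_sqA[OF VN(2,5,4,1) x])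
  ultimately show False using s z(2) by simp
qed

text \<open>The comparison function \<open>|A|\<^sup>2 - \<delta> |A|\<^sup>4 + c |F|\<^sup>2\<close>: the correction by \<open>\<delta>\<close> makes all
  inequalities strict, which spares the strong maximum principle and the Hopf boundary lemma.\<close>

lemma not_subharmonic_and_inward_decreasing:
  assumes \<delta>: "\<delta> > 0" "\<And>y. norm y \<le> 1 \<Longrightarrow> 6 * \<delta> * sqA F nu y \<le> 1"
    and interior: "\<And>y. norm y \<le> 1 \<Longrightarrow> (sqA F nu y)\<^sup>2 * (1 - 2 * \<delta> * sqA F nu y) < c * real CARD('n)"
    and boundary: "\<And>y. norm y = 1 \<Longrightarrow> c < sqA F nu y * (1 - 2 * \<delta> * sqA F nu y)"
  shows False
proof -
  let ?W = "\<lambda>x. sqA F nu x - \<delta> * (sqA F nu x)\<^sup>2 + c * (F x \<bullet> F x)"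
  have "continuous_on (cball 0 1) ?W"
    by (intro continuous_intros continuous_sqA continuous_F)
  from max_on_cball[OF this] obtain z where z: "norm z \<le> 1" "\<And>y. norm y \<le> 1 \<Longrightarrow> ?W y \<le> ?W z"
    by blast
  obtain V N where VN: "z \<in> V" "hypersurface_patch V (\<lambda>a x. F x $ a) N (frame F)"
    "\<And>x. x \<in> V \<Longrightarrow> norm x \<le> 1 \<Longrightarrow> sqA F nu x = hypersurface_patch.s N (frame F) x"
    "\<And>x. x \<in> V \<Longrightarrow> norm x \<le> 1 \<Longrightarrow> hypersurface_patch.H N (frame F) x = 0"
    "\<And>x. x \<in> V \<Longrightarrow> norm x \<le> 1 \<Longrightarrow> \<exists>\<sigma>. \<sigma> * \<sigma> = 1 \<and> (\<forall>a. nu x $ a = \<sigma> * N a x)"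
    using patch_at[OF z(1)] by metis
  interpret P: hypersurface_patch V "\<lambda>a x. F x $ a" N "frame F" by (rule VN(2))
  define f where "f x = P.s x + (- \<delta>) * (P.s x * P.s x) + c * P.r x" for x
  have f_eq: "f y = ?W y" if "y \<in> V" "norm y \<le> 1" for y
    using VN(3)[OF that] by (simp add: f_def P.r_def inner_vec_def power2_eq_square)
  have max: "f y \<le> f z" if "y \<in> V" "norm y \<le> 1" for y
    using z(2)[OF that(2)] f_eq[OF that] f_eq[OF VN(1) z(1)] by simp
  have ss: "smooth_fun V (\<lambda>x. P.s x * P.s x)" "smooth_fun V (\<lambda>x. (- \<delta>) * (P.s x * P.s x))"
    "smooth_fun V (\<lambda>x. P.s x + (- \<delta>) * (P.s x * P.s x))" "smooth_fun V (\<lambda>x. c * P.r x)"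
    by (intro smooth_fun_add smooth_fun_mult smooth_fun_const P.open_V P.smooth_s P.smooth_r)+
  have sf: "smooth_fun V f"
    unfolding f_def[abs_def] by (intro smooth_fun_add P.open_V ss)
  define t where "t = P.s z"
  have t: "sqA F nu z = t" using VN(1,3) z(1) by (simp add: t_def)
  have t0: "t \<ge> 0" using sqA_nonneg[OF z(1)] t by simp
  have \<delta>t: "6 * \<delta> * t \<le> 1" using \<delta>(2)[OF z(1)] t by simp
  consider "norm z < 1" | "norm z = 1" using z(1) by linarith
  then show False
  proof cases
    case 1
    interpret Q: hypersurface_patch "V \<inter> ball 0 1" "\<lambda>a x. F x $ a" N "frame F"
      by (rule P.subset_patch) (use P.open_V in auto)
    have "Q.H y = 0" if "y \<in> V \<inter> ball 0 1" for y using that VN(4) by auto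
    then obtain \<tau> where \<tau>: "\<tau> \<ge> 0" "P.lap P.s z = 2 * \<tau> - 2 * t\<^sup>2"
      "(\<Sum>c\<in>UNIV. (P.D c P.s z)\<^sup>2) \<le> 4 * t * \<tau>"
      using Q.simons[of z] VN(1) 1 by (auto simp: t_def)
    have "P.lap f z \<le> 0"
      by (rule lap_interior_max[OF VN(2) sf VN(1) 1 max])
    moreover have "P.lap f z = P.lap P.s z
        - \<delta> * (2 * t * P.lap P.s z + 2 * (\<Sum>c\<in>UNIV. (P.D c P.s z)\<^sup>2)) + c * P.lap P.r z"
      unfolding f_def[abs_def]
      by (simp only: P.lap_add[OF ss(3,4) VN(1)] P.lap_add[OF P.smooth_s ss(2) VN(1)]
          P.lap_cmult[OF ss(1) VN(1)] P.lap_cmult[OF P.smooth_r VN(1)]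
          P.lap_mult[OF P.smooth_s P.smooth_s VN(1)])
        (simp add: t_def power2_eq_square algebra_simps)
    moreover have "P.lap P.r z = 2 * real CARD('n)"
      using P.lap_r[OF VN(1)] VN(1,4) z(1) dim by simp
    ultimately have "(1 - 2 * \<delta> * t) * (2 * \<tau> - 2 * t\<^sup>2) - 2 * \<delta> * (\<Sum>c\<in>UNIV. (P.D c P.s z)\<^sup>2)
        + 2 * (c * real CARD('n)) \<le> 0"
      by (simp add: \<tau>(2) algebra_simps)
    moreover have "\<delta> * (\<Sum>c\<in>UNIV. (P.D c P.s z)\<^sup>2) \<le> \<delta> * (4 * t * \<tau>)"
      using \<tau>(3) \<delta>(1) by (intro mult_left_mono) auto
    \<comment> \<open>The loss 4\<delta>t\<tau> from the factor of lap s and the loss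
      8\<delta>t\<tau> from the gradient term combine into the factor 1 - 6\<delta>t.\<close>
    moreover have "(1 - 2 * \<delta> * t) * (2 * \<tau> - 2 * t\<^sup>2) - 2 * (\<delta> * (4 * t * \<tau>))
        = 2 * ((1 - 6 * \<delta> * t) * \<tau>) - 2 * (t\<^sup>2 * (1 - 2 * \<delta> * t))"
      by (simp add: algebra_simps)
    moreover have "(1 - 6 * \<delta> * t) * \<tau> \<ge> 0" using \<delta>t \<tau>(1) by simp
    moreover have "t\<^sup>2 * (1 - 2 * \<delta> * t) < c * real CARD('n)" using interior[OF z(1)] t by simp
    ultimately show False by linarith
  next
    case 2
    have "P.D a f z = (1 - 2 * \<delta> * t) * P.D a P.s z + c * P.D a P.r z" for a
      unfolding f_def[abs_def]
      by (simp only: P.D_add[OF ss(3,4) VN(1)] P.D_add[OF P.smooth_s ss(2) VN(1)]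
          P.D_cmult[OF ss(1) VN(1)] P.D_cmult[OF P.smooth_r VN(1)]
          P.D_mult[OF P.smooth_s P.smooth_s VN(1)])
        (simp add: t_def algebra_simps)
    then have D_f: "(\<Sum>a\<in>UNIV. F z $ a * P.D a f z)
        = (1 - 2 * \<delta> * t) * (\<Sum>a\<in>UNIV. F z $ a * P.D a P.s z) + c * (\<Sum>a\<in>UNIV. F z $ a * P.D a P.r z)"
      by (simp add: distrib_left sum.distrib sum_distrib_left mult_ac)
    have "(\<Sum>a\<in>UNIV. F z $ a * P.D a P.r z) = 2"
    proof -
      have "(\<Sum>b\<in>UNIV. N b z * F z $ b) = 0"
        using boundary_patch(2)[OF VN(2,5,1) 2] by (simp add: mult.commute)
      then have "(\<Sum>a\<in>UNIV. F z $ a * P.D a P.r z) = 2 * (\<Sum>a\<in>UNIV. F z $ a * F z $ a)"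
        by (simp add: P.D_r[OF VN(1)] sum_distrib_left mult_ac)
      then show ?thesis using boundary_patch(1)[OF VN(2,5,1) 2] by simp
    qed
    with D_f have "(\<Sum>a\<in>UNIV. F z $ a * P.D a f z) = (1 - 2 * \<delta> * t) * (\<Sum>a\<in>UNIV. F z $ a * P.D a P.s z) + 2 * c"
      by simp
    moreover have "(\<Sum>a\<in>UNIV. F z $ a * P.D a P.s z) \<le> - 2 * t"
      unfolding t_def by (rule conormal_derivative_sqA[OF VN(2,5,4,1) 2])
    then have "(1 - 2 * \<delta> * t) * (\<Sum>a\<in>UNIV. F z $ a * P.D a P.s z) \<le> (1 - 2 * \<delta> * t) * (- 2 * t)"
      using \<delta>t \<delta>(1) t0 by (intro mult_left_mono) auto
    moreover have "(1 - 2 * \<delta> * t) * (- 2 * t) = - 2 * (t * (1 - 2 * \<delta> * t))" by (simp add: algebra_simps)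
    moreover have "(\<Sum>a\<in>UNIV. F z $ a * P.D a f z) \<ge> 0"
      by (rule boundary_max[OF VN(2,5,1) 2 sf max])
    moreover have "c < t * (1 - 2 * \<delta> * t)" using boundary[OF 2] t by simp
    ultimately show False by linarith
  qed
qed

lemma sqA_sup_inf:
  assumes sup: "\<And>y. norm y \<le> 1 \<Longrightarrow> sqA F nu y \<le> S" and S: "S > 0"
    and inf: "\<And>y. norm y = 1 \<Longrightarrow> I \<le> sqA F nu y"
  shows "real CARD('n) * I < S\<^sup>2"
proof (rule ccontr)
  assume "\<not> real CARD('n) * I < S\<^sup>2"
  then have le: "S\<^sup>2 \<le> real CARD('n) * I" by simp
  \<comment> \<open>Any boundary point serves to pass the strict bound on to I.\<close>
  have "norm (axis undefined 1 :: real^'n) = 1" by simp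
  from sqA_boundary_less_max[OF sup S this] inf[OF this] have IS: "I < S" by simp
  have n: "real CARD('n) > 0" by simp
  have "real CARD('n) * I > 0" using le S by (smt (verit) zero_less_power)
  then have I: "I > 0" using n by (simp add: zero_less_mult_iff)
  define \<delta> where "\<delta> = 1 / (6 * S)"
  have \<delta>: "\<delta> > 0" "6 * \<delta> * S = 1" using S by (auto simp: \<delta>_def)
  have small: "6 * \<delta> * t \<le> 1" if "t \<le> S" for t
    using mult_left_mono[OF that, of "6 * \<delta>"] \<delta> by simp
  have "S\<^sup>2 * (1 - 2 * \<delta> * S) < real CARD('n) * (I * (1 - 2 * \<delta> * I))"
  proof -
    have "1 - 2 * \<delta> * S < 1 - 2 * \<delta> * I" using IS \<delta> by simp
    then have "S\<^sup>2 * (1 - 2 * \<delta> * S) < S\<^sup>2 * (1 - 2 * \<delta> * I)" using S by simp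
    also have "\<dots> \<le> real CARD('n) * I * (1 - 2 * \<delta> * I)"
    proof (rule mult_right_mono[OF le])
      have "6 * \<delta> * I \<le> 1" using IS by (intro small) simp
      moreover have "\<delta> * I > 0" using \<delta> I by simp
      ultimately show "0 \<le> 1 - 2 * \<delta> * I" by linarith
    qed
    finally show ?thesis by (simp add: mult.assoc)
  qed
  then have "S\<^sup>2 * (1 - 2 * \<delta> * S) / real CARD('n) < I * (1 - 2 * \<delta> * I)"
    using n by (simp add: field_simps)
  then obtain c where c: "S\<^sup>2 * (1 - 2 * \<delta> * S) / real CARD('n) < c" "c < I * (1 - 2 * \<delta> * I)"
    using dense by blast
  show False
  proof (rule not_subharmonic_and_inward_decreasing[OF \<delta>(1)])
    fix y :: "real^'n"
    show "6 * \<delta> * sqA F nu y \<le> 1" if "norm y \<le> 1" using small[OF sup[OF that]] .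
    show "(sqA F nu y)\<^sup>2 * (1 - 2 * \<delta> * sqA F nu y) < c * real CARD('n)" if y: "norm y \<le> 1"
    proof -
      \<comment> \<open>As 6\<delta>S = 1, t^2 (1 - 2\<delta>t) increases on [0, S], so t = S is the
        worst case; the factorisation shows this without differentiating.\<close>
      define t where "t = sqA F nu y"
      have t: "0 \<le> t" "t \<le> S" using sup[OF y] sqA_nonneg[OF y] by (auto simp: t_def)
      have "S\<^sup>2 * (1 - 2 * \<delta> * S) - t\<^sup>2 * (1 - 2 * \<delta> * t)
          = (S - t) * (S * (1 - 2 * \<delta> * S) + t * (1 - 2 * \<delta> * S - 2 * \<delta> * t))"
        by (simp add: power2_eq_square algebra_simps)
      moreover have "1 - 2 * \<delta> * S - 2 * \<delta> * t \<ge> 0" using small[OF t(2)] \<delta>(2) by linarith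
      moreover have "1 - 2 * \<delta> * S \<ge> 0" using \<delta>(2) by linarith
      ultimately have "S\<^sup>2 * (1 - 2 * \<delta> * S) - t\<^sup>2 * (1 - 2 * \<delta> * t) \<ge> 0"
        using t S by simp
      moreover have "S\<^sup>2 * (1 - 2 * \<delta> * S) < c * real CARD('n)" using c(1) n by (simp add: field_simps)
      ultimately show ?thesis by (simp add: t_def)
    qed
    show "c < sqA F nu y * (1 - 2 * \<delta> * sqA F nu y)" if y: "norm y = 1"
    proof -
      \<comment> \<open>Likewise t (1 - 2\<delta>t) increases on [I, S], so t = I is the worst
        case.\<close>
      define t where "t = sqA F nu y"
      have t: "I \<le> t" "t \<le> S" using sup[of y] inf[OF y] y by (auto simp: t_def)
      have "t * (1 - 2 * \<delta> * t) - I * (1 - 2 * \<delta> * I) = (t - I) * (1 - 2 * \<delta> * t - 2 * \<delta> * I)"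
        by (simp add: algebra_simps)
      moreover have "1 - 2 * \<delta> * t - 2 * \<delta> * I \<ge> 0"
        using small[OF t(2)] small[of I] IS by simp
      ultimately have "t * (1 - 2 * \<delta> * t) - I * (1 - 2 * \<delta> * I) \<ge> 0" using t by simp
      then show ?thesis using c(2) by (simp add: t_def)
    qed
  qed
qed

section \<open>The totally geodesic case\<close>

lemma nu_locally_constant:
  assumes flat: "\<And>x. norm x \<le> 1 \<Longrightarrow> sqA F nu x = 0" and x0: "norm x0 \<le> 1"
  obtains d where "d > 0" "\<And>y. y \<in> ball x0 d \<Longrightarrow> norm y \<le> 1 \<Longrightarrow> nu y = nu x0 \<or> nu y = - nu x0"
proof -
  obtain V N where VN: "x0 \<in> V" "hypersurface_patch V (\<lambda>a x. F x $ a) N (frame F)"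
    "\<And>x. x \<in> V \<Longrightarrow> norm x \<le> 1 \<Longrightarrow> sqA F nu x = hypersurface_patch.s N (frame F) x"
    "\<And>x. x \<in> V \<Longrightarrow> norm x \<le> 1 \<Longrightarrow> \<exists>\<sigma>. \<sigma> * \<sigma> = 1 \<and> (\<forall>a. nu x $ a = \<sigma> * N a x)"
    using patch_at[OF x0] by metis
  interpret P: hypersurface_patch V "\<lambda>a x. F x $ a" N "frame F" by (rule VN(2))
  obtain d where d: "d > 0" "ball x0 d \<subseteq> V" using P.open_V VN(1) openE by blast
  \<comment> \<open>Vanishing derivatives make N constant on this set because it is convex; the sign
    between \<open>nu\<close> and N remains free at each point.\<close>
  let ?S = "ball x0 d \<inter> cball 0 1"
  have dN: "pd i (N a) y = 0" if "y \<in> ?S" for i a y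
  proof -
    have y: "y \<in> V" "norm y \<le> 1" using that d(2) by auto
    have "P.s y = 0" using VN(3)[OF y] flat[OF y(2)] by simp
    then have "(\<Sum>b\<in>UNIV. P.B a b y * P.B a b y) = 0" for a
      unfolding P.s_def by (subst (asm) sum_nonneg_eq_0_iff) (auto intro: sum_nonneg)
    then have "P.B a b y * P.B a b y = 0" for a b
      by (subst (asm) sum_nonneg_eq_0_iff) auto
    then have "P.D c (N a) y = 0" for c by (simp add: P.B_def)
    then show ?thesis by (simp add: P.pd_eq_sum_D[OF y(1), of i "N a"])
  qed
  have "(N a has_derivative (\<lambda>h. 0)) (at y within ?S)" if "y \<in> ?S" for a y
  proof (rule has_derivative_at_withinI)
    have "y \<in> V" using that d by auto
    from has_derivative_pd[OF smooth_fun_differentiable[OF P.smooth_N this]] dN[OF that]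
    show "(N a has_derivative (\<lambda>h. 0)) (at y)" by simp
  qed
  then have "\<exists>c. \<forall>y\<in>?S. N a y = c" for a
    by (intro has_derivative_zero_constant convex_Int convex_ball convex_cball)
  then have N: "N a y = N a x0" if "y \<in> ?S" for a y
    using that x0 d(1) by (metis IntI centre_in_ball mem_cball_0)
  show ?thesis
  proof (rule that[OF d(1)])
    fix y assume "y \<in> ball x0 d" "norm y \<le> 1"
    then have y: "y \<in> ?S" "y \<in> V" "norm y \<le> 1" using d by auto
    obtain \<sigma> \<sigma>' where \<sigma>: "\<sigma> * \<sigma> = 1" "\<And>a. nu y $ a = \<sigma> * N a y"
      and \<sigma>': "\<sigma>' * \<sigma>' = 1" "\<And>a. nu x0 $ a = \<sigma>' * N a x0"
      using VN(4)[OF y(2,3)] VN(4)[OF VN(1) x0] by blast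
    have "\<sigma> = \<sigma>' \<or> \<sigma> = - \<sigma>'" using \<sigma>(1) \<sigma>'(1) by (metis square_eq_iff)
    then show "nu y = nu x0 \<or> nu y = - nu x0"
      using \<sigma>(2) \<sigma>'(2) N[OF y(1)] by (auto simp: vec_eq_iff)
  qed
qed

text \<open>Agreement up to sign is an equivalence relation, so the local statement spreads over the
  connected disk.\<close>

lemma nu_constant:
  assumes flat: "\<And>x. norm x \<le> 1 \<Longrightarrow> sqA F nu x = 0" and x: "norm x \<le> 1"
  shows "nu x = nu 0 \<or> nu x = - nu 0"
proof (rule connected_equivalence_relation[where S = "cball 0 1" and R = "\<lambda>x y. nu y = nu x \<or> nu y = - nu x"])
  show "connected (cball (0::real^'n) 1)" by simp
  show "(0::real^'n) \<in> cball 0 1" "x \<in> cball 0 1" using x by auto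
  fix y :: "real^'n" assume "y \<in> cball 0 1"
  then have "norm y \<le> 1" by simp
  from nu_locally_constant[OF flat this] obtain d where d: "d > 0"
    "\<And>w. w \<in> ball y d \<Longrightarrow> norm w \<le> 1 \<Longrightarrow> nu w = nu y \<or> nu w = - nu y" by metis
  show "\<exists>T. openin (top_of_set (cball 0 1)) T \<and> y \<in> T \<and> (\<forall>w\<in>T. nu w = nu y \<or> nu w = - nu y)"
    using d \<open>norm y \<le> 1\<close> by (intro exI[of _ "cball 0 1 \<inter> ball y d"]) auto
qed auto

text \<open>For surjectivity onto the flat disk, a point of \<open>F ` cball 0 1\<close> closest to \<open>q\<close> must be \<open>q\<close>: at an
  interior point \<open>F - q\<close> is normal, and at a boundary point \<open>F - q\<close> makes no acute angle with
  the conormal \<open>F\<close>.\<close>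

lemma flat_disk:
  assumes flat: "\<And>x. norm x \<le> 1 \<Longrightarrow> sqA F nu x = 0"
  shows "F ` cball 0 1 = {p. norm p \<le> 1 \<and> p \<bullet> nu 0 = 0}"
proof -
  define a where "a = nu 0"
  have nu: "nu x = a \<or> nu x = - a" if "norm x \<le> 1" for x
    using nu_constant[OF flat that] by (simp add: a_def)
  have a_dF: "dF F i x \<bullet> a = 0" if "norm x \<le> 1" for x i
  proof -
    have "nu x \<bullet> dF F i x = 0" using unit_normal that by simp
    then show ?thesis using nu[OF that] by (auto simp: inner_commute)
  qed
  have "((\<lambda>x. F x \<bullet> a) has_derivative (\<lambda>h. 0)) (at x within cball 0 1)" if "x \<in> cball 0 1" for x
  proof (rule has_derivative_at_withinI)
    have d: "F differentiable (at x)" using smooth_on_differentiable(1)[OF smooth] U that by auto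
    then have "((\<lambda>x. F x \<bullet> a) has_derivative (\<lambda>h. frechet_derivative F (at x) h \<bullet> a)) (at x)"
      by (intro has_derivative_inner_left) (simp add: frechet_derivative_works)
    moreover have "frechet_derivative F (at x) h \<bullet> a = 0" for h
      using a_dF that by (simp add: frechet_derivative_eq_sum_dF[OF d] inner_sum_left)
    ultimately show "((\<lambda>x. F x \<bullet> a) has_derivative (\<lambda>h. 0)) (at x)" by simp
  qed
  then obtain c where c: "\<And>x. x \<in> cball 0 1 \<Longrightarrow> F x \<bullet> a = c"
    using has_derivative_zero_constant[of "cball 0 1" "\<lambda>x. F x \<bullet> a"] by (metis convex_cball)
  \<comment> \<open>The constant height c is zero because the free boundary condition makes F
    orthogonal to the normal at some boundary point.\<close>
  have bd: "norm (axis undefined 1 :: real^'n) = 1" by simp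
  then have "nu (axis undefined 1) \<bullet> F (axis undefined 1) = 0" using free_bdry_orth by simp
  then have "F (axis undefined 1) \<bullet> a = 0"
    using nu[of "axis undefined 1"] bd by (auto simp: inner_commute)
  then have Fa: "F x \<bullet> a = 0" if "norm x \<le> 1" for x
    using c[of "axis undefined 1"] c[of x] bd that by simp
  have "q \<in> F ` cball 0 1" if q: "norm q \<le> 1" "q \<bullet> a = 0" for q
  proof -
    have "continuous_on (cball 0 1) (\<lambda>x. - ((F x - q) \<bullet> (F x - q)))"
      by (intro continuous_intros continuous_F)
    from max_on_cball[OF this] obtain z where z: "norm z \<le> 1"
      "\<And>y. norm y \<le> 1 \<Longrightarrow> - ((F y - q) \<bullet> (F y - q)) \<le> - ((F z - q) \<bullet> (F z - q))"
    by blast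
    obtain V N where VN: "z \<in> V" "hypersurface_patch V (\<lambda>a x. F x $ a) N (frame F)"
      "\<And>x. x \<in> V \<Longrightarrow> norm x \<le> 1 \<Longrightarrow> \<exists>\<sigma>. \<sigma> * \<sigma> = 1 \<and> (\<forall>a. nu x $ a = \<sigma> * N a x)"
      using patch_at[OF z(1)] by metis
    interpret P: hypersurface_patch V "\<lambda>a x. F x $ a" N "frame F" by (rule VN(2))
    have zU: "z \<in> U" using z(1) U by auto
    define e where "e b x = F x $ b - q $ b" for b x
    have se: "smooth_fun V (e b)" for b
      unfolding e_def[abs_def] by (intro smooth_fun_diff P.open_V P.smooth_X smooth_fun_const)
    have pd_e: "pd i (e b) z = pd i (\<lambda>x. F x $ b) z" for i b
      using pd_add[of "\<lambda>x. F x $ b" z "\<lambda>_. - q $ b" i] smooth_fun_differentiable[OF P.smooth_X VN(1)]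
      by (simp add: e_def[abs_def])
    define f where "f x = - (\<Sum>b\<in>UNIV. e b x * e b x)" for x
    have sf: "smooth_fun V f"
      unfolding f_def[abs_def] by (intro smooth_fun_minus smooth_fun_sum smooth_fun_mult P.open_V se)
    have f_eq: "f x = - ((F x - q) \<bullet> (F x - q))" for x by (simp add: f_def e_def inner_vec_def)
    have max: "f y \<le> f z" if "norm y \<le> 1" for y using z(2)[OF that] by (simp add: f_eq)
    have pd_f: "pd i f z = - 2 * (\<Sum>b\<in>UNIV. e b z * pd i (\<lambda>x. F x $ b) z)" for i
    proof -
      have s2: "smooth_fun V (\<lambda>x. \<Sum>b\<in>UNIV. e b x * e b x)"
        by (intro smooth_fun_sum smooth_fun_mult P.open_V se)
      have "pd i f z = - 1 * pd i (\<lambda>x. \<Sum>b\<in>UNIV. e b x * e b x) z"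
        using pd_mult[of "\<lambda>_. - 1" z "\<lambda>x. \<Sum>b\<in>UNIV. e b x * e b x" i] smooth_fun_differentiable[OF s2 VN(1)]
        by (simp add: f_def[abs_def])
      also have "pd i (\<lambda>x. \<Sum>b\<in>UNIV. e b x * e b x) z = 2 * (\<Sum>b\<in>UNIV. e b z * pd i (e b) z)"
        by (rule pd_sum_squares) (rule smooth_fun_differentiable[OF se VN(1)])
      finally show ?thesis by (simp add: pd_e)
    qed
    consider "norm z < 1" | "norm z = 1" using z(1) by linarith
    then have "F z = q"
    proof cases
      case 1
      have "pd i f z = 0" for i
        using VN(1) 1 max P.open_V
        by (intro pd_eq_0_at_max[of "V \<inter> ball 0 1"] smooth_fun_subset[OF sf]) auto
      then have "(F z - q) \<bullet> dF F i z = 0" for i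
        by (simp add: pd_f e_def inner_vec_def dF_component[OF smooth zU])
      moreover have "(F z - q) \<bullet> nu z = 0"
        using nu[OF z(1)] Fa[OF z(1)] q(2) by (auto simp: inner_diff_left)
      ultimately have "F z - q = 0"
        using normal_unique[OF dim smooth_on_differentiable(1)[OF smooth zU], of "nu z" "F z - q"]
          immersion unit_normal z(1) by simp
      then show ?thesis by simp
    next
      case 2
      define v where "v = (\<chi> i. \<Sum>c\<in>UNIV. F z $ c * frame F c i z)"
      note con = conormal[OF VN(2,3,1) 2, folded v_def]
      have "norm z \<le> 1" using 2 by simp
      from outward_derivative_at_max[OF P.open_V sf VN(1) this con(1) max]
      have "(\<Sum>i\<in>UNIV. v $ i * pd i f z) \<ge> 0" by simp
      also have "(\<Sum>i\<in>UNIV. v $ i * pd i f z) = - 2 * (\<Sum>i\<in>UNIV. \<Sum>b\<in>UNIV. e b z * (v $ i * pd i (\<lambda>x. F x $ b) z))"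
        by (simp add: pd_f sum_distrib_left sum_negf mult_ac)
      also have "(\<Sum>i\<in>UNIV. \<Sum>b\<in>UNIV. e b z * (v $ i * pd i (\<lambda>x. F x $ b) z))
          = (\<Sum>b\<in>UNIV. \<Sum>i\<in>UNIV. e b z * (v $ i * pd i (\<lambda>x. F x $ b) z))" by (rule sum.swap)
      also have "\<dots> = (F z - q) \<bullet> F z"
        by (simp add: sum_distrib_left[symmetric] con(3) e_def inner_vec_def)
      finally have 1: "(F z - q) \<bullet> F z \<le> 0" by simp
      \<comment> \<open>With |F z| = 1, fact \<open>1\<close> says that F z . q is at least 1; as
        |q| is at most 1, |F z - q|^2 cannot be positive.\<close>
      have "F z \<bullet> F z = 1" using bdry_in_sphere 2 by (simp add: norm_eq_1)
      moreover have "q \<bullet> q \<le> 1" using q(1) by (simp add: dot_square_norm power_le_one)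
      ultimately have "(F z - q) \<bullet> (F z - q) \<le> 0"
        using 1 by (simp add: inner_diff_left inner_diff_right inner_commute)
      then have "(F z - q) \<bullet> (F z - q) = 0" by (intro antisym inner_ge_zero)
      then show ?thesis by simp
    qed
    then show ?thesis using z(1) by auto
  qed
  then show ?thesis using Fa norm_F_le_1 by (auto simp: a_def[symmetric])
qed

end

theorem theorem1p4:
  fixes F :: "real^'n \<Rightarrow> real^'m" and nu :: "real^'n \<Rightarrow> real^'m" and U :: "(real^'n) set"
  assumes dim: "CARD('m) = CARD('n) + 1"
    and smooth: "smooth_on U F" and U: "cball 0 1 \<subseteq> U"
    and immersion: "\<forall>x\<in>cball 0 1. inj (frechet_derivative F (at x))"
    and unit_normal: "\<forall>x\<in>cball 0 1. norm (nu x) = 1 \<and> (\<forall>i. nu x \<bullet> dF F i x = 0)"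
    and minimal: "\<forall>x\<in>cball 0 1. mean_curv F nu x = 0"
    and free_bdry_set: "F ` sphere 0 1 = F ` cball 0 1 \<inter> sphere 0 1"
    and free_bdry_orth: "\<forall>x\<in>sphere 0 1. nu x \<bullet> F x = 0"
    and not_flat: "\<not> (\<exists>a::real^'m. norm a = 1 \<and> F ` cball 0 1 = {p. norm p \<le> 1 \<and> p \<bullet> a = 0})"
  shows "(SUP x\<in>cball 0 1. sqA F nu x) ^ 2 > real CARD('n) * (INF x\<in>sphere 0 1. sqA F nu x)"
proof -
  have "\<forall>x\<in>sphere 0 1. norm (F x) = 1" using free_bdry_set by auto
  then interpret minimal_disk F nu U
    using dim smooth U immersion unit_normal minimal free_bdry_orth by unfold_locales
  let ?S = "SUP x\<in>cball 0 1. sqA F nu x" and ?I = "INF x\<in>sphere 0 1. sqA F nu x"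
  obtain z where z: "norm z \<le> 1" "\<And>y. norm y \<le> 1 \<Longrightarrow> sqA F nu y \<le> sqA F nu z"
    using max_on_cball[OF continuous_sqA] by blast
  \<comment> \<open>The attained maximum and nonnegativity give the boundedness that makes
    \<open>SUP\<close> and \<open>INF\<close> genuine bounds.\<close>
  have sup: "sqA F nu y \<le> ?S" if "norm y \<le> 1" for y
    using z that by (intro cSUP_upper bdd_aboveI2[of _ _ "sqA F nu z"]) auto
  have inf: "?I \<le> sqA F nu y" if "norm y = 1" for y
    using that sqA_nonneg by (intro cINF_lower bdd_belowI2[of _ 0]) auto
  have "\<exists>x. norm x \<le> 1 \<and> sqA F nu x \<noteq> 0"
  proof (rule ccontr)
    assume "\<not> (\<exists>x. norm x \<le> 1 \<and> sqA F nu x \<noteq> 0)"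
    then have "F ` cball 0 1 = {p. norm p \<le> 1 \<and> p \<bullet> nu 0 = 0}" by (intro flat_disk) blast
    moreover have "norm (nu 0) = 1" using unit_normal by simp
    ultimately show False using not_flat by blast
  qed
  then obtain x where x: "norm x \<le> 1" "sqA F nu x \<noteq> 0" by blast
  then have "sqA F nu x > 0" using sqA_nonneg[OF x(1)] by simp
  then have "?S > 0" using sup[OF x(1)] by simp
  from sqA_sup_inf[OF sup this inf] show ?thesis by simp
qed

end
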